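(* Let $\xi>0$ and let $\mu,f:\mathbb{R}\to\mathbb{R}$ satisfy: $\mu\in C^1(\mathbb{R})\cap L^\infty(\mathbb{R})$ is even, $\mu'<0$ in $(0,\infty)$, $\mu(\xi)=0$; and $f\in L^1(\mathbb{R})\cap L^\infty(\mathbb{R})\cap C(\mathbb{R})$ is odd with $f>0$ in $(0,\infty)$. Assume in addition that $\mu$ and $f$ are of class $C^2$ in a neighborhood of $-\xi$. Let $$a_*=\inf_{x\in(-\xi,0]}\frac{\sqrt{2}\,(\mu(x))^{3/2}}{3\int_{-\xi}^{x}|f|\sqrt{\mu}}\in(0,\infty),$$ and let $a\in(0,a_* )$. For small $\epsilon>0$ let $v_\epsilon$ be energy minimizing solutions in $H^1(\mathbb{R})$ of $$\epsilon^2v''(x)+\mu(x)v(x)-v^3(x)+\epsilon a f(x)=0,\quad x\in\mathbb{R},$$ normalized so that $v_\epsilon\to\sqrt{\mu^+}$ uniformly (and the unique zero $\rho_\epsilon$ of $v_\epsilon$ tends to $-\xi$) as $\epsilon\to0$. Let $Y$ be the energy minimizing (with respect to compactly supported perturbations) solution of the Painlevé-II equation $$y''(s)-sy(s)-2y^3(s)-\alpha=0,\quad s\in\mathbb{R},\qquad \alpha=\frac{a f(-\xi)}{\sqrt{2}\,\mu'(-\xi)}<0,$$ for which $$2^{-\frac12}\left(\mu'(-\xi)\epsilon\right)^{-\frac13}v_\epsilon\left(-\xi-\frac{\epsilon^{2/3}s}{(\mu'(-\xi))^{1/3}}\right)\to -Y(s)\quad\text{in } C^1_{loc}(\mathbb{R})\text{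 as }\epsilon\to0.$$ Then $Y$ changes sign exactly once on $\mathbb{R}$.
   Context: Here $\mu^+=\max\{\mu,0\}$. An energy minimizing solution $v_\epsilon$ in $H^1(\mathbb{R})$ is a global minimizer over $H^1(\mathbb{R})$ of the associated energy $$v\mapsto\int_{\mathbb{R}}\left\{\frac{\epsilon^2}{2}(v')^2-\frac{\mu}{2}v^2+\frac14v^4-\epsilon a f v\right\}dx.$$ Known facts (from earlier work), part of the setting: for every $\epsilon,a>0$ such minimizers exist and each has a unique zero $\rho_\epsilon$. Since $f$ is odd and $\mu$ is even, $v(x)\mapsto -v(-x)$ preserves the set of minimizers. If $a\in(0,a_* )$, then, up to this symmetry, $v_\epsilon\to\sqrt{\mu^+}$ uniformly and $\rho_\epsilon\to-\xi$ as $\epsilon\to0$; this is the normalization adopted. The rescaled convergence to $-Y$ displayed in the claim, with $Y$ an energy minimizing solution of the Painlevé-II equation, is likewise known from that earlier work. A solution $y:\mathbb{R}\to\mathbb{R}$ of $y''-sy-2y^3-\alpha=0$ is energy minimizing with respect to compactly supported perturbations (minimal in the sense of Morse / De Giorgi) if, for every $\phi\in C_0^\infty(\mathbb{R})$, $$\int_{\mathrm{supp}\,\phi}\left\{\tfrac12(y')^2+\tfrac12sy^2+\tfrac12y^4+\alpha y\right\}ds\le\int_{\mathrm{supp}\,\phi}\left\{\tfrac12(y'+\phi')^2+\tfrac12s(y+\phi)^2+\tfrac12(y+\phi)^4+\alpha(y+\phi)\right\}ds.$$ *)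

theory Defs
  imports "HOL-Analysis.Analysis"
begin

definition C2_on :: "real set \<Rightarrow> (real \<Rightarrow> real) \<Rightarrow> bool" where
  "C2_on S g \<longleftrightarrow> g C1_differentiable_on S \<and> deriv g C1_differentiable_on S"

definition supp :: "(real \<Rightarrow> real) \<Rightarrow> real set" where
  "supp \<phi> = closure {x. \<phi> x \<noteq> 0}"

definition test_function :: "(real \<Rightarrow> real) \<Rightarrow> bool" where
  "test_function \<phi> \<longleftrightarrow> (\<forall>k::nat. (deriv ^^ k) \<phi> differentiable_on UNIV) \<and> compact (supp \<phi>)"

definition square_integrable :: "(real \<Rightarrow> real) \<Rightarrow> bool" where
  "square_integrable u \<longleftrightarrow> u \<in> borel_measurable lborel \<and> integrable lborel (\<lambda>x. (u x)\<^sup>2)"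

definition has_weak_derivative :: "(real \<Rightarrow> real) \<Rightarrow> (real \<Rightarrow> real) \<Rightarrow> bool" where
  "has_weak_derivative u u' \<longleftrightarrow>
     (\<forall>\<phi>. test_function \<phi> \<longrightarrow>
        (LINT x|lborel. u x * deriv \<phi> x) = - (LINT x|lborel. u' x * \<phi> x))"

text \<open>
  An element of \<open>H\<^sup>1(\<real>)\<close> is represented by a function \<open>u\<close> together with a
  representative \<open>u'\<close> of its weak derivative.  As \<open>u'\<close> is determined by \<open>u\<close> almost everywhere,
  the energy below depends on \<open>u\<close> only.
\<close>

definition in_H1 :: "(real \<Rightarrow> real) \<Rightarrow> (real \<Rightarrow> real) \<Rightarrow> bool" where
  "in_H1 u u' \<longleftrightarrow> square_integrable u \<and> square_integrable u' \<and> has_weak_derivative u u'"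

definition energy ::
  "(real \<Rightarrow> real) \<Rightarrow> (real \<Rightarrow> real) \<Rightarrow> real \<Rightarrow> real \<Rightarrow> (real \<Rightarrow> real) \<Rightarrow> (real \<Rightarrow> real) \<Rightarrow> real" where
  "energy \<mu> f a \<epsilon> u u' =
     (LINT x|lborel. \<epsilon>\<^sup>2 / 2 * (u' x)\<^sup>2 - \<mu> x / 2 * (u x)\<^sup>2 + 1 / 4 * (u x) ^ 4 - \<epsilon> * a * f x * u x)"

definition H1_minimizer ::
  "(real \<Rightarrow> real) \<Rightarrow> (real \<Rightarrow> real) \<Rightarrow> real \<Rightarrow> real \<Rightarrow> (real \<Rightarrow> real) \<Rightarrow> bool" where
  "H1_minimizer \<mu> f a \<epsilon> v \<longleftrightarrow>
     (\<exists>v'. in_H1 v v' \<and>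
        (\<forall>w w'. in_H1 w w' \<longrightarrow> energy \<mu> f a \<epsilon> v v' \<le> energy \<mu> f a \<epsilon> w w'))"

text \<open>
  The differential equation is understood classically, which also singles out the continuous
  representative of the minimizer.
\<close>

definition energy_minimizing_solution ::
  "(real \<Rightarrow> real) \<Rightarrow> (real \<Rightarrow> real) \<Rightarrow> real \<Rightarrow> real \<Rightarrow> (real \<Rightarrow> real) \<Rightarrow> bool" where
  "energy_minimizing_solution \<mu> f a \<epsilon> v \<longleftrightarrow>
     C2_on UNIV v \<and>
     (\<forall>x. \<epsilon>\<^sup>2 * deriv (deriv v) x + \<mu> x * v x - (v x) ^ 3 + \<epsilon> * a * f x = 0) \<and>
     H1_minimizer \<mu> f a \<epsilon> v"

definition a_star :: "(real \<Rightarrow> real) \<Rightarrow> (real \<Rightarrow> real) \<Rightarrow> real \<Rightarrow> real" where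
  "a_star \<mu> f \<xi> =
     (INF x\<in>{-\<xi><..0}. sqrt 2 * \<mu> x powr (3/2) /
        (3 * (LINT t:{-\<xi>..x}|lborel. \<bar>f t\<bar> * sqrt (\<mu> t))))"

definition PII_solution :: "real \<Rightarrow> (real \<Rightarrow> real) \<Rightarrow> bool" where
  "PII_solution \<alpha> y \<longleftrightarrow>
     C2_on UNIV y \<and> (\<forall>s. deriv (deriv y) s - s * y s - 2 * (y s) ^ 3 - \<alpha> = 0)"

definition PII_minimal :: "real \<Rightarrow> (real \<Rightarrow> real) \<Rightarrow> bool" where
  "PII_minimal \<alpha> y \<longleftrightarrow>
     (\<forall>\<phi>. test_function \<phi> \<longrightarrow>
        (LINT s:supp \<phi>|lborel.
           1/2 * (deriv y s)\<^sup>2 + 1/2 * s * (y s)\<^sup>2 + 1/2 * (y s) ^ 4 + \<alpha> * y s)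
        \<le> (LINT s:supp \<phi>|lborel.
           1/2 * (deriv y s + deriv \<phi> s)\<^sup>2 + 1/2 * s * (y s + \<phi> s)\<^sup>2
             + 1/2 * (y s + \<phi> s) ^ 4 + \<alpha> * (y s + \<phi> s)))"

definition C1_loc_limit ::
  "('a \<Rightarrow> real \<Rightarrow> real) \<Rightarrow> (real \<Rightarrow> real) \<Rightarrow> 'a filter \<Rightarrow> bool" where
  "C1_loc_limit F G A \<longleftrightarrow>
     (\<forall>K. compact K \<longrightarrow>
        uniform_limit K F G A \<and> uniform_limit K (\<lambda>n. deriv (F n)) (deriv G) A)"

definition changes_sign_at :: "(real \<Rightarrow> real) \<Rightarrow> real \<Rightarrow> bool" where
  "changes_sign_at g s\<^sub>0 \<longleftrightarrow>
     (\<exists>\<delta>>0. \<forall>s\<in>{s\<^sub>0 - \<delta><..<s\<^sub>0}. \<forall>t\<in>{s\<^sub>0<..<s\<^sub>0 + \<delta>}. g s * g t < 0)"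

end

theory Submission
  imports Defs "HOL-Computational_Algebra.Polynomial"
begin

text \<open>
  Since \<open>v\<^sub>\<epsilon>\<close> is negative to the left of its zero \<open>\<rho>\<^sub>\<epsilon>\<close> and positive to the right, the limit \<open>Y\<close>
  is nonpositive to the left of some point and nonnegative to the right of it, unless \<open>Y\<close> has
  constant sign.  At a zero of \<open>Y\<close> with \<open>Y' = 0\<close> the equation gives \<open>Y'' = \<alpha> < 0\<close>, which makes the
  sign change strict.  A nonpositive \<open>Y\<close> would blow up in finite time.

  If \<open>Y\<close> were nonnegative, then \<open>\<rho>\<^sub>\<epsilon> + \<xi>\<close> would be large compared with \<open>\<epsilon>\<^bsup>2/3\<^esup>\<close>, and the following
  energy comparison rules this out.  The hypothesis \<open>a < a\<^sub>*\<close> gives \<open>a \<bar>f\<bar> < \<mu>' / \<surd>2\<close> near \<open>-\<xi>\<close>.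
  The inequality \<open>\<epsilon>\<^sup>2/2 v'\<^sup>2 + (v\<^sup>2 - \<mu>)\<^sup>2/4 \<ge> (\<epsilon>/\<surd>2) (\<mu> - v\<^sup>2) v' = (\<epsilon>/\<surd>2) ((\<mu> v - v\<^sup>3/3)' - \<mu>' v)\<close> is a
  calibration bounding the energy of \<open>v\<close> from below, from a point \<open>x\<^sub>1\<close> at distance of order
  \<open>\<epsilon>\<^bsup>2/3\<^esup>\<close> to the right of \<open>-\<xi>\<close>, where \<open>v < 0\<close>, up to the first point \<open>x\<^sub>2\<close> beyond \<open>\<rho>\<^sub>\<epsilon>\<close>
  where \<open>v = (1 - \<eta>) \<surd>\<mu>\<close>.  On that interval \<open>v \<le> (1 - \<eta>) \<surd>\<mu>\<close>, so \<open>\<surd>\<mu>\<close>, interpolated to the boundary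
  values of \<open>v\<close>, gains an amount of order \<open>\<epsilon> \<eta> \<mu>(x\<^sub>2)\<^bsup>3/2\<^esup>\<close> while the interpolation at \<open>x\<^sub>2\<close> costs only
  order \<open>\<epsilon> \<eta>\<^sup>2 \<mu>(x\<^sub>2)\<^bsup>3/2\<^esup>\<close>.  The remaining costs are of lower order because \<open>x\<^sub>2 + \<xi>\<close> is large compared
  with \<open>\<epsilon>\<^bsup>2/3\<^esup>\<close>.
\<close>

section \<open>Smooth bump functions and weak derivatives\<close>

text \<open>For positive x every derivative of exp (-1/x) is a polynomial in 1/x times exp (-1/x);
  keeping the polynomial as a parameter closes the family under differentiation.\<close>

definition flat_poly :: "real poly \<Rightarrow> real \<Rightarrow> real" where
  "flat_poly p x = (if x > 0 then poly p (1 / x) * exp (- (1 / x)) else 0)"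

lemma poly_times_exp_neg_tendsto_0:
  "((\<lambda>y. poly p y * exp (- y)) \<longlongrightarrow> (0::real)) at_top"
proof -
  have "((\<lambda>y. \<Sum>i\<le>degree p. coeff p i * (y ^ i / exp y)) \<longlongrightarrow> (\<Sum>i\<le>degree p. coeff p i * 0)) at_top"
    by (intro tendsto_intros tendsto_power_div_exp_0)
  then show ?thesis
    by (simp add: poly_altdef sum_distrib_right exp_minus divide_inverse mult.assoc)
qed

lemma flat_poly_tendsto_0: "(flat_poly p \<longlongrightarrow> 0) (at 0)"
proof -
  have "((\<lambda>x. poly p (1 / x) * exp (- (1 / x))) \<longlongrightarrow> 0) (at_right (0::real))"
    using filterlim_compose[OF poly_times_exp_neg_tendsto_0 filterlim_inverse_at_top_right]
    by (simp add: inverse_eq_divide)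
  moreover have "\<forall>\<^sub>F x in at_right (0::real). poly p (1 / x) * exp (- (1 / x)) = flat_poly p x"
    by (auto simp: eventually_at_filter flat_poly_def)
  ultimately have "(flat_poly p \<longlongrightarrow> 0) (at_right 0)"
    by (rule Lim_transform_eventually)
  moreover have "\<forall>\<^sub>F x in at_left (0::real). 0 = flat_poly p x"
    by (auto simp: eventually_at_filter flat_poly_def)
  then have "(flat_poly p \<longlongrightarrow> 0) (at_left 0)"
    by (rule Lim_transform_eventually[OF tendsto_const])
  ultimately show ?thesis
    by (simp add: filterlim_at_split)
qed

lemma flat_poly_has_derivative:
  "(flat_poly p has_real_derivative flat_poly ([:0, 0, 1:] * (p - pderiv p)) x) (at x)"
proof -
  consider "x > 0" | "x = 0" | "x < 0" by linarith
  then show ?thesis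
  proof cases
    case 1
    have "((\<lambda>x. poly p (1 / x) * exp (- (1 / x))) has_real_derivative
            flat_poly ([:0, 0, 1:] * (p - pderiv p)) x) (at x)"
      using 1 by (auto intro!: derivative_eq_intros DERIV_chain2[OF poly_DERIV]
          simp: flat_poly_def field_simps power2_eq_square)
    then show ?thesis
      by (rule has_field_derivative_transform_within_open[where S = "{0<..}"])
        (use 1 in \<open>auto simp: flat_poly_def\<close>)
  next
    case 2
    \<comment> \<open>Dividing by y multiplies the polynomial in 1/y by its variable, so the
      difference quotient at 0 is again a member of the family and tends to 0.\<close>
    have "(flat_poly p y - flat_poly p 0) / (y - 0) = flat_poly ([:0, 1:] * p) y" for y
      by (auto simp: flat_poly_def)
    then show ?thesis
      using 2 flat_poly_tendsto_0[of "[:0, 1:] * p"] flat_poly_def[of _ 0]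
      by (simp add: has_field_derivative_iff)
  next
    case 3
    have "((\<lambda>x. 0) has_real_derivative flat_poly ([:0, 0, 1:] * (p - pderiv p)) x) (at x)"
      using 3 by (simp add: flat_poly_def)
    then show ?thesis
      by (rule has_field_derivative_transform_within_open[where S = "{..<0}"])
        (use 3 in \<open>auto simp: flat_poly_def\<close>)
  qed
qed

text \<open>A family closed under differentiation, all of whose members are therefore smooth.\<close>

inductive_set flat_span :: "real \<Rightarrow> real \<Rightarrow> real \<Rightarrow> (real \<Rightarrow> real) set" for n a b where
  prod: "(\<lambda>x. flat_poly p (n * (x - a)) * flat_poly q (n * (b - x))) \<in> flat_span n a b"
| add: "g \<in> flat_span n a b \<Longrightarrow> h \<in> flat_span n a b \<Longrightarrow> (\<lambda>x. g x + h x) \<in> flat_span n a b"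

lemma flat_poly_smult: "flat_poly (smult c p) x = c * flat_poly p x"
  by (simp add: flat_poly_def)

lemma flat_span_derivative:
  assumes "g \<in> flat_span n a b"
  shows "\<exists>g'\<in>flat_span n a b. \<forall>x. (g has_real_derivative g' x) (at x)"
  using assms
proof induction
  case (prod p q)
  let ?D = "\<lambda>p. [:0, 0, 1:] * (p - pderiv p)"
  let ?g' = "\<lambda>x. flat_poly (smult n (?D p)) (n * (x - a)) * flat_poly q (n * (b - x))
               + flat_poly p (n * (x - a)) * flat_poly (smult (- n) (?D q)) (n * (b - x))"
  have "((\<lambda>x. flat_poly p (n * (x - a)) * flat_poly q (n * (b - x))) has_real_derivative ?g' x) (at x)" for x
    unfolding flat_poly_smult
    by (auto intro!: derivative_eq_intros DERIV_chain2[OF flat_poly_has_derivative] simp: mult_ac)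
  moreover have "?g' \<in> flat_span n a b"
    by (intro flat_span.intros)
  ultimately show ?case by (intro bexI[of _ ?g'] allI)
next
  case (add g h)
  then obtain g' h' where "g' \<in> flat_span n a b" "h' \<in> flat_span n a b"
    "\<And>x. (g has_real_derivative g' x) (at x)" "\<And>x. (h has_real_derivative h' x) (at x)" by blast
  then show ?case
    by (intro bexI[of _ "\<lambda>x. g' x + h' x"] allI DERIV_add flat_span.add) auto
qed

lemma flat_span_smooth:
  assumes "g \<in> flat_span n a b"
  shows "(deriv ^^ k) g differentiable_on UNIV"
proof -
  have "(deriv ^^ k) g \<in> flat_span n a b"
  proof (induction k)
    case (Suc k)
    then obtain g' where g': "g' \<in> flat_span n a b" "\<And>x. ((deriv ^^ k) g has_real_derivative g' x) (at x)"
      using flat_span_derivative by blast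
    then have "deriv ((deriv ^^ k) g) = g'"
      by (intro ext DERIV_imp_deriv)
    with g' show ?case by simp
  qed (simp add: assms)
  from flat_span_derivative[OF this] show ?thesis
    by (metis differentiable_on_def differentiable_at_withinI real_differentiable_def)
qed

text \<open>The factor \<open>n + 1\<close> turns \<open>exp (- 1 / x)\<close> into its \<open>(n + 1)\<close>-st root, so that bumps tend to an indicator.\<close>

definition bump :: "real \<Rightarrow> real \<Rightarrow> nat \<Rightarrow> real \<Rightarrow> real" where
  "bump a b n x = flat_poly 1 (real (Suc n) * (x - a)) * flat_poly 1 (real (Suc n) * (b - x))"

lemma flat_poly_one_bounds: "0 \<le> flat_poly 1 x" "flat_poly 1 x \<le> 1"
  by (auto simp: flat_poly_def)

lemma bump_bounds: "0 \<le> bump a b n x" "bump a b n x \<le> 1"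
  using flat_poly_one_bounds by (auto simp: bump_def intro: mult_le_one)

lemma bump_eq_0: "x \<le> a \<or> b \<le> x \<Longrightarrow> bump a b n x = 0"
  by (auto simp: bump_def flat_poly_def zero_less_mult_iff)

lemma bump_test_function: "test_function (bump a b n)"
proof -
  have "bump a b n \<in> flat_span (real (Suc n)) a b"
    unfolding bump_def by (rule flat_span.prod)
  moreover have "{x. bump a b n x \<noteq> 0} \<subseteq> {a..b}"
  proof
    fix x assume "x \<in> {x. bump a b n x \<noteq> 0}"
    then show "x \<in> {a..b}"
      using bump_eq_0[of x a b n] by (cases "x \<le> a \<or> b \<le> x") auto
  qed
  then have "supp (bump a b n) \<subseteq> {a..b}"
    unfolding supp_def by (simp add: closure_minimal)
  then have "compact (supp (bump a b n))"
    by (metis bounded_closed_interval bounded_subset closed_closure compact_eq_bounded_closed supp_def)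
  ultimately show ?thesis
    unfolding test_function_def using flat_span_smooth by blast
qed

lemma flat_poly_one_scaled_tendsto_1:
  assumes "y > 0"
  shows "(\<lambda>n. flat_poly 1 (real (Suc n) * y)) \<longlonglongrightarrow> 1"
proof -
  have "(\<lambda>n. exp (- (inverse (real (Suc n)) * (1 / y)))) \<longlonglongrightarrow> exp (- (0 * (1 / y)))"
    by (intro tendsto_intros LIMSEQ_inverse_real_of_nat)
  moreover have "exp (- (inverse (real (Suc n)) * (1 / y))) = flat_poly 1 (real (Suc n) * y)" for n
    using assms by (simp add: flat_poly_def inverse_eq_divide)
  ultimately show ?thesis by simp
qed

lemma bump_tendsto_indicator: "(\<lambda>n. bump a b n x) \<longlonglongrightarrow> indicator {a<..<b} x"
proof (cases "x \<in> {a<..<b}")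
  case True
  then show ?thesis
    using tendsto_mult[OF flat_poly_one_scaled_tendsto_1[of "x - a"] flat_poly_one_scaled_tendsto_1[of "b - x"]]
    by (simp add: bump_def)
qed (auto simp: bump_eq_0 not_less)

section \<open>Test functions and the fundamental lemma of the calculus of variations\<close>

lemma test_function_continuous: "test_function \<phi> \<Longrightarrow> continuous_on UNIV \<phi>"
  unfolding test_function_def by (metis differentiable_imp_continuous_on funpow_0)

lemma test_function_derivative:
  assumes "test_function \<phi>"
  shows "(\<phi> has_real_derivative deriv \<phi> x) (at x)" "continuous_on UNIV (deriv \<phi>)"
proof -
  have "(deriv ^^ 0) \<phi> differentiable_on UNIV" "(deriv ^^ 1) \<phi> differentiable_on UNIV"
    using assms unfolding test_function_def by blast+
  then show "(\<phi> has_real_derivative deriv \<phi> x) (at x)" "continuous_on UNIV (deriv \<phi>)"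
    by (auto simp: differentiable_on_def DERIV_deriv_iff_real_differentiable differentiable_imp_continuous_on)
qed

lemma test_function_support:
  assumes "test_function \<phi>"
  obtains M where "M > 0" "\<And>x. M \<le> \<bar>x\<bar> \<Longrightarrow> \<phi> x = 0" "\<And>x. M \<le> \<bar>x\<bar> \<Longrightarrow> deriv \<phi> x = 0"
proof -
  have "bounded (supp \<phi>)"
    using assms by (simp add: test_function_def compact_imp_bounded)
  then obtain M where M: "M > 0" "\<And>x. x \<in> supp \<phi> \<Longrightarrow> \<bar>x\<bar> \<le> M"
    by (metis bounded_pos real_norm_def)
  have z: "\<phi> x = 0" if "\<bar>x\<bar> > M" for x
  proof (rule ccontr)
    assume "\<phi> x \<noteq> 0"
    then have "x \<in> supp \<phi>"
      unfolding supp_def by (intro subsetD[OF closure_subset]) simp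
    with M(2) that show False by force
  qed
  have "deriv \<phi> x = 0" if "\<bar>x\<bar> > M" for x
  proof -
    have "((\<lambda>x. 0) has_real_derivative 0) (at x)" by simp
    then have "(\<phi> has_real_derivative 0) (at x)"
    proof (rule has_field_derivative_transform_within_open[where S = "{x. \<bar>x\<bar> > M}"])
      show "open {x::real. \<bar>x\<bar> > M}" by (intro open_Collect_less continuous_intros)
    qed (use that z in auto)
    then show ?thesis by (rule DERIV_imp_deriv)
  qed
  with z M(1) show thesis by (intro that[of "M + 1"]) auto
qed

text \<open>Half-lines form an intersection-stable generator of the Borel sets, the sets over which
  \<open>g\<close> integrates to zero are closed under complements and countable disjoint unions,
  and a density with zero integral over every Borel set vanishes almost everywhere.\<close>

lemma AE_eq_0_if_intervals_integral_0:
  fixes g :: "real \<Rightarrow> real"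
  assumes g: "integrable lborel g" and zero: "\<And>a. (LINT x:{..a}|lborel. g x) = 0"
  shows "AE x in lborel. g x = 0"
proof -
  \<comment> \<open>Closure under complements needs the integral over the whole line, which is a
    limit over half-lines.\<close>
  have UNIV0: "(LINT x|lborel. g x) = 0"
  proof -
    have "(\<lambda>n. LINT x:{..real n}|lborel. g x) \<longlonglongrightarrow> (LINT x|lborel. g x)"
      unfolding set_lebesgue_integral_def
    proof (rule integral_dominated_convergence[where w = "\<lambda>x. \<bar>g x\<bar>"])
      show "AE x in lborel. (\<lambda>n. indicator {..real n} x *\<^sub>R g x) \<longlonglongrightarrow> g x"
      proof (rule AE_I2)
        fix x :: real
        have "\<forall>\<^sub>F n in sequentially. g x = indicator {..real n} x *\<^sub>R g x"
          using eventually_ge_at_top[of "nat \<lceil>x\<rceil>"] by eventually_elim (auto simp: nat_le_iff ceiling_le_iff)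
        then show "(\<lambda>n. indicator {..real n} x *\<^sub>R g x) \<longlonglongrightarrow> g x"
          by (rule Lim_transform_eventually[OF tendsto_const])
      qed
    qed (use g in \<open>auto simp: indicator_def\<close>)
    then show ?thesis
      by (simp add: zero LIMSEQ_const_iff)
  qed
  have set0: "(LINT x:A|lborel. g x) = 0" if "A \<in> sets borel" for A
  proof -
    have A: "A \<in> sigma_sets UNIV (range atMost)"
      using that by (simp add: borel_eq_atMost)
    have 1: "Int_stable (range (atMost :: real \<Rightarrow> real set))"
      by (auto simp: Int_stable_def)
    have 2: "range (atMost :: real \<Rightarrow> real set) \<subseteq> Pow UNIV" by simp
    from 1 2 A show ?thesis
    proof (induction rule: sigma_sets_induct_disjoint)
      case (basic A)
      then show ?case using zero by auto
    next
      case (compl A)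
      then have A: "A \<in> sets lborel" by (simp add: borel_eq_atMost)
      have "(LINT x:UNIV - A|lborel. g x) = (LINT x|lborel. g x) - (LINT x:A|lborel. g x)"
        unfolding set_lebesgue_integral_def
        by (subst Bochner_Integration.integral_diff[OF g integrable_mult_indicator[OF A g], symmetric])
          (auto intro!: Bochner_Integration.integral_cong simp: indicator_def)
      with compl UNIV0 show ?case by simp
    next
      case (union A)
      then have A: "\<And>i. A i \<in> sets lborel" by (simp add: borel_eq_atMost range_subsetD)
      have "set_integrable lborel (\<Union>i. A i) g"
        using g A unfolding set_integrable_def by (intro integrable_mult_indicator) auto
      then have "(LINT x:(\<Union>i. A i)|lborel. g x) = (\<Sum>i. LINT x:A i|lborel. g x)"
        using union A by (intro lebesgue_integral_countable_add) (auto simp: disjoint_family_on_def)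
      with union show ?case by simp
    next
      case empty
      then show ?case by (simp add: set_lebesgue_integral_def)
    qed
  qed
  show ?thesis
    by (rule density_unique_real[OF g integrable_zero]) (simp add: set0)
qed

text \<open>The fundamental lemma of the calculus of variations: the bumps converge boundedly to
  indicators of open intervals, so \<open>g\<close> integrates to zero over each of these.\<close>

lemma AE_eq_0_if_test_integrals_0:
  fixes g :: "real \<Rightarrow> real"
  assumes loc: "\<And>A B. set_integrable lborel {A..B} g"
    and zero: "\<And>\<phi>. test_function \<phi> \<Longrightarrow> (LINT x|lborel. g x * \<phi> x) = 0"
  shows "AE x in lborel. g x = 0"
proof -
  have int0: "(LINT x|lborel. g x * indicator {a<..<b} x) = 0" for a b
  proof -
    have [measurable]: "(\<lambda>x. bump a b n x) \<in> borel_measurable borel" for n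
      by (intro borel_measurable_continuous_onI test_function_continuous bump_test_function)
    have gi: "integrable lborel (\<lambda>x. indicator {a..b} x * g x)"
      using loc by (simp add: set_integrable_def)
    then have [measurable]: "(\<lambda>x. indicator {a..b} x * g x) \<in> borel_measurable borel"
      by (auto dest: borel_measurable_integrable)
    have "(\<lambda>n. LINT x|lborel. indicator {a..b} x * g x * bump a b n x) \<longlonglongrightarrow>
          (LINT x|lborel. indicator {a..b} x * g x * indicator {a<..<b} x)"
    proof (rule integral_dominated_convergence[where w = "\<lambda>x. \<bar>indicator {a..b} x * g x\<bar>"])
      show "AE x in lborel. (\<lambda>n. indicator {a..b} x * g x * bump a b n x)
             \<longlonglongrightarrow> indicator {a..b} x * g x * indicator {a<..<b} x"
        by (intro AE_I2 tendsto_intros bump_tendsto_indicator)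
      show "AE x in lborel. norm (indicator {a..b} x * g x * bump a b n x) \<le> \<bar>indicator {a..b} x * g x\<bar>" for n
        using bump_bounds[of a b n] by (intro AE_I2) (simp add: abs_mult mult_left_le)
    qed (use gi in auto)
    moreover have "(LINT x|lborel. indicator {a..b} x * g x * bump a b n x) = 0" for n
    proof -
      have "indicator {a..b} x * g x * bump a b n x = g x * bump a b n x" for x
        using bump_eq_0[of x a b n] by (cases "x \<le> a \<or> b \<le> x") (auto simp: indicator_def)
      then show ?thesis by (simp only: zero[OF bump_test_function])
    qed
    moreover have "indicator {a..b} x * g x * indicator {a<..<b} x = g x * indicator {a<..<b} x" for x
      by (auto simp: indicator_def)
    ultimately show ?thesis
      by (simp add: LIMSEQ_const_iff)
  qed
  \<comment> \<open>\<open>g\<close> is only locally integrable, but its truncation to (-N, N) falls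
    under the criterion for half-lines. Countably many N exhaust the line.\<close>
  have "AE x in lborel. indicator {- real N<..<real N} x * g x = 0" for N
  proof (rule AE_eq_0_if_intervals_integral_0)
    let ?N = "real N"
    have "set_integrable lborel {-?N<..<?N} g"
      by (rule set_integrable_subset[OF loc[of "-?N" ?N]]) auto
    then show "integrable lborel (\<lambda>x. indicator {-?N<..<?N} x * g x)"
      by (simp add: set_integrable_def)
    fix a
    have "(LINT x:{..a}|lborel. indicator {-?N<..<?N} x * g x) = (LINT x|lborel. g x * indicator {-?N<..<min a ?N} x)"
      unfolding set_lebesgue_integral_def
    proof (rule integral_cong_AE)
      have m: "set_borel_measurable lborel {- \<bar>?N\<bar>..\<bar>?N\<bar>} g"
        using loc by (simp add: set_integrable_def set_borel_measurable_def borel_measurable_integrable)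
      then have [measurable]: "(\<lambda>x. indicator {-?N..?N} x * g x) \<in> borel_measurable borel"
        by (simp add: set_borel_measurable_def)
      have "indicat_real {..a} x *\<^sub>R (indicat_real {-?N<..<?N} x * g x)
              = indicat_real {..a} x * indicat_real {-?N<..<?N} x * (indicator {-?N..?N} x * g x)" for x
        by (auto simp: indicator_def)
      then show "(\<lambda>x. indicat_real {..a} x *\<^sub>R (indicat_real {-?N<..<?N} x * g x)) \<in> borel_measurable lborel"
        by (simp only:) measurable
      have "g x * indicat_real {-?N<..<min a ?N} x
              = indicat_real {-?N<..<min a ?N} x * (indicator {-?N..?N} x * g x)" for x
        by (auto simp: indicator_def)
      then show "(\<lambda>x. g x * indicat_real {-?N<..<min a ?N} x) \<in> borel_measurable lborel"
        by (simp only:) measurable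
      \<comment> \<open>The half-line contains its endpoint \<open>a\<close>, the open interval does
        not, so the two integrands agree only off a null set.\<close>
      have "AE x in lborel. x \<noteq> a" by (rule AE_lborel_singleton)
      then show "AE x in lborel. indicat_real {..a} x *\<^sub>R (indicat_real {-?N<..<?N} x * g x)
                   = g x * indicat_real {-?N<..<min a ?N} x"
        by eventually_elim (auto simp: indicator_def)
    qed
    with int0 show "(LINT x:{..a}|lborel. indicator {-?N<..<?N} x * g x) = 0" by simp
  qed
  then have "AE x in lborel. \<forall>N. indicator {- real N<..<real N} x * g x = 0"
    by (subst AE_all_countable) blast
  then show ?thesis
  proof eventually_elim
    case (elim x)
    obtain N where "\<bar>x\<bar> < real N" using reals_Archimedean2 by blast
    with elim[rule_format, of N] show ?case by (auto simp: indicator_def abs_less_iff split: if_splits)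
  qed
qed

section \<open>Local integrability, integration by parts, and perturbations in H^1\<close>

lemma set_integrable_continuous:
  fixes g :: "real \<Rightarrow> real"
  shows "continuous_on {A..B} g \<Longrightarrow> set_integrable lborel {A..B} g"
  unfolding set_integrable_def by (rule borel_integrable_compact) auto

lemma set_integrable_bounded:
  fixes g :: "real \<Rightarrow> real"
  assumes [measurable]: "g \<in> borel_measurable borel" and "\<And>x. x \<in> {A..B} \<Longrightarrow> \<bar>g x\<bar> \<le> C"
  shows "set_integrable lborel {A..B} g"
  unfolding set_integrable_def
proof (rule Bochner_Integration.integrable_bound[where f = "\<lambda>x. indicator {A..B} x * C"])
  show "integrable lborel (\<lambda>x. indicator {A..B} x * C)"
    by (intro integrable_mult_left integrable_real_indicator) (auto simp: emeasure_lborel_Icc_eq)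
qed (use assms in \<open>auto simp: indicator_def intro!: AE_I2 order_trans[OF _ abs_ge_self]\<close>)

lemma set_integrable_mult_continuous:
  fixes g \<psi> :: "real \<Rightarrow> real"
  assumes g: "set_integrable lborel {A..B} g" and \<psi>: "continuous_on UNIV \<psi>"
  shows "set_integrable lborel {A..B} (\<lambda>x. g x * \<psi> x)"
proof -
  have "bounded (\<psi> ` {A..B})"
    by (intro compact_imp_bounded compact_continuous_image continuous_on_subset[OF \<psi>]) auto
  then obtain C where C: "\<And>x. x \<in> {A..B} \<Longrightarrow> \<bar>\<psi> x\<bar> \<le> C"
    unfolding bounded_iff by fastforce
  have [measurable]: "\<psi> \<in> borel_measurable borel"
    using \<psi> by (rule borel_measurable_continuous_onI)
  have gi: "integrable lborel (\<lambda>x. indicator {A..B} x * g x)"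
    using g by (simp add: set_integrable_def)
  then have [measurable]: "(\<lambda>x. indicator {A..B} x * g x) \<in> borel_measurable borel"
    by (auto dest: borel_measurable_integrable)
  have "integrable lborel (\<lambda>x. (indicator {A..B} x * g x) * \<psi> x)"
  proof (rule Bochner_Integration.integrable_bound[where f = "\<lambda>x. C * (indicator {A..B} x * g x)"])
    show "AE x in lborel. norm (indicat_real {A..B} x * g x * \<psi> x) \<le> norm (C * (indicat_real {A..B} x * g x))"
    proof (rule AE_I2)
      fix x
      show "norm (indicat_real {A..B} x * g x * \<psi> x) \<le> norm (C * (indicat_real {A..B} x * g x))"
      proof (cases "x \<in> {A..B}")
        case True
        then have "\<bar>\<psi> x\<bar> \<le> \<bar>C\<bar>" using C by fastforce
        then show ?thesis using True
          by (simp add: abs_mult mult.commute[of "\<bar>g x\<bar>"] mult_right_mono)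
      qed simp
    qed
  qed (use gi in auto)
  then show ?thesis by (simp add: set_integrable_def mult.assoc)
qed

text \<open>The product with \<phi> vanishes at -M and M, so the boundary terms drop. The finite set
  \<open>S\<close> admits the corners of piecewise defined competitors.\<close>

lemma integral_by_parts_test_function:
  assumes h: "continuous_on UNIV h" and S: "finite S"
    and deriv: "\<And>x. x \<notin> S \<Longrightarrow> (h has_real_derivative h' x) (at x)"
    and loc: "\<And>A B. set_integrable lborel {A..B} h'" and \<phi>: "test_function \<phi>"
  shows "integrable lborel (\<lambda>x. h' x * \<phi> x)"
    and "(LINT x|lborel. h x * deriv \<phi> x) = - (LINT x|lborel. h' x * \<phi> x)"
proof -
  obtain M where M: "M > 0" "\<And>x. M \<le> \<bar>x\<bar> \<Longrightarrow> \<phi> x = 0" "\<And>x. M \<le> \<bar>x\<bar> \<Longrightarrow> deriv \<phi> x = 0"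
    by (rule test_function_support[OF \<phi>]) (rule that)
  note \<phi>' = test_function_derivative[OF \<phi>] test_function_continuous[OF \<phi>]
  have i1: "set_integrable lborel {-M..M} (\<lambda>x. h' x * \<phi> x)"
    by (intro set_integrable_mult_continuous loc \<phi>')
  have i2: "set_integrable lborel {-M..M} (\<lambda>x. h x * deriv \<phi> x)"
    by (intro set_integrable_continuous continuous_intros continuous_on_subset[OF h] continuous_on_subset[OF \<phi>'(2)]) auto
  have e1: "indicator {-M..M} x * (h' x * \<phi> x) = h' x * \<phi> x" for x
    using M(2)[of x] by (cases "M \<le> \<bar>x\<bar>") (auto simp: indicator_def)
  have e2: "indicator {-M..M} x * (h x * deriv \<phi> x) = h x * deriv \<phi> x" for x
    using M(3)[of x] by (cases "M \<le> \<bar>x\<bar>") (auto simp: indicator_def)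
  show "integrable lborel (\<lambda>x. h' x * \<phi> x)"
    using i1 by (simp add: set_integrable_def e1)
  have "((\<lambda>x. h' x * \<phi> x + h x * deriv \<phi> x) has_integral (h M * \<phi> M - h (-M) * \<phi> (-M))) {-M..M}"
  proof (rule fundamental_theorem_of_calculus_interior_strong[OF S])
    show "((\<lambda>x. h x * \<phi> x) has_vector_derivative h' x * \<phi> x + h x * deriv \<phi> x) (at x)"
      if "x \<in> {-M<..<M} - S" for x
      using that DERIV_mult[OF deriv[of x] \<phi>'(1)[of x]]
      by (simp add: has_real_derivative_iff_has_vector_derivative[symmetric] algebra_simps)
    show "continuous_on {-M..M} (\<lambda>x. h x * \<phi> x)"
      by (intro continuous_intros continuous_on_subset[OF h] continuous_on_subset[OF \<phi>'(3)]) auto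
  qed (use M in auto)
  moreover have "h M * \<phi> M - h (-M) * \<phi> (-M) = 0"
    using M(2)[of M] M(2)[of "-M"] by simp
  ultimately have "(LINT x:{-M..M}|lborel. h' x * \<phi> x + h x * deriv \<phi> x) = 0"
    using set_borel_integral_eq_integral(2)[OF set_integral_add(1)[OF i1 i2]] by (simp add: integral_unique)
  then have "(LINT x:{-M..M}|lborel. h' x * \<phi> x) + (LINT x:{-M..M}|lborel. h x * deriv \<phi> x) = 0"
    using set_integral_add(2)[OF i1 i2] by simp
  then show "(LINT x|lborel. h x * deriv \<phi> x) = - (LINT x|lborel. h' x * \<phi> x)"
    by (simp add: set_lebesgue_integral_def e1 e2)
qed

lemma square_integrable_imp_locally_integrable:
  assumes "square_integrable u"
  shows "set_integrable lborel {A..B} u"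
proof -
  have [measurable]: "u \<in> borel_measurable borel" and u: "integrable lborel (\<lambda>x. (u x)\<^sup>2)"
    using assms by (auto simp: square_integrable_def)
  show ?thesis
    unfolding set_integrable_def
  proof (rule Bochner_Integration.integrable_bound[where f = "\<lambda>x. indicator {A..B} x + (u x)\<^sup>2"])
    show "integrable lborel (\<lambda>x. indicat_real {A..B} x + (u x)\<^sup>2)"
      by (intro Bochner_Integration.integrable_add u integrable_real_indicator) (auto simp: emeasure_lborel_Icc_eq)
    have "\<bar>y\<bar> \<le> 1 + y\<^sup>2" for y :: real
      using zero_le_power2[of "\<bar>y\<bar> - 1"] by (simp add: power2_diff)
    then show "AE x in lborel. norm (indicat_real {A..B} x *\<^sub>R u x) \<le> norm (indicat_real {A..B} x + (u x)\<^sup>2)"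
      by (intro AE_I2) (auto simp: indicator_def)
  qed simp
qed

text \<open>Integration by parts shows that the classical derivative satisfies the defining identity
  of the weak one, and the fundamental lemma identifies the two. The energy, stated with some weak
  derivative, can thus be computed with the classical one.\<close>

lemma weak_derivative_eq_deriv_AE:
  assumes v: "\<And>x. (v has_real_derivative v' x) (at x)" and v': "continuous_on UNIV v'"
    and W: "square_integrable W" and weak: "has_weak_derivative v W"
  shows "AE x in lborel. W x = v' x"
proof -
  have v'_loc: "set_integrable lborel {A..B} v'" for A B
    by (intro set_integrable_continuous continuous_on_subset[OF v']) auto
  note W_loc = square_integrable_imp_locally_integrable[OF W]
  have vc: "continuous_on UNIV v"
    using v by (auto intro!: continuous_at_imp_continuous_on DERIV_isCont)
  have "AE x in lborel. W x - v' x = 0"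
  proof (rule AE_eq_0_if_test_integrals_0)
    show "set_integrable lborel {A..B} (\<lambda>x. W x - v' x)" for A B
      by (intro set_integral_diff W_loc v'_loc)
    fix \<phi> assume \<phi>: "test_function \<phi>"
    obtain M where M: "\<And>x. M \<le> \<bar>x\<bar> \<Longrightarrow> \<phi> x = 0"
      by (rule test_function_support[OF \<phi>]) (rule that)
    have "set_integrable lborel {-M..M} (\<lambda>x. W x * \<phi> x)"
      by (intro set_integrable_mult_continuous W_loc test_function_continuous \<phi>)
    moreover have "indicator {-M..M} x * (W x * \<phi> x) = W x * \<phi> x" for x
      using M[of x] by (cases "M \<le> \<bar>x\<bar>"; auto simp: indicator_def)+
    ultimately have i: "integrable lborel (\<lambda>x. W x * \<phi> x)"
      by (simp add: set_integrable_def)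
    note parts = integral_by_parts_test_function[OF vc finite.emptyI v v'_loc \<phi>]
    have "(LINT x|lborel. W x * \<phi> x) = (LINT x|lborel. v' x * \<phi> x)"
      using weak \<phi> parts(2) by (simp add: has_weak_derivative_def)
    with i parts(1) show "(LINT x|lborel. (W x - v' x) * \<phi> x) = 0"
      by (simp add: left_diff_distrib)
  qed
  then show ?thesis by simp
qed

lemma square_integrable_add:
  assumes "square_integrable u" "square_integrable w"
  shows "square_integrable (\<lambda>x. u x + w x)"
  unfolding square_integrable_def
proof
  have [measurable]: "u \<in> borel_measurable borel" "w \<in> borel_measurable borel"
    using assms by (auto simp: square_integrable_def)
  show "(\<lambda>x. u x + w x) \<in> borel_measurable lborel"
    by measurable
  show "integrable lborel (\<lambda>x. (u x + w x)\<^sup>2)"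
  proof (rule Bochner_Integration.integrable_bound[where f = "\<lambda>x. 2 * (u x)\<^sup>2 + 2 * (w x)\<^sup>2"])
    show "integrable lborel (\<lambda>x. 2 * (u x)\<^sup>2 + 2 * (w x)\<^sup>2)"
      using assms by (auto simp: square_integrable_def)
    have "(y + z)\<^sup>2 \<le> 2 * y\<^sup>2 + 2 * z\<^sup>2" for y z :: real
      using zero_le_power2[of "y - z"] by (simp add: power2_diff power2_sum)
    then show "AE x in lborel. norm ((u x + w x)\<^sup>2) \<le> norm (2 * (u x)\<^sup>2 + 2 * (w x)\<^sup>2)"
      by (intro AE_I2) simp
  qed measurable
qed

lemma square_integrable_bounded_support:
  assumes [measurable]: "u \<in> borel_measurable borel" and "\<And>x. \<bar>u x\<bar> \<le> C"
    and "\<And>x. x \<notin> {A..B} \<Longrightarrow> u x = 0"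
  shows "square_integrable u"
proof -
  have "set_integrable lborel {A..B} (\<lambda>x. (u x)\<^sup>2)"
  proof (rule set_integrable_bounded[where C = "C\<^sup>2"])
    show "\<bar>(u x)\<^sup>2\<bar> \<le> C\<^sup>2" for x
      using power_mono[OF assms(2)[of x], of 2] by simp
  qed measurable
  moreover have "indicator {A..B} x * (u x)\<^sup>2 = (u x)\<^sup>2" for x
    using assms(3)[of x] by (auto simp: indicator_def)
  ultimately show ?thesis
    by (simp add: square_integrable_def set_integrable_def)
qed

text \<open>Gluing a competitor into \<open>v\<close> on a bounded interval changes it by such an
  \<open>h\<close>: continuous, with finitely many corners and bounded support.\<close>

lemma in_H1_perturb:
  assumes v: "in_H1 v W" and h: "continuous_on UNIV h" and S: "finite S"
    and deriv: "\<And>x. x \<notin> S \<Longrightarrow> (h has_real_derivative h' x) (at x)"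
    and h'[measurable]: "h' \<in> borel_measurable borel" and bd: "\<And>x. \<bar>h' x\<bar> \<le> C"
    and supp: "\<And>x. x \<notin> {A..B} \<Longrightarrow> h x = 0" "\<And>x. x \<notin> {A..B} \<Longrightarrow> h' x = 0"
  shows "in_H1 (\<lambda>x. v x + h x) (\<lambda>x. W x + h' x)"
proof -
  have "bounded (h ` {A..B})"
    by (intro compact_imp_bounded compact_continuous_image continuous_on_subset[OF h]) auto
  then obtain D where D: "\<And>x. x \<in> {A..B} \<Longrightarrow> \<bar>h x\<bar> \<le> D"
    unfolding bounded_iff by fastforce
  have hD: "\<bar>h x\<bar> \<le> \<bar>D\<bar>" for x
    using supp(1)[of x] order_trans[OF D abs_ge_self, of x] by (cases "x \<in> {A..B}") auto
  have sh: "square_integrable h"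
    by (rule square_integrable_bounded_support[OF borel_measurable_continuous_onI[OF h] hD supp(1)])
  have sh': "square_integrable h'"
    by (rule square_integrable_bounded_support[OF h' bd supp(2)])
  have v': "square_integrable v" "square_integrable W" "has_weak_derivative v W"
    using v by (auto simp: in_H1_def)
  have "has_weak_derivative (\<lambda>x. v x + h x) (\<lambda>x. W x + h' x)"
    unfolding has_weak_derivative_def
  proof (intro allI impI)
    fix \<phi> assume \<phi>: "test_function \<phi>"
    obtain M where "M > 0" and M: "\<And>x. M \<le> \<bar>x\<bar> \<Longrightarrow> \<phi> x = 0" "\<And>x. M \<le> \<bar>x\<bar> \<Longrightarrow> deriv \<phi> x = 0"
      by (rule test_function_support[OF \<phi>]) (rule that)
    have i: "integrable lborel (\<lambda>x. g x * \<phi> x)" "integrable lborel (\<lambda>x. g x * deriv \<phi> x)" if "square_integrable g" for g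
    proof -
      have "set_integrable lborel {-M..M} (\<lambda>x. g x * \<phi> x)" "set_integrable lborel {-M..M} (\<lambda>x. g x * deriv \<phi> x)"
        by (rule set_integrable_mult_continuous[OF square_integrable_imp_locally_integrable[OF that]],
            rule test_function_continuous[OF \<phi>] test_function_derivative(2)[OF \<phi>])+
      moreover have "indicator {-M..M} x * (g x * \<phi> x) = g x * \<phi> x"
        "indicator {-M..M} x * (g x * deriv \<phi> x) = g x * deriv \<phi> x" for x
        using M[of x] by (cases "M \<le> \<bar>x\<bar>"; auto simp: indicator_def)+
      ultimately show "integrable lborel (\<lambda>x. g x * \<phi> x)" "integrable lborel (\<lambda>x. g x * deriv \<phi> x)"
        by (simp_all add: set_integrable_def)
    qed
    have "(LINT x|lborel. h x * deriv \<phi> x) = - (LINT x|lborel. h' x * \<phi> x)"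
      by (rule integral_by_parts_test_function(2)[OF h S deriv _ \<phi>])
        (auto intro: square_integrable_imp_locally_integrable sh')
    then show "(LINT x|lborel. (v x + h x) * deriv \<phi> x) = - (LINT x|lborel. (W x + h' x) * \<phi> x)"
      using v'(3)[unfolded has_weak_derivative_def, rule_format, OF \<phi>]
      by (simp add: distrib_right i v' sh sh')
  qed
  with v' sh sh' show ?thesis
    by (simp add: in_H1_def square_integrable_add)
qed

section \<open>Local comparison for minimizers\<close>

text \<open>
  This is the energy density plus \<open>\<mu>\<^sup>2 / 4\<close>, which does not depend on the competitor and need not
  be integrable on the line.
\<close>

definition lagrangian ::
  "(real \<Rightarrow> real) \<Rightarrow> (real \<Rightarrow> real) \<Rightarrow> real \<Rightarrow> real \<Rightarrow> real \<Rightarrow> real \<Rightarrow> real \<Rightarrow> real" where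
  "lagrangian \<mu> f a \<epsilon> x y p = \<epsilon>\<^sup>2 / 2 * p\<^sup>2 + (y\<^sup>2 - \<mu> x)\<^sup>2 / 4 - \<epsilon> * a * f x * y"

lemma set_integrable_lagrangian:
  assumes \<mu>: "continuous_on UNIV \<mu>" and f: "continuous_on UNIV f" and w: "continuous_on {A..B} w"
    and [measurable]: "w' \<in> borel_measurable borel" and w'_bd: "\<And>x. x \<in> {A..B} \<Longrightarrow> \<bar>w' x\<bar> \<le> C"
  shows "set_integrable lborel {A..B} (\<lambda>x. lagrangian \<mu> f a \<epsilon> x (w x) (w' x))"
proof -
  have 1: "set_integrable lborel {A..B} (\<lambda>x. \<epsilon>\<^sup>2 / 2 * (w' x)\<^sup>2)"
  proof (rule set_integrable_bounded[where C = "\<epsilon>\<^sup>2 / 2 * C\<^sup>2"])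
    show "\<bar>\<epsilon>\<^sup>2 / 2 * (w' x)\<^sup>2\<bar> \<le> \<epsilon>\<^sup>2 / 2 * C\<^sup>2" if "x \<in> {A..B}" for x
      using power_mono[OF w'_bd[OF that], of 2] by (simp add: mult_left_mono)
  qed measurable
  have 2: "set_integrable lborel {A..B} (\<lambda>x. (w x ^ 2 - \<mu> x)\<^sup>2 / 4 - \<epsilon> * a * f x * w x)"
    by (intro set_integrable_continuous continuous_intros w
        continuous_on_subset[OF \<mu>] continuous_on_subset[OF f]) auto
  show ?thesis
    using set_integral_add(1)[OF 1 2] by (simp add: lagrangian_def add_diff_eq)
qed

lemma C2_on_UNIV_derivatives:
  assumes "C2_on UNIV v"
  shows "(v has_real_derivative deriv v x) (at x)"
    and "(deriv v has_real_derivative deriv (deriv v) x) (at x)"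
    and "continuous_on UNIV (deriv v)" and "continuous_on UNIV v"
proof -
  have "v differentiable at x" "deriv v differentiable at x" for x
    using assms by (auto simp: C2_on_def C1_differentiable_on_eq)
  then show d: "(v has_real_derivative deriv v x) (at x)"
    "(deriv v has_real_derivative deriv (deriv v) x) (at x)" for x
    by (simp_all add: DERIV_deriv_iff_real_differentiable)
  show "continuous_on UNIV (deriv v)" "continuous_on UNIV v"
    by (auto intro!: continuous_at_imp_continuous_on DERIV_isCont[OF d(1)] DERIV_isCont[OF d(2)])
qed

text \<open>Boundedness of \<open>v\<close> dominates the quartic term by a multiple of v^2 and the
  forcing term by a multiple of |f|. Integrability is what lets energies be split; a nonintegrable
  density would have integral 0 by convention.\<close>

lemma energy_density_integrable:
  assumes v: "in_H1 v W" and bd: "\<And>x. \<bar>v x\<bar> \<le> V"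
    and \<mu>[measurable]: "\<mu> \<in> borel_measurable borel" and \<mu>_bd: "\<And>x. \<bar>\<mu> x\<bar> \<le> m"
    and f: "integrable lborel f"
  shows "integrable lborel (\<lambda>x. \<epsilon>\<^sup>2 / 2 * (W x)\<^sup>2 - \<mu> x / 2 * (v x)\<^sup>2 + 1 / 4 * (v x) ^ 4 - \<epsilon> * a * f x * v x)"
proof -
  have [measurable]: "v \<in> borel_measurable borel" "W \<in> borel_measurable borel" "f \<in> borel_measurable borel"
    and i: "integrable lborel (\<lambda>x. (v x)\<^sup>2)" "integrable lborel (\<lambda>x. (W x)\<^sup>2)"
    using v f by (auto simp: in_H1_def square_integrable_def dest: borel_measurable_integrable)
  have bd': "\<bar>v x\<bar> \<le> \<bar>V\<bar>" "\<bar>\<mu> x\<bar> \<le> \<bar>m\<bar>" for x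
    using order_trans[OF bd abs_ge_self] order_trans[OF \<mu>_bd abs_ge_self] by auto
  have 1: "integrable lborel (\<lambda>x. \<mu> x * (v x)\<^sup>2)"
    by (rule Bochner_Integration.integrable_bound[where f = "\<lambda>x. m * (v x)\<^sup>2"])
      (use i bd' in \<open>auto intro!: AE_I2 mult_right_mono simp: abs_mult\<close>)
  have 2: "integrable lborel (\<lambda>x. (v x) ^ 4)"
  proof (rule Bochner_Integration.integrable_bound[where f = "\<lambda>x. V\<^sup>2 * (v x)\<^sup>2"])
    have *: "(v x) ^ 4 = (v x)\<^sup>2 * (v x)\<^sup>2" "(v x)\<^sup>2 \<le> V\<^sup>2" for x
      using bd'(1) by (simp_all add: power4_eq_xxxx power2_eq_square abs_le_square_iff)
    have "(v x) ^ 4 \<le> V\<^sup>2 * (v x)\<^sup>2" for x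
      unfolding *(1) by (rule mult_right_mono[OF *(2)]) simp
    then show "AE x in lborel. norm (v x ^ 4) \<le> norm (V\<^sup>2 * (v x)\<^sup>2)"
      by (intro AE_I2) simp
  qed (use i in auto)
  have 3: "integrable lborel (\<lambda>x. f x * v x)"
    by (rule Bochner_Integration.integrable_bound[where f = "\<lambda>x. V * f x"])
      (use f bd' in \<open>auto intro!: AE_I2 mult_right_mono simp: abs_mult mult.commute[of "\<bar>f _\<bar>"]\<close>)
  have "integrable lborel (\<lambda>x. \<epsilon>\<^sup>2 / 2 * (W x)\<^sup>2 - 1 / 2 * (\<mu> x * (v x)\<^sup>2) + 1 / 4 * (v x) ^ 4 - \<epsilon> * a * (f x * v x))"
    using i 1 2 3
    by (intro Bochner_Integration.integrable_add Bochner_Integration.integrable_diff integrable_mult_right) auto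
  then show ?thesis
    by (simp add: mult.assoc)
qed

text \<open>The function equal to \<open>w\<close> on [A, B] and to \<open>v\<close> elsewhere lies
  in H^1, and its energy differs from that of \<open>v\<close> only on [A, B]. The added \<mu>^2/4
  cancels in the difference.\<close>

lemma minimizer_local_lagrangian_le:
  assumes sol: "energy_minimizing_solution \<mu> f a \<epsilon> v" and bd: "\<And>x. \<bar>v x\<bar> \<le> V"
    and \<mu>: "continuous_on UNIV \<mu>" and \<mu>_bd: "\<And>x. \<bar>\<mu> x\<bar> \<le> m"
    and f: "integrable lborel f" "continuous_on UNIV f"
    and "A \<le> B" and w: "continuous_on {A..B} w" and ends: "w A = v A" "w B = v B"
    and S: "finite S"
    and deriv: "\<And>x. x \<in> {A<..<B} - S \<Longrightarrow> (w has_real_derivative w' x) (at x)"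
    and w'[measurable]: "w' \<in> borel_measurable borel" and w'_bd: "\<And>x. x \<in> {A..B} \<Longrightarrow> \<bar>w' x\<bar> \<le> C"
  shows "(LINT x:{A..B}|lborel. lagrangian \<mu> f a \<epsilon> x (v x) (deriv v x))
           \<le> (LINT x:{A..B}|lborel. lagrangian \<mu> f a \<epsilon> x (w x) (w' x))"
proof -
  have C2: "C2_on UNIV v" and "H1_minimizer \<mu> f a \<epsilon> v"
    using sol by (auto simp: energy_minimizing_solution_def)
  then obtain W where W: "in_H1 v W"
    and min: "\<And>u u'. in_H1 u u' \<Longrightarrow> energy \<mu> f a \<epsilon> v W \<le> energy \<mu> f a \<epsilon> u u'"
    by (auto simp: H1_minimizer_def)
  note v = C2_on_UNIV_derivatives[OF C2]
  have AE_W: "AE x in lborel. W x = deriv v x"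
    using weak_derivative_eq_deriv_AE[OF v(1) v(3)] W by (auto simp: in_H1_def)
  \<comment> \<open>Clamping to [A, B] extends \<open>w - v\<close> continuously by its zero
    boundary values.\<close>
  define c where "c = (\<lambda>x. max A (min x B))"
  define h where "h = (\<lambda>x. w (c x) - v (c x))"
  define h' where "h' = (\<lambda>x. if x \<in> {A..B} then w' x - deriv v x else 0)"
  have c_in: "c x \<in> {A..B}" for x
    using \<open>A \<le> B\<close> by (auto simp: c_def)
  have c_id: "c x = x" if "x \<in> {A..B}" for x
    using that by (auto simp: c_def)
  have h_in: "h x = w x - v x" if "x \<in> {A..B}" for x
    using that by (simp add: h_def c_id)
  have h_out: "h x = 0" if "x \<notin> {A..B}" for x
    using that ends \<open>A \<le> B\<close> by (auto simp: h_def c_def not_le max_def min_def)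
  have h_cont: "continuous_on UNIV h"
    unfolding h_def
    by (intro continuous_intros continuous_on_compose2[OF w] continuous_on_compose2[OF v(4)])
      (use c_in in \<open>auto simp: c_def intro!: continuous_intros\<close>)
  have h_deriv: "(h has_real_derivative h' x) (at x)" if "x \<notin> S \<union> {A, B}" for x
  proof (cases "x \<in> {A..B}")
    case True
    with that have x: "x \<in> {A<..<B} - S" by auto
    have "((\<lambda>x. w x - v x) has_real_derivative h' x) (at x)"
      using DERIV_diff[OF deriv[OF x] v(1)] True by (simp add: h'_def)
    then show ?thesis
      by (rule has_field_derivative_transform_within_open[where S = "{A<..<B}"])
        (use x in \<open>auto simp: h_in\<close>)
  next
    case False
    have "((\<lambda>x. 0) has_real_derivative h' x) (at x)"
      using False by (auto simp: h'_def)
    then show ?thesis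
      by (rule has_field_derivative_transform_within_open[where S = "- {A..B}"])
        (use False in \<open>auto simp: h_out simp del: atLeastAtMost_iff intro: open_Compl\<close>)
  qed
  have dv[measurable]: "deriv v \<in> borel_measurable borel"
    using v(3) by (rule borel_measurable_continuous_onI)
  have h'_meas[measurable]: "h' \<in> borel_measurable borel"
    unfolding h'_def by measurable
  have "bounded (deriv v ` {A..B})"
    by (intro compact_imp_bounded compact_continuous_image continuous_on_subset[OF v(3)]) auto
  then obtain D where D: "\<And>x. x \<in> {A..B} \<Longrightarrow> \<bar>deriv v x\<bar> \<le> D"
    unfolding bounded_iff by fastforce
  have h'_bd: "\<bar>h' x\<bar> \<le> \<bar>C\<bar> + \<bar>D\<bar>" for x
    using D[of x] w'_bd[of x] by (auto simp: h'_def)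
  have H1: "in_H1 (\<lambda>x. v x + h x) (\<lambda>x. W x + h' x)"
    by (rule in_H1_perturb[OF W h_cont _ h_deriv h'_meas h'_bd h_out, where S = "S \<union> {A, B}"])
      (use S in \<open>auto simp: h'_def\<close>)
  define e where "e = (\<lambda>u u' x. \<epsilon>\<^sup>2 / 2 * (u' x)\<^sup>2 - \<mu> x / 2 * (u x)\<^sup>2 + 1 / 4 * (u x) ^ 4 - \<epsilon> * a * f x * u x)"
  have \<mu>_m[measurable]: "\<mu> \<in> borel_measurable borel" and f_m[measurable]: "f \<in> borel_measurable borel"
    and [measurable]: "v \<in> borel_measurable borel" "h \<in> borel_measurable borel" "W \<in> borel_measurable borel"
    using \<mu> f(2) v(4) h_cont W
    by (auto intro: borel_measurable_continuous_onI simp: in_H1_def square_integrable_def)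
  have e_int: "integrable lborel (e v W)"
    unfolding e_def by (rule energy_density_integrable[OF W bd \<mu>_m \<mu>_bd f(1)])
  have Lv: "set_integrable lborel {A..B} (\<lambda>x. lagrangian \<mu> f a \<epsilon> x (v x) (deriv v x))"
    by (rule set_integrable_lagrangian[OF \<mu> f(2) continuous_on_subset[OF v(4)] dv D]) auto
  have Lw: "set_integrable lborel {A..B} (\<lambda>x. lagrangian \<mu> f a \<epsilon> x (w x) (w' x))"
    by (rule set_integrable_lagrangian[OF \<mu> f(2) w w' w'_bd])
  define g where "g = (\<lambda>x. lagrangian \<mu> f a \<epsilon> x (w x) (w' x) - lagrangian \<mu> f a \<epsilon> x (v x) (deriv v x))"
  have g: "set_integrable lborel {A..B} g"
    unfolding g_def by (intro set_integral_diff Lw Lv)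
  have AE_e: "AE x in lborel. e (\<lambda>x. v x + h x) (\<lambda>x. W x + h' x) x = e v W x + indicator {A..B} x * g x"
    using AE_W
  proof eventually_elim
    case (elim x)
    show ?case
    proof (cases "x \<in> {A..B}")
      case True
      have *: "lagrangian \<mu> f a \<epsilon> x y p
        = \<epsilon>\<^sup>2 / 2 * p\<^sup>2 - \<mu> x / 2 * y\<^sup>2 + 1 / 4 * y ^ 4 - \<epsilon> * a * f x * y + (\<mu> x)\<^sup>2 / 4" for y p
        by (simp add: lagrangian_def power2_eq_square power4_eq_xxxx field_simps)
      show ?thesis
        using True elim by (simp add: e_def g_def h_in h'_def *)
    next
      case False
      then show ?thesis
        by (simp add: e_def h_out h'_def del: atLeastAtMost_iff)
    qed
  qed
  have gi: "integrable lborel (\<lambda>x. indicator {A..B} x * g x)"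
    using g by (simp add: set_integrable_def)
  have "energy \<mu> f a \<epsilon> (\<lambda>x. v x + h x) (\<lambda>x. W x + h' x) = (LINT x|lborel. e (\<lambda>x. v x + h x) (\<lambda>x. W x + h' x) x)"
    by (simp add: energy_def e_def)
  also have "\<dots> = (LINT x|lborel. e v W x + indicator {A..B} x * g x)"
  proof (rule integral_cong_AE[OF _ _ AE_e])
    show "(\<lambda>x. e (\<lambda>x. v x + h x) (\<lambda>x. W x + h' x) x) \<in> borel_measurable lborel"
      unfolding e_def by measurable
    show "(\<lambda>x. e v W x + indicator {A..B} x * g x) \<in> borel_measurable lborel"
      using e_int gi by (intro borel_measurable_add borel_measurable_integrable)
  qed
  also have "\<dots> = energy \<mu> f a \<epsilon> v W + (LINT x:{A..B}|lborel. g x)"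
    using e_int gi by (simp add: energy_def e_def set_lebesgue_integral_def)
  finally have "0 \<le> (LINT x:{A..B}|lborel. g x)"
    using min[OF H1] by simp
  then show ?thesis
    using set_integral_diff(2)[OF Lw Lv] by (simp add: g_def)
qed

section \<open>The Painleve-II equation\<close>

lemma DERIV_nonneg_imp_mono:
  fixes g :: "real \<Rightarrow> real"
  assumes "\<And>x. x \<ge> c \<Longrightarrow> (g has_real_derivative g' x) (at x)" "\<And>x. x \<ge> c \<Longrightarrow> g' x \<ge> 0" "c \<le> x" "x \<le> y"
  shows "g x \<le> g y"
  using assms(4)
proof (rule DERIV_nonneg_imp_nondecreasing)
  fix z assume "x \<le> z"
  then show "\<exists>y. (g has_real_derivative y) (at z) \<and> 0 \<le> y"
    using assms(1-3) by (intro exI[of _ "g' z"]) simp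
qed

text \<open>
  The energy \<open>(u')\<^sup>2 - u\<^sup>4\<close> is eventually nonnegative, so that eventually \<open>u' \<ge> u\<^sup>2\<close>
  and \<open>1 / u\<close> reaches zero in finite time.
\<close>

lemma no_global_nonneg_solution:
  fixes u u' u'' :: "real \<Rightarrow> real"
  assumes u: "\<And>x. (u has_real_derivative u' x) (at x)"
    and u': "\<And>x. (u' has_real_derivative u'' x) (at x)"
    and "b > 0" and nonneg: "\<And>x. x \<ge> 0 \<Longrightarrow> u x \<ge> 0"
    and ineq: "\<And>x. x \<ge> 0 \<Longrightarrow> u'' x \<ge> 2 * u x ^ 3 + b"
  shows False
proof -
  have u''_ge: "u'' x \<ge> b" if "x \<ge> 0" for x
    using ineq[OF that] nonneg[OF that] zero_le_power[of "u x" 3] by linarith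
  have lin: "u' 0 + b * x \<le> u' x" if "x \<ge> 0" for x
  proof -
    have "u' 0 - b * 0 \<le> u' x - b * x"
      by (rule DERIV_nonneg_imp_mono[of 0 "\<lambda>x. u' x - b * x" "\<lambda>x. u'' x - b"])
        (use that u''_ge in \<open>auto intro!: derivative_eq_intros u'\<close>)
    then show ?thesis by simp
  qed
  \<comment> \<open>Chosen so that b p = |u' 0| + 1, which makes the linear bound \<open>lin\<close>
    yield u' >= 1 from \<open>p\<close> on.\<close>
  define p where "p = \<bar>u' 0\<bar> / b + 1 / b"
  have "p \<ge> 0" using \<open>b > 0\<close> by (simp add: p_def)
  have u'_ge_1: "u' x \<ge> 1" if "x \<ge> p" for x
  proof -
    have "b * x \<ge> b * p" using that \<open>b > 0\<close> by simp
    moreover have "b * p = \<bar>u' 0\<bar> + 1" using \<open>b > 0\<close> by (simp add: p_def field_simps)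
    ultimately show ?thesis using lin[of x] that \<open>p \<ge> 0\<close> by linarith
  qed
  have u_lin: "u p + (x - p) \<le> u x" if "x \<ge> p" for x
  proof -
    have "u p - p \<le> u x - x"
      by (rule DERIV_nonneg_imp_mono[of p "\<lambda>x. u x - x" "\<lambda>x. u' x - 1"])
        (use that u'_ge_1 in \<open>auto intro!: derivative_eq_intros u\<close>)
    then show ?thesis by simp
  qed
  \<comment> \<open>The first integral of u'' = 2 u^3 + b. Its derivative is 2 u' (u'' - 2 u^3 - b),
    which the differential inequality makes nonnegative where u' is positive.\<close>
  define E where "E = (\<lambda>x. (u' x)\<^sup>2 - (u x) ^ 4 - 2 * b * u x)"
  have E: "E p \<le> E x" if "x \<ge> p" for x
  proof (rule DERIV_nonneg_imp_mono[of p E "\<lambda>x. 2 * u' x * (u'' x - 2 * u x ^ 3 - b)"])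
    show "(E has_real_derivative 2 * u' x * (u'' x - 2 * u x ^ 3 - b)) (at x)" for x
      unfolding E_def
      by (auto intro!: derivative_eq_intros u u' simp: algebra_simps power3_eq_cube)
    show "0 \<le> 2 * u' x * (u'' x - 2 * u x ^ 3 - b)" if "x \<ge> p" for x
      using u'_ge_1[OF that] ineq[of x] that \<open>p \<ge> 0\<close> by (intro mult_nonneg_nonneg) auto
  qed (use that in auto)
  \<comment> \<open>From \<open>q\<close> on, u >= |E p| / b + 1, so the term 2 b u absorbs a
    possibly negative E p and leaves u'^2 >= u^4.\<close>
  define q where "q = p + \<bar>E p\<bar> / b + 1"
  have "q \<ge> p + 1" using \<open>b > 0\<close> by (simp add: q_def)
  have u_pos: "u x \<ge> 1" and u'_ge_sq: "u' x \<ge> (u x)\<^sup>2" if "x \<ge> q" for x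
  proof -
    have x: "x \<ge> p" "x - p \<ge> \<bar>E p\<bar> / b + 1" using that \<open>q \<ge> p + 1\<close> by (auto simp: q_def)
    have up: "u x \<ge> \<bar>E p\<bar> / b + 1"
      using u_lin[OF x(1)] x(2) nonneg[OF \<open>p \<ge> 0\<close>] by linarith
    then show "u x \<ge> 1"
      using \<open>b > 0\<close> by (smt (verit) divide_nonneg_pos)
    have "b * u x \<ge> \<bar>E p\<bar>"
      using up \<open>b > 0\<close> by (simp add: field_simps)
    moreover have "b * u x \<ge> 0"
      using \<open>1 \<le> u x\<close> \<open>b > 0\<close> by simp
    ultimately have "(u' x)\<^sup>2 \<ge> ((u x)\<^sup>2)\<^sup>2"
      using E[OF x(1)] by (simp add: E_def)
    then show "u' x \<ge> (u x)\<^sup>2"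
      by (rule power2_le_imp_le) (use u'_ge_1[OF x(1)] in linarith)
  qed
  \<comment> \<open>Since u' >= u^2, the function -1/u - x is nondecreasing from \<open>q\<close>
    on. Over a length of 2 this is impossible, because -1/u stays in [-1, 0).\<close>
  have "- (1 / u q) - q \<le> - (1 / u (q + 2)) - (q + 2)"
  proof (rule DERIV_nonneg_imp_mono[of q "\<lambda>x. - (1 / u x) - x" "\<lambda>x. u' x / (u x)\<^sup>2 - 1"])
    show "((\<lambda>x. - (1 / u x) - x) has_real_derivative u' x / (u x)\<^sup>2 - 1) (at x)" if "x \<ge> q" for x
      using u_pos[OF that] by (auto intro!: derivative_eq_intros u simp: power2_eq_square)
    show "0 \<le> u' x / (u x)\<^sup>2 - 1" if "x \<ge> q" for x
      using u_pos[OF that] u'_ge_sq[OF that] by (simp add: pos_le_divide_eq)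
  qed auto
  moreover have "1 / u q \<le> 1" "1 / u (q + 2) > 0"
    using u_pos[of q] u_pos[of "q + 2"] by auto
  ultimately show False by linarith
qed

text \<open>With u = -Y the equation reads u'' = s u + 2 u^3 - \<alpha>. For s >= 0 and u >= 0 the
  right-hand side is at least 2 u^3 + |\<alpha>|, which forces blow-up.\<close>

lemma PII_solution_not_nonpos:
  assumes Y: "PII_solution \<alpha> Y" and "\<alpha> < 0"
  shows "\<exists>s. Y s > 0"
proof (rule ccontr)
  assume "\<not> (\<exists>s. Y s > 0)"
  then have np: "Y s \<le> 0" for s by (simp add: not_less)
  have C2: "C2_on UNIV Y" and ode: "deriv (deriv Y) s = s * Y s + 2 * Y s ^ 3 + \<alpha>" for s
    using Y by (auto simp: PII_solution_def algebra_simps)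
  note d = C2_on_UNIV_derivatives[OF C2]
  show False
  proof (rule no_global_nonneg_solution[of "\<lambda>s. - Y s" "\<lambda>s. - deriv Y s" "\<lambda>s. - deriv (deriv Y) s" "- \<alpha>"])
    show "- deriv (deriv Y) x \<ge> 2 * (- Y x) ^ 3 + - \<alpha>" if "x \<ge> 0" for x
      using mult_nonneg_nonpos[OF that np[of x]] ode[of x] by (simp add: power3_eq_cube)
  qed (use d \<open>\<alpha> < 0\<close> np in \<open>auto intro!: DERIV_minus\<close>)
qed

text \<open>At such a point Y'' = \<alpha> < 0, and by continuity Y'' < 0 nearby. Two applications
  of the mean value theorem then make it a strict local maximum.\<close>

lemma PII_solution_no_min_at_zero:
  assumes Y: "PII_solution \<alpha> Y" and "\<alpha> < 0" and "Y s = 0" and "deriv Y s = 0"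
  shows "\<exists>\<delta>>0. \<forall>t. t \<noteq> s \<longrightarrow> \<bar>t - s\<bar> < \<delta> \<longrightarrow> Y t < 0"
proof -
  have C2: "C2_on UNIV Y" and ode: "deriv (deriv Y) t = t * Y t + 2 * Y t ^ 3 + \<alpha>" for t
    using Y by (auto simp: PII_solution_def algebra_simps)
  note d = C2_on_UNIV_derivatives[OF C2]
  have "isCont (\<lambda>t. t * Y t + 2 * Y t ^ 3 + \<alpha>) s"
    using d(4) by (auto intro!: continuous_intros simp: continuous_on_eq_continuous_at)
  then have "(\<lambda>t. t * Y t + 2 * Y t ^ 3 + \<alpha>) \<midarrow>s\<rightarrow> \<alpha>"
    using \<open>Y s = 0\<close> by (simp add: isCont_def)
  then have "\<forall>\<^sub>F t in at s. t * Y t + 2 * Y t ^ 3 + \<alpha> < 0"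
    using \<open>\<alpha> < 0\<close> by (rule order_tendstoD(2))
  then obtain \<delta> where \<delta>: "\<delta> > 0" "\<And>t. t \<noteq> s \<Longrightarrow> \<bar>t - s\<bar> < \<delta> \<Longrightarrow> deriv (deriv Y) t < 0"
    by (auto simp: eventually_at dist_real_def ode)
  have "Y t < 0" if "t \<noteq> s" "\<bar>t - s\<bar> < \<delta>" for t
  proof (cases "s < t")
    case True
    obtain z where z: "s < z" "z < t" "Y t - Y s = (t - s) * deriv Y z"
      using MVT2[OF True, of Y "deriv Y"] d(1) by blast
    obtain y where y: "s < y" "y < z" "deriv Y z - deriv Y s = (z - s) * deriv (deriv Y) y"
      using MVT2[OF z(1), of "deriv Y" "deriv (deriv Y)"] d(2) by blast
    have "deriv (deriv Y) y < 0"
      using y z that True by (intro \<delta>(2)) auto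
    then have "deriv Y z < 0"
      using y assms by (simp add: mult_pos_neg)
    with z True assms show ?thesis by (simp add: mult_pos_neg)
  next
    case False
    with that have "t < s" by simp
    obtain z where z: "t < z" "z < s" "Y s - Y t = (s - t) * deriv Y z"
      using MVT2[OF \<open>t < s\<close>, of Y "deriv Y"] d(1) by blast
    obtain y where y: "z < y" "y < s" "deriv Y s - deriv Y z = (s - z) * deriv (deriv Y) y"
      using MVT2[OF z(2), of "deriv Y" "deriv (deriv Y)"] d(2) by blast
    have "deriv (deriv Y) y < 0"
      using y z that \<open>t < s\<close> by (intro \<delta>(2)) auto
    then have "(s - z) * deriv (deriv Y) y < 0"
      using z by (simp add: mult_pos_neg)
    then have "deriv Y z > 0"
      using y assms by simp
    then have "(s - t) * deriv Y z > 0"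
      using \<open>t < s\<close> by simp
    with z assms show ?thesis by simp
  qed
  with \<delta>(1) show ?thesis by blast
qed

section \<open>The energy gap\<close>

lemma FTC_le_set_integral:
  fixes \<Psi> g :: "real \<Rightarrow> real"
  assumes "a \<le> b" and S: "finite S" and cont: "continuous_on {a..b} \<Psi>"
    and deriv: "\<And>x. x \<in> {a<..<b} - S \<Longrightarrow> (\<Psi> has_real_derivative \<psi> x) (at x)"
    and le: "\<And>x. x \<in> {a<..<b} - S \<Longrightarrow> \<psi> x \<le> g x"
    and g: "set_integrable lborel {a..b} g"
  shows "\<Psi> b - \<Psi> a \<le> (LINT x:{a..b}|lborel. g x)"
proof -
  let ?S = "S \<union> {a, b}"
  \<comment> \<open>The fundamental theorem tolerates arbitrary values on a finite set; choosing
    \<open>g\<close> there makes the pointwise comparison hold on the whole interval.\<close>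
  define \<psi>' where "\<psi>' = (\<lambda>x. if x \<in> ?S then g x else \<psi> x)"
  have "(\<psi>' has_integral (\<Psi> b - \<Psi> a)) {a..b}"
    by (rule fundamental_theorem_of_calculus_interior_strong[of ?S])
      (use S \<open>a \<le> b\<close> cont deriv in \<open>auto simp: \<psi>'_def has_real_derivative_iff_has_vector_derivative[symmetric]\<close>)
  moreover have "(g has_integral (LINT x:{a..b}|lborel. g x)) {a..b}"
    using set_borel_integral_eq_integral[OF g] by (simp add: integrable_integral)
  ultimately show ?thesis
    by (rule has_integral_le) (use le in \<open>auto simp: \<psi>'_def\<close>)
qed

lemma DERIV_sqrt_comp:
  assumes "(g has_real_derivative g') (at x)" "g x > 0"
  shows "((\<lambda>x. sqrt (g x)) has_real_derivative g' / (2 * sqrt (g x))) (at x)"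
  using assms by (auto intro!: derivative_eq_intros simp: field_simps)

lemma DERIV_mult_sqrt:
  assumes g: "(g has_real_derivative g') (at x)" and pos: "g x > 0"
  shows "((\<lambda>x. g x * sqrt (g x)) has_real_derivative 3 / 2 * (sqrt (g x) * g')) (at x)"
proof -
  have "g' / (2 * sqrt (g x)) * g x = g' / 2 * (g x / sqrt (g x))" by simp
  also have "g x / sqrt (g x) = sqrt (g x)" using pos by (simp add: real_div_sqrt)
  finally have "g' * sqrt (g x) + g' / (2 * sqrt (g x)) * g x = 3 / 2 * (sqrt (g x) * g')"
    by simp
  from DERIV_cong[OF DERIV_mult[OF g DERIV_sqrt_comp[OF assms]] this] show ?thesis .
qed

text \<open>Bounds r times the slope of sqrt \<mu> at distance at least c r^2 from the zero, where
  \<mu> >= b c r^2 and \<mu>' <= B.\<close>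

definition slope_const :: "real \<Rightarrow> real \<Rightarrow> real \<Rightarrow> real" where
  "slope_const b B c = B / (2 * sqrt (b * c))"

text \<open>The coefficient of r^4 in the energy density of the left layer. The first square is
  kinetic, from the slopes of sqrt \<mu> and of the correction; the second is potential.
  \<open>A + sqrt (B * c)\<close> bounds the boundary mismatch divided by r.\<close>

definition layer_const :: "real \<Rightarrow> real \<Rightarrow> real \<Rightarrow> real \<Rightarrow> real" where
  "layer_const b B A c = (slope_const b B c + (A + sqrt (B * c)))\<^sup>2 / 2
     + ((A + sqrt (B * c)) * (2 * sqrt (B * (c + 1)) + (A + sqrt (B * c))))\<^sup>2 / 4"

text \<open>Collects the costs that will carry a factor \<kappa>: the boundary values at
  \<open>x\<^sub>1\<close> (first two terms), the left layer, and the kinetic energy of sqrt \<mu>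
  over the whole interval, whose length is at most N^2 / b.\<close>

definition error_const :: "real \<Rightarrow> real \<Rightarrow> real \<Rightarrow> real \<Rightarrow> real \<Rightarrow> real" where
  "error_const b B c\<^sub>0 A c = A ^ 3 + 2 * c\<^sub>0 / (3 * B) * sqrt (B * c) ^ 3 + layer_const b B A c
     + (slope_const b B c)\<^sup>2 / b"

text \<open>
  In the setting of \<open>transition\<close>, \<open>z\<^sub>0\<close> stands for \<open>- \<xi>\<close> and \<open>r\<close> for \<open>\<epsilon>\<^bsup>1/3\<^esup>\<close>, so that the Painleve scale is
  \<open>r\<^sup>2\<close>.  The parameter \<open>\<kappa>\<close> measures how small that scale is compared with \<open>x\<^sub>2 - z\<^sub>0\<close>.
\<close>

locale transition =
  fixes \<mu> \<mu>' f v v' :: "real \<Rightarrow> real" and z\<^sub>0 x\<^sub>2 a b B c\<^sub>0 A\<^sub>0 c\<^sub>1 r \<eta> \<kappa> :: real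
  fixes x\<^sub>1 N \<epsilon>
  assumes pos: "b > 0" "c\<^sub>0 > 0" "A\<^sub>0 \<ge> 0" "c\<^sub>1 > 0" "r > 0" "0 < \<eta>" "\<eta> < 1" "0 < \<kappa>" "\<kappa> \<le> 1"
    and \<kappa>_small: "(c\<^sub>1 + 2) * B * \<kappa>\<^sup>2 \<le> 1"
    and budget: "3 * \<eta>\<^sup>2 + \<kappa> * error_const b B c\<^sub>0 A\<^sub>0 c\<^sub>1 < \<eta> * (2 * c\<^sub>0 / (3 * B))"
  defines "x\<^sub>1 \<equiv> z\<^sub>0 + c\<^sub>1 * r\<^sup>2" and "N \<equiv> sqrt (\<mu> x\<^sub>2)" and "\<epsilon> \<equiv> r ^ 3"
  assumes \<mu>: "\<And>x. (\<mu> has_real_derivative \<mu>' x) (at x)" and \<mu>': "continuous_on UNIV \<mu>'" and \<mu>_0: "\<mu> z\<^sub>0 = 0"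
    and \<mu>'_bd: "\<And>x. z\<^sub>0 \<le> x \<Longrightarrow> x \<le> x\<^sub>2 \<Longrightarrow> b \<le> \<mu>' x \<and> \<mu>' x \<le> B"
    and f: "continuous_on UNIV f"
    and f_bd: "\<And>x. z\<^sub>0 \<le> x \<Longrightarrow> x \<le> x\<^sub>2 \<Longrightarrow> 0 \<le> - a * f x \<and> c\<^sub>0 \<le> \<mu>' x / sqrt 2 - (- a * f x)"
    and v: "\<And>x. (v has_real_derivative v' x) (at x)" and v': "continuous_on UNIV v'"
    and v_x\<^sub>1: "v x\<^sub>1 \<le> 0" "- A\<^sub>0 * r \<le> v x\<^sub>1"
    and v_le: "\<And>x. x\<^sub>1 \<le> x \<Longrightarrow> x \<le> x\<^sub>2 \<Longrightarrow> v x \<le> (1 - \<eta>) * sqrt (\<mu> x)"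
    and v_x\<^sub>2: "v x\<^sub>2 = (1 - \<eta>) * N"
    and z\<^sub>0_less: "z\<^sub>0 < x\<^sub>2" and r_le: "r \<le> \<kappa> * N"
begin

abbreviation "L \<equiv> lagrangian \<mu> f a \<epsilon>"

section \<open>Linear bounds on \<mu> and the geometry of the two layers\<close>

lemma \<mu>_bounds:
  assumes "z\<^sub>0 \<le> x" "x \<le> x\<^sub>2"
  shows "b * (x - z\<^sub>0) \<le> \<mu> x" "\<mu> x \<le> B * (x - z\<^sub>0)"
proof -
  have "b * (x - z\<^sub>0) \<le> \<mu> x \<and> \<mu> x \<le> B * (x - z\<^sub>0)"
  proof (cases "x = z\<^sub>0")
    case False
    with assms have "z\<^sub>0 < x" by simp
    from MVT2[OF this, of \<mu> \<mu>'] \<mu>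
    obtain z where z: "z\<^sub>0 < z" "z < x" "\<mu> x - \<mu> z\<^sub>0 = (x - z\<^sub>0) * \<mu>' z" by blast
    with \<mu>'_bd[of z] assms \<mu>_0 \<open>z\<^sub>0 < x\<close> show ?thesis
      by (simp add: mult.commute[of _ "x - z\<^sub>0"])
  qed (simp add: \<mu>_0)
  then show "b * (x - z\<^sub>0) \<le> \<mu> x" "\<mu> x \<le> B * (x - z\<^sub>0)" by auto
qed

lemma b_le_B: "b \<le> B"
  using \<mu>'_bd[of x\<^sub>2] z\<^sub>0_less by simp

lemma \<mu>_pos: "z\<^sub>0 < x \<Longrightarrow> x \<le> x\<^sub>2 \<Longrightarrow> 0 < \<mu> x"
  using \<mu>_bounds(1)[of x] pos(1) by (smt (verit) mult_pos_pos)

lemma \<mu>_mono: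
  assumes "z\<^sub>0 \<le> x" "x \<le> y" "y \<le> x\<^sub>2"
  shows "\<mu> x \<le> \<mu> y"
  using assms(2)
proof (rule DERIV_nonneg_imp_nondecreasing)
  fix z assume "x \<le> z" "z \<le> y"
  then show "\<exists>d. (\<mu> has_real_derivative d) (at z) \<and> 0 \<le> d"
    using assms \<mu>[of z] \<mu>'_bd[of z] pos(1) by (intro exI[of _ "\<mu>' z"]) simp
qed

text \<open>Data of the competitor: \<open>y\<^sub>1\<close> and \<open>y\<^sub>2\<close> are the
  inner edges of the two correction layers, and \<beta> is the mismatch between \<open>v\<close> and
  sqrt \<mu> at \<open>x\<^sub>1\<close>, of size at most
  \<open>\<beta>\<^sub>0 * r\<close>.\<close>

definition "m = \<epsilon> / N"
definition "y\<^sub>1 = x\<^sub>1 + r\<^sup>2"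
definition "y\<^sub>2 = x\<^sub>2 - m"
definition "q = slope_const b B c\<^sub>1"
definition "\<beta> = v x\<^sub>1 - sqrt (\<mu> x\<^sub>1)"
definition "\<beta>\<^sub>0 = A\<^sub>0 + sqrt (B * c\<^sub>1)"
definition "a\<^sub>1 = layer_const b B A\<^sub>0 c\<^sub>1"

lemma N_pos: "N > 0"
  unfolding N_def using \<mu>_pos[of x\<^sub>2] z\<^sub>0_less by simp

lemma \<epsilon>_pos: "\<epsilon> > 0"
  using pos by (simp add: \<epsilon>_def)

lemma m_pos: "m > 0"
  using N_pos \<epsilon>_pos by (simp add: m_def)

lemma N_sq: "N\<^sup>2 = \<mu> x\<^sub>2"
  unfolding N_def using \<mu>_pos[of x\<^sub>2] z\<^sub>0_less by simp

lemma x\<^sub>1_gt: "z\<^sub>0 < x\<^sub>1"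
  using pos by (simp add: x\<^sub>1_def)

text \<open>The layers do not overlap. From r <= \<kappa> N one gets r^2 <= \<kappa>^2 B
  (\<open>x\<^sub>2 - z\<^sub>0\<close>), so \<open>\<kappa>_small\<close> leaves room for
  \<open>c\<^sub>1 + 2\<close> multiples of r^2: \<open>c\<^sub>1\<close> up to
  \<open>x\<^sub>1\<close> and one for each layer, since r <= N gives m <= r^2.\<close>

lemma y\<^sub>1_le_y\<^sub>2: "y\<^sub>1 \<le> y\<^sub>2"
proof -
  have "r\<^sup>2 \<le> (\<kappa> * N)\<^sup>2"
    using r_le pos by (intro power_mono) auto
  also have "\<dots> \<le> \<kappa>\<^sup>2 * (B * (x\<^sub>2 - z\<^sub>0))"
    using \<mu>_bounds(2)[of x\<^sub>2] z\<^sub>0_less by (simp add: power_mult_distrib N_sq mult_left_mono)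
  finally have "(c\<^sub>1 + 2) * r\<^sup>2 \<le> (c\<^sub>1 + 2) * (\<kappa>\<^sup>2 * (B * (x\<^sub>2 - z\<^sub>0)))"
    using pos by (intro mult_left_mono) auto
  also have "\<dots> = ((c\<^sub>1 + 2) * B * \<kappa>\<^sup>2) * (x\<^sub>2 - z\<^sub>0)"
    by (simp add: mult_ac)
  also have "\<dots> \<le> 1 * (x\<^sub>2 - z\<^sub>0)"
    using \<kappa>_small z\<^sub>0_less by (intro mult_right_mono) auto
  finally have 1: "(c\<^sub>1 + 2) * r\<^sup>2 \<le> x\<^sub>2 - z\<^sub>0" by simp
  have "r \<le> N"
    using r_le pos N_pos mult_right_mono[of \<kappa> 1 N] by linarith
  then have "r\<^sup>2 * r \<le> r\<^sup>2 * N"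
    using pos by (intro mult_left_mono) auto
  then have "m \<le> r\<^sup>2"
    using N_pos by (simp add: m_def \<epsilon>_def pos_divide_le_eq power2_eq_square power3_eq_cube)
  with 1 show ?thesis
    by (simp add: y\<^sub>1_def y\<^sub>2_def x\<^sub>1_def algebra_simps)
qed

lemma order: "z\<^sub>0 < x\<^sub>1" "x\<^sub>1 < y\<^sub>1" "y\<^sub>1 \<le> y\<^sub>2" "y\<^sub>2 < x\<^sub>2"
  using x\<^sub>1_gt y\<^sub>1_le_y\<^sub>2 m_pos pos by (auto simp: y\<^sub>1_def y\<^sub>2_def)

lemma B_pos: "B > 0"
  using b_le_B pos by simp

lemma sqrt_slope_le:
  assumes "x\<^sub>1 \<le> x" "x \<le> x\<^sub>2"
  shows "0 \<le> \<mu>' x / (2 * sqrt (\<mu> x))" "\<mu>' x / (2 * sqrt (\<mu> x)) \<le> q / r"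
proof -
  have z: "z\<^sub>0 < x" using assms x\<^sub>1_gt by simp
  note bd = \<mu>'_bd[of x] \<mu>_pos[of x]
  show "0 \<le> \<mu>' x / (2 * sqrt (\<mu> x))"
    using bd assms z pos by simp
  have "b * (c\<^sub>1 * r\<^sup>2) \<le> \<mu> x"
  proof -
    have "b * (c\<^sub>1 * r\<^sup>2) \<le> b * (x - z\<^sub>0)"
      using assms pos(1) by (intro mult_left_mono) (auto simp: x\<^sub>1_def)
    with \<mu>_bounds(1)[of x] assms z show ?thesis by simp
  qed
  then have "sqrt (b * c\<^sub>1 * r\<^sup>2) \<le> sqrt (\<mu> x)"
    by (intro real_sqrt_le_mono) (simp add: mult.assoc)
  then have s: "sqrt (b * c\<^sub>1) * r \<le> sqrt (\<mu> x)"
    using pos by (simp add: real_sqrt_mult)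
  have "\<mu>' x / (2 * sqrt (\<mu> x)) \<le> B / (2 * (sqrt (b * c\<^sub>1) * r))"
    using s bd assms z pos B_pos by (intro frac_le) auto
  then show "\<mu>' x / (2 * sqrt (\<mu> x)) \<le> q / r"
    by (simp add: q_def slope_const_def)
qed

lemma \<beta>_bd: "\<bar>\<beta>\<bar> \<le> \<beta>\<^sub>0 * r" "\<beta> \<le> 0"
proof -
  have "\<mu> x\<^sub>1 \<le> B * (c\<^sub>1 * r\<^sup>2)"
    using \<mu>_bounds(2)[of x\<^sub>1] order by (simp add: x\<^sub>1_def)
  then have "sqrt (\<mu> x\<^sub>1) \<le> sqrt (B * c\<^sub>1 * r\<^sup>2)"
    by (intro real_sqrt_le_mono) (simp add: mult.assoc)
  then have 1: "sqrt (\<mu> x\<^sub>1) \<le> sqrt (B * c\<^sub>1) * r"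
    using pos by (simp add: real_sqrt_mult)
  have 2: "sqrt (\<mu> x\<^sub>1) \<ge> 0"
    using \<mu>_pos[of x\<^sub>1] order by simp
  have "\<beta>\<^sub>0 * r = A\<^sub>0 * r + sqrt (B * c\<^sub>1) * r"
    by (simp add: \<beta>\<^sub>0_def distrib_right)
  with 1 2 v_x\<^sub>1 show "\<bar>\<beta>\<bar> \<le> \<beta>\<^sub>0 * r" "\<beta> \<le> 0"
    unfolding \<beta>_def by linarith+
qed

text \<open>
  The competitor: \<open>\<surd>\<mu>\<close>, corrected on a layer of width \<open>r\<^sup>2\<close> at \<open>x\<^sub>1\<close> and on one of width \<open>m\<close>, the
  width of a heteroclinic layer, at \<open>x\<^sub>2\<close>.
\<close>

definition w :: "real \<Rightarrow> real" where
  "w x = (1 - \<eta> * max 0 (1 - (x\<^sub>2 - x) / m)) * sqrt (\<mu> x) + \<beta> * max 0 (1 - (x - x\<^sub>1) / r\<^sup>2)"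

definition w' :: "real \<Rightarrow> real" where
  "w' x = (if x < y\<^sub>1 then \<mu>' x / (2 * sqrt (\<mu> x)) - \<beta> / r\<^sup>2
     else if x < y\<^sub>2 then \<mu>' x / (2 * sqrt (\<mu> x))
     else (1 - \<eta> * (1 - (x\<^sub>2 - x) / m)) * (\<mu>' x / (2 * sqrt (\<mu> x))) - \<eta> / m * sqrt (\<mu> x))"

lemma w_left: "x \<le> y\<^sub>1 \<Longrightarrow> w x = sqrt (\<mu> x) + \<beta> * (1 - (x - x\<^sub>1) / r\<^sup>2)"
  and w_mid: "y\<^sub>1 \<le> x \<Longrightarrow> x \<le> y\<^sub>2 \<Longrightarrow> w x = sqrt (\<mu> x)"
  and w_right: "y\<^sub>2 \<le> x \<Longrightarrow> w x = (1 - \<eta> * (1 - (x\<^sub>2 - x) / m)) * sqrt (\<mu> x)"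
proof -
  have l: "x \<le> y\<^sub>1 \<Longrightarrow> max 0 (1 - (x - x\<^sub>1) / r\<^sup>2) = 1 - (x - x\<^sub>1) / r\<^sup>2"
    "y\<^sub>1 \<le> x \<Longrightarrow> max 0 (1 - (x - x\<^sub>1) / r\<^sup>2) = 0" for x
    using pos by (auto simp: y\<^sub>1_def max_def field_simps)
  have rr: "y\<^sub>2 \<le> x \<Longrightarrow> max 0 (1 - (x\<^sub>2 - x) / m) = 1 - (x\<^sub>2 - x) / m"
    "x \<le> y\<^sub>2 \<Longrightarrow> max 0 (1 - (x\<^sub>2 - x) / m) = 0" for x
    using m_pos by (auto simp: y\<^sub>2_def max_def field_simps)
  show "w x = sqrt (\<mu> x) + \<beta> * (1 - (x - x\<^sub>1) / r\<^sup>2)" if "x \<le> y\<^sub>1"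
    using that order by (simp add: w_def l(1) rr(2))
  show "w x = sqrt (\<mu> x)" if "y\<^sub>1 \<le> x" "x \<le> y\<^sub>2"
    using that by (simp add: w_def l(2) rr(2))
  show "w x = (1 - \<eta> * (1 - (x\<^sub>2 - x) / m)) * sqrt (\<mu> x)" if "y\<^sub>2 \<le> x"
    using that order by (simp add: w_def l(2) rr(1))
qed

lemma w_ends: "w x\<^sub>1 = v x\<^sub>1" "w x\<^sub>2 = v x\<^sub>2"
  using w_left[of x\<^sub>1] w_right[of x\<^sub>2] order v_x\<^sub>2 by (auto simp: \<beta>_def N_def)

lemma \<mu>_cont: "continuous_on UNIV \<mu>"
  using \<mu> by (auto intro!: continuous_at_imp_continuous_on DERIV_isCont)

lemma v_cont: "continuous_on UNIV v"
  using v by (auto intro!: continuous_at_imp_continuous_on DERIV_isCont)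

lemma w_cont: "continuous_on {x\<^sub>1..x\<^sub>2} w"
  unfolding w_def using m_pos pos
  by (intro continuous_intros continuous_on_subset[OF \<mu>_cont]) auto

lemma sqrt_\<mu>_deriv:
  assumes "x\<^sub>1 \<le> x" "x \<le> x\<^sub>2"
  shows "((\<lambda>x. sqrt (\<mu> x)) has_real_derivative \<mu>' x / (2 * sqrt (\<mu> x))) (at x)"
  using \<mu>_pos[of x] assms order by (intro DERIV_sqrt_comp \<mu>) auto

lemma w_deriv:
  assumes x: "x \<in> {x\<^sub>1<..<x\<^sub>2} - {y\<^sub>1, y\<^sub>2}"
  shows "(w has_real_derivative w' x) (at x)"
proof -
  have s: "((\<lambda>x. sqrt (\<mu> x)) has_real_derivative \<mu>' x / (2 * sqrt (\<mu> x))) (at x)"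
    using x by (intro sqrt_\<mu>_deriv) auto
  consider "x < y\<^sub>1" | "y\<^sub>1 < x" "x < y\<^sub>2" | "y\<^sub>2 < x" using x by force
  then show ?thesis
  proof cases
    case 1
    have "((\<lambda>x. \<beta> * (1 - (x - x\<^sub>1) / r\<^sup>2)) has_real_derivative - (\<beta> / r\<^sup>2)) (at x)"
      using pos by (auto intro!: derivative_eq_intros simp: field_simps power2_eq_square)
    from DERIV_add[OF s this]
    have "((\<lambda>x. sqrt (\<mu> x) + \<beta> * (1 - (x - x\<^sub>1) / r\<^sup>2)) has_real_derivative w' x) (at x)"
      using 1 by (simp add: w'_def)
    then show ?thesis
      by (rule has_field_derivative_transform_within_open[where S = "{..<y\<^sub>1}"]) (use 1 w_left in auto)
  next
    case 2
    have "((\<lambda>x. sqrt (\<mu> x)) has_real_derivative w' x) (at x)"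
      using 2 s by (simp add: w'_def)
    then show ?thesis
      by (rule has_field_derivative_transform_within_open[where S = "{y\<^sub>1<..<y\<^sub>2}"]) (use 2 w_mid in auto)
  next
    case 3
    then have "\<not> x < y\<^sub>1" using order by simp
    have "((\<lambda>x. 1 - \<eta> * (1 - (x\<^sub>2 - x) / m)) has_real_derivative - (\<eta> / m)) (at x)"
      using m_pos by (auto intro!: derivative_eq_intros simp: field_simps)
    from DERIV_mult[OF this s] 3 \<open>\<not> x < y\<^sub>1\<close>
    have "((\<lambda>x. (1 - \<eta> * (1 - (x\<^sub>2 - x) / m)) * sqrt (\<mu> x)) has_real_derivative w' x) (at x)"
      by (simp add: w'_def algebra_simps)
    then show ?thesis
      by (rule has_field_derivative_transform_within_open[where S = "{y\<^sub>2<..}"]) (use 3 w_right in auto)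
  qed
qed

lemma w'_meas: "w' \<in> borel_measurable borel"
proof -
  have [measurable]: "\<mu> \<in> borel_measurable borel" "\<mu>' \<in> borel_measurable borel"
    using \<mu>_cont \<mu>' by (auto intro: borel_measurable_continuous_onI)
  show ?thesis unfolding w'_def by measurable
qed

section \<open>Energy density of the competitor on the three pieces\<close>

lemma L_eq: "L x y p = r ^ 6 / 2 * p\<^sup>2 + (y\<^sup>2 - \<mu> x)\<^sup>2 / 4 + \<epsilon> * (- a * f x) * y"
  by (simp add: lagrangian_def \<epsilon>_def power_mult[symmetric])

text \<open>A slope of order 1/r costs \<epsilon>^2 / r^2 = r^4.\<close>

lemma kinetic_le:
  assumes "\<bar>p\<bar> \<le> c / r"
  shows "r ^ 6 / 2 * p\<^sup>2 \<le> r ^ 4 * (c\<^sup>2 / 2)"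
proof -
  have "p\<^sup>2 \<le> (c / r)\<^sup>2"
    using power_mono[OF assms, of 2] by simp
  then have "r ^ 6 / 2 * p\<^sup>2 \<le> r ^ 6 / 2 * (c / r)\<^sup>2"
    by (rule mult_left_mono) simp
  also have "\<dots> = r ^ 4 * (c\<^sup>2 / 2)"
    using pos by (simp add: power_divide) (simp add: field_simps eval_nat_numeral)
  finally show ?thesis .
qed

text \<open>At distance of order r^2 from the zero of \<mu>, both sqrt \<mu> and the correction have
  order r, so kinetic and potential densities have order r^4. The correction is nonpositive and -a f
  nonnegative, so it can only lower the forcing term.\<close>

lemma L_w_left:
  assumes x: "x\<^sub>1 < x" "x < y\<^sub>1"
  shows "L x (w x) (w' x) \<le> \<epsilon> * (- a * f x) * sqrt (\<mu> x) + a\<^sub>1 * r ^ 4"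
proof -
  have x2: "x < x\<^sub>2" "z\<^sub>0 < x" using x order by auto
  define s e p where "s = sqrt (\<mu> x)" and "e = \<beta> * (1 - (x - x\<^sub>1) / r\<^sup>2)"
    and "p = \<mu>' x / (2 * sqrt (\<mu> x)) - \<beta> / r\<^sup>2"
  have s: "s > 0" "s\<^sup>2 = \<mu> x" using \<mu>_pos[of x] x2 by (auto simp: s_def)
  have t: "0 \<le> 1 - (x - x\<^sub>1) / r\<^sup>2" "1 - (x - x\<^sub>1) / r\<^sup>2 \<le> 1"
    using x pos by (auto simp: y\<^sub>1_def)
  have e: "\<bar>e\<bar> \<le> \<beta>\<^sub>0 * r" "e \<le> 0"
  proof -
    have "\<bar>e\<bar> \<le> \<bar>\<beta>\<bar>"
      unfolding e_def abs_mult using t by (intro mult_left_le) auto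
    with \<beta>_bd show "\<bar>e\<bar> \<le> \<beta>\<^sub>0 * r" by linarith
    show "e \<le> 0"
      unfolding e_def using t \<beta>_bd(2) by (simp add: mult_nonpos_nonneg)
  qed
  have w: "w x = s + e" "w' x = p"
    using x w_left[of x] by (auto simp: s_def e_def p_def w'_def)
  have "\<bar>p\<bar> \<le> (q + \<beta>\<^sub>0) / r"
  proof -
    have "\<bar>\<beta> / r\<^sup>2\<bar> \<le> \<beta>\<^sub>0 / r"
      using \<beta>_bd(1) pos by (simp add: abs_divide field_simps power2_eq_square)
    moreover have "(q + \<beta>\<^sub>0) / r = q / r + \<beta>\<^sub>0 / r"
      by (simp add: add_divide_distrib)
    ultimately show ?thesis
      using sqrt_slope_le[of x] x x2 unfolding p_def by linarith
  qed
  note kin = kinetic_le[OF this]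
  have "\<mu> x \<le> B * ((c\<^sub>1 + 1) * r\<^sup>2)"
  proof -
    have "B * (x - z\<^sub>0) \<le> B * ((c\<^sub>1 + 1) * r\<^sup>2)"
      using x B_pos by (intro mult_left_mono) (auto simp: y\<^sub>1_def x\<^sub>1_def algebra_simps)
    with \<mu>_bounds(2)[of x] x2 show ?thesis by simp
  qed
  then have "s \<le> sqrt (B * (c\<^sub>1 + 1) * r\<^sup>2)"
    unfolding s_def by (intro real_sqrt_le_mono) (simp add: mult.assoc)
  then have s_le: "s \<le> sqrt (B * (c\<^sub>1 + 1)) * r"
    using pos by (simp add: real_sqrt_mult)
  have "(s + e)\<^sup>2 - \<mu> x = e * (2 * s + e)"
    unfolding s(2)[symmetric] by (simp add: power2_eq_square algebra_simps)
  then have "\<bar>(s + e)\<^sup>2 - \<mu> x\<bar> = \<bar>e\<bar> * \<bar>2 * s + e\<bar>"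
    by (simp add: abs_mult)
  also have "\<dots> \<le> (\<beta>\<^sub>0 * r) * (2 * (sqrt (B * (c\<^sub>1 + 1)) * r) + \<beta>\<^sub>0 * r)"
    using e s_le s by (intro mult_mono) auto
  also have "\<dots> = (\<beta>\<^sub>0 * (2 * sqrt (B * (c\<^sub>1 + 1)) + \<beta>\<^sub>0)) * r\<^sup>2"
    by (simp add: power2_eq_square algebra_simps)
  finally have "((s + e)\<^sup>2 - \<mu> x)\<^sup>2 \<le> ((\<beta>\<^sub>0 * (2 * sqrt (B * (c\<^sub>1 + 1)) + \<beta>\<^sub>0)) * r\<^sup>2)\<^sup>2"
    using power_mono[of "\<bar>(s + e)\<^sup>2 - \<mu> x\<bar>" _ 2] by simp
  also have "\<dots> = (\<beta>\<^sub>0 * (2 * sqrt (B * (c\<^sub>1 + 1)) + \<beta>\<^sub>0))\<^sup>2 * r ^ 4"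
    by (simp add: power_mult_distrib power_mult[symmetric])
  finally have pot: "((s + e)\<^sup>2 - \<mu> x)\<^sup>2 / 4 \<le> (\<beta>\<^sub>0 * (2 * sqrt (B * (c\<^sub>1 + 1)) + \<beta>\<^sub>0))\<^sup>2 / 4 * r ^ 4"
    by simp
  have "0 \<le> \<epsilon> * (- a * f x)"
    by (rule mult_nonneg_nonneg) (use f_bd[of x] x2 \<epsilon>_pos in auto)
  then have "\<epsilon> * (- a * f x) * (s + e) \<le> \<epsilon> * (- a * f x) * s"
    using e(2) by (intro mult_left_mono) auto
  moreover have "a\<^sub>1 * r ^ 4 = r ^ 4 * ((q + \<beta>\<^sub>0)\<^sup>2 / 2) + (\<beta>\<^sub>0 * (2 * sqrt (B * (c\<^sub>1 + 1)) + \<beta>\<^sub>0))\<^sup>2 / 4 * r ^ 4"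
  proof -
    have "a\<^sub>1 = (q + \<beta>\<^sub>0)\<^sup>2 / 2 + (\<beta>\<^sub>0 * (2 * sqrt (B * (c\<^sub>1 + 1)) + \<beta>\<^sub>0))\<^sup>2 / 4"
      by (simp only: a\<^sub>1_def layer_const_def \<beta>\<^sub>0_def q_def)
    then show ?thesis by (simp only: distrib_right mult.commute[of "(q + \<beta>\<^sub>0)\<^sup>2 / 2"])
  qed
  ultimately show ?thesis
    using kin pot unfolding L_eq w s_def[symmetric] by linarith
qed

lemma L_w_mid:
  assumes x: "y\<^sub>1 < x" "x < y\<^sub>2"
  shows "L x (w x) (w' x) \<le> \<epsilon> * (- a * f x) * sqrt (\<mu> x) + q\<^sup>2 * r ^ 4"
proof -
  have w: "w x = sqrt (\<mu> x)" "w' x = \<mu>' x / (2 * sqrt (\<mu> x))"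
    using x w_mid[of x] by (auto simp: w'_def)
  have "\<bar>w' x\<bar> \<le> q / r"
    using sqrt_slope_le[of x] x order unfolding w by (simp del: abs_divide)
  note kin = kinetic_le[OF this]
  have "((w x)\<^sup>2 - \<mu> x)\<^sup>2 / 4 = 0"
    using \<mu>_pos[of x] x order by (simp add: w)
  moreover have "r ^ 4 * (q\<^sup>2 / 2) \<le> q\<^sup>2 * r ^ 4"
    by simp
  ultimately show ?thesis
    using kin unfolding L_eq w(1) by linarith
qed

text \<open>The interpolation factor has slope \<eta> / m with m = \<epsilon> / N, which costs at
  most \<epsilon>^2 (\<eta> N / m)^2 = \<eta>^2 N^4; a relative defect of at most \<eta> costs no
  more than that in the potential. The slope of sqrt \<mu> itself gives the q^2 term.\<close>

lemma L_w_right: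
  assumes x: "y\<^sub>2 < x" "x < x\<^sub>2"
  shows "L x (w x) (w' x) \<le> \<epsilon> * (- a * f x) * sqrt (\<mu> x) + q\<^sup>2 * r ^ 4 + 2 * \<eta>\<^sup>2 * N ^ 4"
proof -
  have x2: "x\<^sub>1 < x" "z\<^sub>0 < x" "\<not> x < y\<^sub>1" using x order by auto
  define s \<theta> g where "s = sqrt (\<mu> x)" and "\<theta> = 1 - \<eta> * (1 - (x\<^sub>2 - x) / m)" and "g = \<mu>' x / (2 * sqrt (\<mu> x))"
  have s: "s > 0" "s\<^sup>2 = \<mu> x" "s \<le> N"
    using \<mu>_pos[of x] \<mu>_mono[of x x\<^sub>2] x x2 by (auto simp: s_def N_def)
  have t: "0 \<le> 1 - (x\<^sub>2 - x) / m" "1 - (x\<^sub>2 - x) / m \<le> 1"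
    using x m_pos by (auto simp: y\<^sub>2_def)
  have \<theta>: "1 - \<theta> \<le> \<eta>" "\<theta> \<le> 1" "0 \<le> \<theta>"
  proof -
    have "\<eta> * (1 - (x\<^sub>2 - x) / m) \<le> \<eta>" "0 \<le> \<eta> * (1 - (x\<^sub>2 - x) / m)"
      using t pos by (auto intro: mult_left_le)
    then show "1 - \<theta> \<le> \<eta>" "\<theta> \<le> 1" "0 \<le> \<theta>"
      using pos(7,8) unfolding \<theta>_def by linarith+
  qed
  have w: "w x = \<theta> * s" "w' x = \<theta> * g - \<eta> / m * s"
    using x x2 w_right[of x] by (auto simp: s_def \<theta>_def g_def w'_def)
  have g: "0 \<le> g" "g \<le> q / r"
    using sqrt_slope_le[of x] x x2 by (auto simp: g_def)
  have "(w' x)\<^sup>2 \<le> 2 * g\<^sup>2 + 2 * (\<eta> / m * N)\<^sup>2"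
  proof -
    have "(\<theta> * g - \<eta> / m * s)\<^sup>2 \<le> 2 * (\<theta> * g)\<^sup>2 + 2 * (\<eta> / m * s)\<^sup>2"
      using zero_le_power2[of "\<theta> * g + \<eta> / m * s"] by (simp add: power2_diff power2_sum)
    moreover have "(\<theta> * g)\<^sup>2 \<le> g\<^sup>2"
      using \<theta> g by (intro power_mono mult_left_le_one_le) auto
    moreover have "(\<eta> / m * s)\<^sup>2 \<le> (\<eta> / m * N)\<^sup>2"
      using s pos m_pos by (intro power_mono mult_left_mono) auto
    ultimately show ?thesis unfolding w by linarith
  qed
  then have "r ^ 6 / 2 * (w' x)\<^sup>2 \<le> r ^ 6 / 2 * (2 * g\<^sup>2 + 2 * (\<eta> / m * N)\<^sup>2)"
    by (rule mult_left_mono) simp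
  also have "\<dots> = 2 * (r ^ 6 / 2 * g\<^sup>2) + r ^ 6 * (\<eta> / m * N)\<^sup>2"
    by (simp add: algebra_simps)
  also have "r ^ 6 * (\<eta> / m * N)\<^sup>2 = \<eta>\<^sup>2 * N ^ 4"
    using pos N_pos by (simp add: m_def \<epsilon>_def power_mult_distrib power_divide)
  also have "r ^ 6 / 2 * g\<^sup>2 \<le> r ^ 4 * (q\<^sup>2 / 2)"
    using g by (intro kinetic_le) simp
  finally have kin: "r ^ 6 / 2 * (w' x)\<^sup>2 \<le> q\<^sup>2 * r ^ 4 + \<eta>\<^sup>2 * N ^ 4"
    by (simp add: mult.commute[of "q\<^sup>2"])
  have "(\<theta> * s)\<^sup>2 - \<mu> x = - ((1 - \<theta>) * (1 + \<theta>) * s\<^sup>2)"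
    unfolding s(2)[symmetric] by (simp add: power2_eq_square algebra_simps)
  then have "((\<theta> * s)\<^sup>2 - \<mu> x)\<^sup>2 = ((1 - \<theta>) * (1 + \<theta>) * s\<^sup>2)\<^sup>2"
    by simp
  also have "\<dots> \<le> (\<eta> * 2 * N\<^sup>2)\<^sup>2"
    using \<theta> s(1,3) pos by (intro power_mono mult_mono mult_nonneg_nonneg) auto
  also have "\<dots> = 4 * (\<eta>\<^sup>2 * N ^ 4)"
    by (simp add: power_mult_distrib power_mult[symmetric])
  finally have pot: "((\<theta> * s)\<^sup>2 - \<mu> x)\<^sup>2 / 4 \<le> \<eta>\<^sup>2 * N ^ 4"
    by simp
  have "0 \<le> \<epsilon> * (- a * f x)"
    by (rule mult_nonneg_nonneg) (use f_bd[of x] x x2 \<epsilon>_pos in auto)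
  then have "\<epsilon> * (- a * f x) * (\<theta> * s) \<le> \<epsilon> * (- a * f x) * s"
    using \<theta> s by (intro mult_left_mono mult_left_le_one_le) auto
  then show ?thesis
    using kin pot unfolding L_eq w(1) s_def[symmetric] by linarith
qed

text \<open>Since \<open>\<gamma> \<mu>' \<le> \<mu>' / \<surd>2 - a \<bar>f\<bar>\<close>, the \<open>\<eta>\<close>-term of \<open>H\<close> is the gain from \<open>v \<le> (1 - \<eta>) \<surd>\<mu>\<close>.\<close>

definition "\<gamma> = c\<^sub>0 / B"

definition H :: "real \<Rightarrow> real" where
  "H x = \<epsilon> / sqrt 2 * (\<mu> x * v x - (v x) ^ 3 / 3 - 2 / 3 * (\<mu> x * sqrt (\<mu> x)))
     + \<epsilon> * \<eta> * \<gamma> * (2 / 3 * (\<mu> x * sqrt (\<mu> x)))"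

definition H' :: "real \<Rightarrow> real" where
  "H' x = \<epsilon> / sqrt 2 * (\<mu>' x * v x + (\<mu> x - (v x)\<^sup>2) * v' x - sqrt (\<mu> x) * \<mu>' x)
     + \<epsilon> * \<eta> * \<gamma> * (sqrt (\<mu> x) * \<mu>' x)"

section \<open>The calibration inequality\<close>

lemma H_deriv:
  assumes "x\<^sub>1 \<le> x" "x \<le> x\<^sub>2"
  shows "(H has_real_derivative H' x) (at x)"
proof -
  have "\<mu> x > 0" using \<mu>_pos[of x] assms order by simp
  note G = DERIV_mult_sqrt[OF \<mu> this]
  have G': "((\<lambda>x. 2 / 3 * (\<mu> x * sqrt (\<mu> x))) has_real_derivative sqrt (\<mu> x) * \<mu>' x) (at x)"
    using DERIV_cmult[OF G, of "2 / 3"] by (simp add: mult.commute[of "sqrt (\<mu> x)"])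
  have V: "((\<lambda>x. v x ^ 3 / 3) has_real_derivative (v x)\<^sup>2 * v' x) (at x)"
    by (auto intro!: derivative_eq_intros v)
  have "((\<lambda>x. \<mu> x * v x - v x ^ 3 / 3 - 2 / 3 * (\<mu> x * sqrt (\<mu> x))) has_real_derivative
      \<mu>' x * v x + (\<mu> x - (v x)\<^sup>2) * v' x - sqrt (\<mu> x) * \<mu>' x) (at x)"
    by (rule DERIV_cong[OF DERIV_diff[OF DERIV_diff[OF DERIV_mult[OF \<mu> v] V] G']]) (simp add: algebra_simps)
  from DERIV_add[OF DERIV_cmult[OF this] DERIV_cmult[OF G']] show ?thesis
    unfolding H_def[abs_def] H'_def .
qed

text \<open>Completing the square bounds kinetic plus potential energy below by \<epsilon> / sqrt 2
  times (\<mu> - v^2) v'. Measured against sqrt \<mu>, what remains is \<epsilon> (sqrt \<mu> - v)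
  (\<mu>' / sqrt 2 + a f), where the last factor is at least \<open>c\<^sub>0\<close> and the
  difference at least \<eta> sqrt \<mu>.\<close>

lemma calibration:
  assumes x: "x\<^sub>1 \<le> x" "x \<le> x\<^sub>2"
  shows "H' x + \<epsilon> * (- a * f x) * sqrt (\<mu> x) \<le> L x (v x) (v' x)"
proof -
  define s k where "s = sqrt (\<mu> x)" and "k = \<mu>' x / sqrt 2 - (- a * f x)"
  have z: "z\<^sub>0 < x" using x order by simp
  have "s \<ge> 0" using \<mu>_pos[of x] x z by (simp add: s_def)
  have k: "k \<ge> c\<^sub>0" using f_bd[of x] x z by (simp add: k_def)
  have "\<epsilon> / sqrt 2 * ((\<mu> x - (v x)\<^sup>2) * v' x) \<le> r ^ 6 / 2 * (v' x)\<^sup>2 + ((v x)\<^sup>2 - \<mu> x)\<^sup>2 / 4"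
  proof -
    have "0 \<le> (\<epsilon> / sqrt 2 * v' x - (\<mu> x - (v x)\<^sup>2) / 2)\<^sup>2" by simp
    also have "\<dots> = (\<epsilon> / sqrt 2 * v' x)\<^sup>2 - \<epsilon> / sqrt 2 * v' x * (\<mu> x - (v x)\<^sup>2) + (\<mu> x - (v x)\<^sup>2)\<^sup>2 / 4"
      by (simp only: power2_diff[of "\<epsilon> / sqrt 2 * v' x"] power_divide) simp
    also have "(\<epsilon> / sqrt 2 * v' x)\<^sup>2 = \<epsilon>\<^sup>2 / 2 * (v' x)\<^sup>2"
      by (simp add: power_mult_distrib power_divide)
    also have "(\<mu> x - (v x)\<^sup>2)\<^sup>2 = ((v x)\<^sup>2 - \<mu> x)\<^sup>2"
      by (rule power2_commute)
    also have "\<epsilon> / sqrt 2 * v' x * (\<mu> x - (v x)\<^sup>2) = \<epsilon> / sqrt 2 * ((\<mu> x - (v x)\<^sup>2) * v' x)"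
      by simp
    finally show ?thesis by (simp add: \<epsilon>_def power_mult[symmetric])
  qed
  moreover have "\<epsilon> * v x * k \<le> \<epsilon> * s * k - \<epsilon> * \<eta> * \<gamma> * (s * \<mu>' x)"
  proof -
    have "v x * k \<le> (1 - \<eta>) * s * k"
      using v_le[OF x] k pos by (intro mult_right_mono) (auto simp: s_def)
    moreover have "\<gamma> * \<mu>' x \<le> k"
    proof -
      have "\<gamma> * \<mu>' x \<le> \<gamma> * B"
        using \<mu>'_bd[of x] x z pos B_pos by (intro mult_left_mono) (auto simp: \<gamma>_def)
      with k B_pos show ?thesis by (simp add: \<gamma>_def)
    qed
    then have "\<eta> * s * (\<gamma> * \<mu>' x) \<le> \<eta> * s * k"
      using pos \<open>s \<ge> 0\<close> by (intro mult_left_mono) auto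
    ultimately have "v x * k \<le> s * k - \<eta> * s * (\<gamma> * \<mu>' x)"
      by (simp add: algebra_simps)
    then have "\<epsilon> * (v x * k) \<le> \<epsilon> * (s * k - \<eta> * s * (\<gamma> * \<mu>' x))"
      using \<epsilon>_pos by (intro mult_left_mono) auto
    then show ?thesis by (simp add: algebra_simps)
  qed
  moreover have "\<epsilon> / sqrt 2 * (\<mu>' x * v x - s * \<mu>' x) = \<epsilon> * (v x - s) * (k + - a * f x)"
    by (simp add: k_def algebra_simps)
  ultimately show ?thesis
    unfolding L_eq H'_def s_def[symmetric] by (simp add: algebra_simps)
qed

section \<open>Comparison of the two energies\<close>

lemma w'_bounded: "\<exists>C. \<forall>x\<in>{x\<^sub>1..x\<^sub>2}. \<bar>w' x\<bar> \<le> C"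
proof -
  let ?g = "\<lambda>x. \<mu>' x / (2 * sqrt (\<mu> x))"
  have c: "continuous_on {x\<^sub>1..x\<^sub>2} ?g" "continuous_on {x\<^sub>1..x\<^sub>2} (\<lambda>x. sqrt (\<mu> x))"
    using \<mu>_pos order
    by (auto intro!: continuous_intros continuous_on_subset[OF \<mu>_cont] continuous_on_subset[OF \<mu>'])
       (metis \<mu>_pos dual_order.strict_trans1 less_irrefl)
  have bdd: "\<exists>C. \<forall>x\<in>{x\<^sub>1..x\<^sub>2}. \<bar>h x\<bar> \<le> C" if "continuous_on {x\<^sub>1..x\<^sub>2} h" for h :: "real \<Rightarrow> real"
    using compact_imp_bounded[OF compact_continuous_image[OF that compact_Icc]] by (auto simp: bounded_iff)
  have "continuous_on {x\<^sub>1..x\<^sub>2} (\<lambda>x. ?g x - \<beta> / r\<^sup>2)" "continuous_on {x\<^sub>1..x\<^sub>2} ?g"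
    "continuous_on {x\<^sub>1..x\<^sub>2} (\<lambda>x. (1 - \<eta> * (1 - (x\<^sub>2 - x) / m)) * ?g x - \<eta> / m * sqrt (\<mu> x))"
    using m_pos by (intro continuous_intros c; simp)+
  from this[THEN bdd] obtain C1 C2 C3 where
    "\<forall>x\<in>{x\<^sub>1..x\<^sub>2}. \<bar>?g x - \<beta> / r\<^sup>2\<bar> \<le> C1" "\<forall>x\<in>{x\<^sub>1..x\<^sub>2}. \<bar>?g x\<bar> \<le> C2"
    "\<forall>x\<in>{x\<^sub>1..x\<^sub>2}. \<bar>(1 - \<eta> * (1 - (x\<^sub>2 - x) / m)) * ?g x - \<eta> / m * sqrt (\<mu> x)\<bar> \<le> C3" by blast
  then have "\<forall>x\<in>{x\<^sub>1..x\<^sub>2}. \<bar>w' x\<bar> \<le> max C1 (max C2 C3)"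
    by (auto simp: w'_def le_max_iff_disj)
  then show ?thesis by blast
qed

text \<open>\<open>H\<close> minus the accumulated costs of the competitor. The kinked terms charge
  each layer cost only on its layer: \<open>min x y\<^sub>1\<close> grows up to
  \<open>y\<^sub>1\<close> and \<open>max x y\<^sub>2\<close> from \<open>y\<^sub>2\<close>
  on.\<close>

definition \<Psi> :: "real \<Rightarrow> real" where
  "\<Psi> x = H x - q\<^sup>2 * r ^ 4 * x - a\<^sub>1 * r ^ 4 * min x y\<^sub>1 - 2 * \<eta>\<^sup>2 * N ^ 4 * max x y\<^sub>2"

definition \<psi> :: "real \<Rightarrow> real" where
  "\<psi> x = H' x - q\<^sup>2 * r ^ 4 - a\<^sub>1 * r ^ 4 * (if x < y\<^sub>1 then 1 else 0) - 2 * \<eta>\<^sup>2 * N ^ 4 * (if x < y\<^sub>2 then 0 else 1)"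

lemma \<Psi>_deriv:
  assumes x: "x \<in> {x\<^sub>1<..<x\<^sub>2} - {y\<^sub>1, y\<^sub>2}"
  shows "(\<Psi> has_real_derivative \<psi> x) (at x)"
proof -
  have "((\<lambda>x. min x y\<^sub>1) has_real_derivative (if x < y\<^sub>1 then 1 else 0)) (at x)"
  proof (cases "x < y\<^sub>1")
    case True
    show ?thesis
      by (rule has_field_derivative_transform_within_open[where f = "\<lambda>x. x" and S = "{..<y\<^sub>1}"]) (use True in auto)
  next
    case False
    show ?thesis
      by (rule has_field_derivative_transform_within_open[where f = "\<lambda>x. y\<^sub>1" and S = "{y\<^sub>1<..}"]) (use False x in auto)
  qed
  moreover have "((\<lambda>x. max x y\<^sub>2) has_real_derivative (if x < y\<^sub>2 then 0 else 1)) (at x)"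
  proof (cases "x < y\<^sub>2")
    case True
    show ?thesis
      by (rule has_field_derivative_transform_within_open[where f = "\<lambda>x. y\<^sub>2" and S = "{..<y\<^sub>2}"]) (use True in auto)
  next
    case False
    show ?thesis
      by (rule has_field_derivative_transform_within_open[where f = "\<lambda>x. x" and S = "{y\<^sub>2<..}"]) (use False x in auto)
  qed
  moreover have "(H has_real_derivative H' x) (at x)"
    using x by (intro H_deriv) auto
  ultimately show ?thesis
    unfolding \<Psi>_def[abs_def] \<psi>_def
    using DERIV_cmult[OF DERIV_ident, of "q\<^sup>2 * r ^ 4" x UNIV]
    by (intro DERIV_diff DERIV_cmult) simp_all
qed

lemma a\<^sub>1_nonneg: "a\<^sub>1 \<ge> 0"
  by (simp add: a\<^sub>1_def layer_const_def)

lemma \<psi>_le: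
  assumes x: "x \<in> {x\<^sub>1<..<x\<^sub>2} - {y\<^sub>1, y\<^sub>2}"
  shows "\<psi> x \<le> L x (v x) (v' x) - L x (w x) (w' x)"
proof -
  have cal: "H' x + \<epsilon> * (- a * f x) * sqrt (\<mu> x) \<le> L x (v x) (v' x)"
    using x by (intro calibration) auto
  have nn: "0 \<le> q\<^sup>2 * r ^ 4" by simp
  consider "x < y\<^sub>1" | "y\<^sub>1 < x" "x < y\<^sub>2" | "y\<^sub>2 < x" using x by force
  then show ?thesis
  proof cases
    case 1
    moreover have "x < y\<^sub>2" using 1 order by simp
    ultimately have "\<psi> x = H' x - q\<^sup>2 * r ^ 4 - a\<^sub>1 * r ^ 4" by (simp add: \<psi>_def)
    moreover have "L x (w x) (w' x) \<le> \<epsilon> * (- a * f x) * sqrt (\<mu> x) + a\<^sub>1 * r ^ 4"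
      using x 1 by (intro L_w_left) auto
    ultimately show ?thesis using cal nn by linarith
  next
    case 2
    then show ?thesis using cal L_w_mid[of x] by (simp add: \<psi>_def)
  next
    case 3
    moreover have "\<not> x < y\<^sub>1" using 3 order by simp
    ultimately show ?thesis using cal L_w_right[of x] x by (simp add: \<psi>_def)
  qed
qed

text \<open>The gain is 2/3 \<eta> \<gamma> \<epsilon> N^3. It pays for three multiples of \<eta>^2
  \<epsilon> N^3, one from the boundary value of \<open>H\<close> at \<open>x\<^sub>2\<close> and
  two from the right layer, and for the remaining costs, which r <= \<kappa> N bounds by multiples
  of \<kappa> \<epsilon> N^3. This balance is \<open>budget\<close>.\<close>

lemma \<Psi>_increment: "\<Psi> x\<^sub>1 < \<Psi> x\<^sub>2"
proof -
  define K where "K = A\<^sub>0 ^ 3 + 2 * \<gamma> / 3 * sqrt (B * c\<^sub>1) ^ 3 + a\<^sub>1"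
  have \<gamma>: "\<gamma> > 0" using pos B_pos by (simp add: \<gamma>_def)
  have "K \<ge> 0"
    using pos B_pos \<gamma> a\<^sub>1_nonneg by (simp add: K_def)
  have s2: "1 / sqrt 2 \<le> (1::real)" by simp
  have H2: "\<epsilon> * N ^ 3 * (2 / 3 * \<eta> * \<gamma> - \<eta>\<^sup>2) \<le> H x\<^sub>2"
  proof -
    \<comment> \<open>There is no term linear in \<eta>, because sqrt \<mu> is a critical point of y
      \<mapsto> \<mu> y - y^3 / 3, with value 2/3 \<mu>^(3/2).\<close>
    have 1: "\<mu> x\<^sub>2 * v x\<^sub>2 - (v x\<^sub>2) ^ 3 / 3 - 2 / 3 * (\<mu> x\<^sub>2 * sqrt (\<mu> x\<^sub>2)) = N ^ 3 * (\<eta> ^ 3 / 3 - \<eta>\<^sup>2)"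
      unfolding v_x\<^sub>2 N_sq[symmetric] using N_pos by (simp add: field_simps eval_nat_numeral)
    have 2: "\<epsilon> / sqrt 2 * (N ^ 3 * (\<eta> ^ 3 / 3 - \<eta>\<^sup>2)) \<ge> \<epsilon> * N ^ 3 * - \<eta>\<^sup>2"
    proof -
      have "\<epsilon> / sqrt 2 * (N ^ 3 * (\<eta> ^ 3 / 3 - \<eta>\<^sup>2)) \<ge> \<epsilon> / sqrt 2 * (N ^ 3 * - \<eta>\<^sup>2)"
        using pos N_pos \<epsilon>_pos by (intro mult_left_mono) auto
      moreover have "(\<epsilon> * N ^ 3 * \<eta>\<^sup>2) * (1 / sqrt 2) \<le> \<epsilon> * N ^ 3 * \<eta>\<^sup>2"
        using N_pos \<epsilon>_pos s2 by (intro mult_left_le) auto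
      ultimately show ?thesis by simp
    qed
    have 3: "\<mu> x\<^sub>2 * sqrt (\<mu> x\<^sub>2) = N ^ 3"
      unfolding N_sq[symmetric] using N_pos by (simp add: power2_eq_square power3_eq_cube)
    have "H x\<^sub>2 = \<epsilon> / sqrt 2 * (N ^ 3 * (\<eta> ^ 3 / 3 - \<eta>\<^sup>2)) + \<epsilon> * \<eta> * \<gamma> * (2 / 3 * N ^ 3)"
      unfolding H_def 3 1[unfolded 3] ..
    moreover have "\<epsilon> * N ^ 3 * (2 / 3 * \<eta> * \<gamma> - \<eta>\<^sup>2) = \<epsilon> * N ^ 3 * - \<eta>\<^sup>2 + \<epsilon> * \<eta> * \<gamma> * (2 / 3 * N ^ 3)"
      by (simp add: algebra_simps)
    ultimately show ?thesis using 2 by linarith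
  qed
  \<comment> \<open>At \<open>x\<^sub>1\<close> both \<open>v\<close> and sqrt \<mu> are of order r,
    so \<open>H\<close> is at most of order \<epsilon> r^3 once its nonpositive terms are
    dropped.\<close>
  have H1: "H x\<^sub>1 \<le> \<epsilon> * r ^ 3 * (A\<^sub>0 ^ 3 + 2 * \<gamma> / 3 * sqrt (B * c\<^sub>1) ^ 3)"
  proof -
    define s where "s = sqrt (\<mu> x\<^sub>1)"
    have s: "s > 0" "\<mu> x\<^sub>1 = s\<^sup>2"
      using \<mu>_pos[of x\<^sub>1] order by (auto simp: s_def)
    have "\<mu> x\<^sub>1 \<le> B * c\<^sub>1 * r\<^sup>2"
      using \<mu>_bounds(2)[of x\<^sub>1] order by (simp add: x\<^sub>1_def mult.assoc)
    then have "s \<le> sqrt (B * c\<^sub>1 * r\<^sup>2)"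
      unfolding s_def by (rule real_sqrt_le_mono)
    then have "s \<le> sqrt (B * c\<^sub>1) * r"
      using pos by (simp add: real_sqrt_mult)
    then have s3: "s ^ 3 \<le> sqrt (B * c\<^sub>1) ^ 3 * r ^ 3"
      using s power_mono[of s "sqrt (B * c\<^sub>1) * r" 3] by (simp add: power_mult_distrib)
    have "(- v x\<^sub>1) ^ 3 \<le> (A\<^sub>0 * r) ^ 3"
      using v_x\<^sub>1 by (intro power_mono) auto
    then have v3: "- ((v x\<^sub>1) ^ 3) \<le> A\<^sub>0 ^ 3 * r ^ 3" "0 \<le> A\<^sub>0 ^ 3 * r ^ 3"
      using pos by (simp_all add: power_mult_distrib power_minus_odd)
    have "\<mu> x\<^sub>1 * v x\<^sub>1 \<le> 0"
      using v_x\<^sub>1(1) unfolding s(2) by (intro mult_nonneg_nonpos) auto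
    then have "\<mu> x\<^sub>1 * v x\<^sub>1 - (v x\<^sub>1) ^ 3 / 3 - 2 / 3 * (\<mu> x\<^sub>1 * s) \<le> A\<^sub>0 ^ 3 * r ^ 3"
    proof -
      have "0 \<le> \<mu> x\<^sub>1 * s" using s by simp
      with v3 \<open>\<mu> x\<^sub>1 * v x\<^sub>1 \<le> 0\<close> show ?thesis by linarith
    qed
    then have "\<epsilon> / sqrt 2 * (\<mu> x\<^sub>1 * v x\<^sub>1 - (v x\<^sub>1) ^ 3 / 3 - 2 / 3 * (\<mu> x\<^sub>1 * s)) \<le> \<epsilon> / sqrt 2 * (A\<^sub>0 ^ 3 * r ^ 3)"
      using \<epsilon>_pos by (intro mult_left_mono) auto
    also have "\<dots> = (\<epsilon> * (A\<^sub>0 ^ 3 * r ^ 3)) * (1 / sqrt 2)"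
      by simp
    also have "\<dots> \<le> \<epsilon> * (A\<^sub>0 ^ 3 * r ^ 3)"
      using v3(2) \<epsilon>_pos s2 by (intro mult_left_le) auto
    finally have 1: "\<epsilon> / sqrt 2 * (\<mu> x\<^sub>1 * v x\<^sub>1 - (v x\<^sub>1) ^ 3 / 3 - 2 / 3 * (\<mu> x\<^sub>1 * s)) \<le> \<epsilon> * (A\<^sub>0 ^ 3 * r ^ 3)" .
    have "\<epsilon> * \<eta> * \<gamma> * (2 / 3 * (\<mu> x\<^sub>1 * s)) = \<eta> * (\<epsilon> * \<gamma> * (2 / 3) * s ^ 3)"
      by (simp add: s(2) power2_eq_square power3_eq_cube)
    also have "\<dots> \<le> \<epsilon> * \<gamma> * (2 / 3) * s ^ 3"
      using pos \<epsilon>_pos \<gamma> s by (intro mult_left_le_one_le) auto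
    also have "\<dots> \<le> \<epsilon> * \<gamma> * (2 / 3) * (sqrt (B * c\<^sub>1) ^ 3 * r ^ 3)"
      using \<epsilon>_pos \<gamma> s3 by (intro mult_left_mono) auto
    finally show ?thesis
      using 1 unfolding H_def s_def[symmetric] by (simp add: algebra_simps)
  qed
  have "\<Psi> x\<^sub>2 - \<Psi> x\<^sub>1 = H x\<^sub>2 - H x\<^sub>1 - q\<^sup>2 * r ^ 4 * (x\<^sub>2 - x\<^sub>1) - a\<^sub>1 * r ^ 4 * r\<^sup>2 - 2 * \<eta>\<^sup>2 * N ^ 4 * m"
  proof -
    have ends: "min x\<^sub>2 y\<^sub>1 = x\<^sub>1 + r\<^sup>2" "min x\<^sub>1 y\<^sub>1 = x\<^sub>1" "max x\<^sub>2 y\<^sub>2 = x\<^sub>2" "max x\<^sub>1 y\<^sub>2 = x\<^sub>2 - m"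
      using order by (auto simp: y\<^sub>1_def[symmetric] y\<^sub>2_def[symmetric])
    show ?thesis
      unfolding \<Psi>_def ends by (simp add: algebra_simps)
  qed
  moreover have "a\<^sub>1 * r ^ 4 * r\<^sup>2 = \<epsilon> * r ^ 3 * a\<^sub>1"
  proof -
    have "r ^ 4 * r\<^sup>2 = r ^ 3 * r ^ 3" by (simp add: power_add[symmetric])
    then show ?thesis by (simp add: \<epsilon>_def)
  qed
  moreover have "2 * \<eta>\<^sup>2 * N ^ 4 * m = \<epsilon> * N ^ 3 * (2 * \<eta>\<^sup>2)"
  proof -
    have "N ^ 4 = N ^ 3 * N" by (simp add: power_Suc2[symmetric])
    then show ?thesis using N_pos by (simp add: m_def)
  qed
  moreover have "\<epsilon> * N ^ 3 * (2 / 3 * \<eta> * \<gamma> - 3 * \<eta>\<^sup>2)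
      = \<epsilon> * N ^ 3 * (2 / 3 * \<eta> * \<gamma> - \<eta>\<^sup>2) - \<epsilon> * N ^ 3 * (2 * \<eta>\<^sup>2)"
    by (simp add: algebra_simps)
  moreover have "\<epsilon> * r ^ 3 * K = \<epsilon> * r ^ 3 * (A\<^sub>0 ^ 3 + 2 * \<gamma> / 3 * sqrt (B * c\<^sub>1) ^ 3) + \<epsilon> * r ^ 3 * a\<^sub>1"
    by (simp add: K_def distrib_left)
  ultimately have inc: "\<Psi> x\<^sub>2 - \<Psi> x\<^sub>1 \<ge> \<epsilon> * N ^ 3 * (2 / 3 * \<eta> * \<gamma> - 3 * \<eta>\<^sup>2) - \<epsilon> * r ^ 3 * K - q\<^sup>2 * r ^ 4 * (x\<^sub>2 - x\<^sub>1)"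
    using H1 H2 by linarith
  have \<kappa>N: "0 \<le> \<kappa> * N" using pos N_pos by simp
  have "r ^ 3 \<le> (\<kappa> * N) ^ 3"
    using r_le pos by (intro power_mono) auto
  also have "\<dots> = \<kappa> ^ 3 * N ^ 3" by (simp add: power_mult_distrib)
  also have "\<kappa> ^ 3 \<le> \<kappa>"
    using pos power_decreasing[of 1 3 \<kappa>] by simp
  finally have "r ^ 3 \<le> \<kappa> * N ^ 3"
    using N_pos by (simp add: mult_right_mono)
  then have e1: "\<epsilon> * r ^ 3 * K \<le> \<epsilon> * (\<kappa> * N ^ 3) * K"
    using \<epsilon>_pos \<open>K \<ge> 0\<close> by (intro mult_right_mono mult_left_mono) auto
  \<comment> \<open>The lower bound on \<mu> converts the length of the interval into at most N^2 /
    b.\<close>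
  have "b * (x\<^sub>2 - x\<^sub>1) \<le> b * (x\<^sub>2 - z\<^sub>0)"
    using order pos by (intro mult_left_mono) auto
  also have "\<dots> \<le> N\<^sup>2"
    using \<mu>_bounds(1)[of x\<^sub>2] order by (simp add: N_sq)
  finally have "x\<^sub>2 - x\<^sub>1 \<le> N\<^sup>2 / b"
    using pos by (simp add: field_simps)
  then have "r * (x\<^sub>2 - x\<^sub>1) \<le> (\<kappa> * N) * (N\<^sup>2 / b)"
    using r_le pos \<kappa>N order by (intro mult_mono) auto
  then have "\<epsilon> * q\<^sup>2 * (r * (x\<^sub>2 - x\<^sub>1)) \<le> \<epsilon> * q\<^sup>2 * ((\<kappa> * N) * (N\<^sup>2 / b))"
    using \<epsilon>_pos by (intro mult_left_mono) auto
  moreover have "r ^ 4 = r ^ 3 * r" "N ^ 3 = N * N\<^sup>2"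
    by (simp_all add: power_Suc2[symmetric] power_Suc[symmetric])
  ultimately have e2: "q\<^sup>2 * r ^ 4 * (x\<^sub>2 - x\<^sub>1) \<le> \<epsilon> * (\<kappa> * N ^ 3) * (q\<^sup>2 / b)"
    by (simp add: \<epsilon>_def mult_ac)
  have "K + q\<^sup>2 / b = error_const b B c\<^sub>0 A\<^sub>0 c\<^sub>1"
    by (simp add: K_def error_const_def a\<^sub>1_def q_def \<gamma>_def)
  then have "0 < 2 / 3 * \<eta> * \<gamma> - 3 * \<eta>\<^sup>2 - \<kappa> * (K + q\<^sup>2 / b)"
    using budget by (simp add: \<gamma>_def mult_ac)
  then have "0 < (\<epsilon> * N ^ 3) * (2 / 3 * \<eta> * \<gamma> - 3 * \<eta>\<^sup>2 - \<kappa> * (K + q\<^sup>2 / b))"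
    using \<epsilon>_pos N_pos by (intro mult_pos_pos) auto
  moreover have "(\<epsilon> * N ^ 3) * (2 / 3 * \<eta> * \<gamma> - 3 * \<eta>\<^sup>2 - \<kappa> * (K + q\<^sup>2 / b))
      = \<epsilon> * N ^ 3 * (2 / 3 * \<eta> * \<gamma> - 3 * \<eta>\<^sup>2) - \<epsilon> * (\<kappa> * N ^ 3) * K - \<epsilon> * (\<kappa> * N ^ 3) * (q\<^sup>2 / b)"
    by (simp add: algebra_simps)
  ultimately show ?thesis using inc e1 e2 by linarith
qed

lemma energy_gap:
  "(LINT x:{x\<^sub>1..x\<^sub>2}|lborel. L x (w x) (w' x)) < (LINT x:{x\<^sub>1..x\<^sub>2}|lborel. L x (v x) (v' x))"
proof -
  obtain C where "\<And>x. x \<in> {x\<^sub>1..x\<^sub>2} \<Longrightarrow> \<bar>w' x\<bar> \<le> C" using w'_bounded by blast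
  then have Lw: "set_integrable lborel {x\<^sub>1..x\<^sub>2} (\<lambda>x. L x (w x) (w' x))"
    by (rule set_integrable_lagrangian[OF \<mu>_cont f w_cont w'_meas])
  have "set_integrable lborel {x\<^sub>1..x\<^sub>2} (\<lambda>x. L x (v x) (v' x))"
    unfolding lagrangian_def
    by (intro set_integrable_continuous continuous_intros continuous_on_subset[OF v_cont]
        continuous_on_subset[OF v'] continuous_on_subset[OF \<mu>_cont] continuous_on_subset[OF f]) auto
  note Lv = this
  have "continuous_on {x\<^sub>1..x\<^sub>2} H"
    using H_deriv by (intro continuous_at_imp_continuous_on ballI) (auto intro: DERIV_isCont)
  then have "continuous_on {x\<^sub>1..x\<^sub>2} \<Psi>"
    unfolding \<Psi>_def[abs_def] by (intro continuous_intros)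
  then have "\<Psi> x\<^sub>2 - \<Psi> x\<^sub>1 \<le> (LINT x:{x\<^sub>1..x\<^sub>2}|lborel. L x (v x) (v' x) - L x (w x) (w' x))"
    by (intro FTC_le_set_integral[where S = "{y\<^sub>1, y\<^sub>2}" and \<psi> = \<psi>])
      (use order in \<open>auto intro!: \<Psi>_deriv \<psi>_le set_integral_diff Lv Lw\<close>)
  with \<Psi>_increment show ?thesis
    using set_integral_diff(2)[OF Lv Lw] by simp
qed

end

section \<open>Signs of Painleve-II solutions\<close>

lemma PII_nonneg_imp_pos:
  assumes Y: "PII_solution \<alpha> Y" and "\<alpha> < 0" and nonneg: "\<And>s. Y s \<ge> 0"
  shows "Y s > 0"
proof (rule ccontr)
  assume "\<not> Y s > 0"
  with nonneg[of s] have Y0: "Y s = 0" by simp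
  have "(Y has_real_derivative deriv Y s) (at s)"
    using Y C2_on_UNIV_derivatives(1) by (auto simp: PII_solution_def)
  \<comment> \<open>A zero of a nonnegative function is a minimum, yet a zero with vanishing slope
    is a strict local maximum of Y.\<close>
  then have "deriv Y s = 0"
    by (rule DERIV_local_min[of _ _ _ 1]) (use nonneg Y0 in auto)
  from PII_solution_no_min_at_zero[OF Y \<open>\<alpha> < 0\<close> Y0 this]
  obtain \<delta> where \<delta>: "\<delta> > 0" "\<forall>t. t \<noteq> s \<longrightarrow> \<bar>t - s\<bar> < \<delta> \<longrightarrow> Y t < 0" by blast
  have "Y (s + \<delta> / 2) < 0" using \<delta>(1) \<delta>(2)[rule_format, of "s + \<delta> / 2"] by simp
  with nonneg[of "s + \<delta> / 2"] show False by simp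
qed

text \<open>The supremum of the negativity set separates Y <= 0 from Y >= 0. The slope there is
  positive: otherwise Y would be negative just to the right, by a negative slope or, for slope zero,
  because the point is a strict local maximum.\<close>

lemma PII_unique_sign_change:
  assumes Y: "PII_solution \<alpha> Y" and "\<alpha> < 0" and p: "Y p > 0" and n: "Y n < 0"
    and ord: "\<And>s t. Y s < 0 \<Longrightarrow> Y t > 0 \<Longrightarrow> s < t"
  shows "\<exists>!s\<^sub>0. changes_sign_at Y s\<^sub>0"
proof -
  note d = C2_on_UNIV_derivatives[OF conjunct1[OF Y[unfolded PII_solution_def]]]
  define s\<^sub>0 where "s\<^sub>0 = Sup {s. Y s < 0}"
  have bdd: "bdd_above {s. Y s < 0}"
    using ord[OF _ p] by (auto intro!: bdd_aboveI[of _ p] less_imp_le)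
  have left: "Y s \<le> 0" if "s < s\<^sub>0" for s
  proof -
    have "\<exists>t\<in>{s. Y s < 0}. s < t"
      using less_cSup_iff[OF _ bdd, of s] that n by (auto simp: s\<^sub>0_def)
    then show ?thesis using ord[of _ s] by force
  qed
  have right: "Y s \<ge> 0" if "s > s\<^sub>0" for s
    using cSup_upper[OF _ bdd, of s] that by (force simp: s\<^sub>0_def)
  have isC: "(Y \<longlongrightarrow> Y s\<^sub>0) (at s\<^sub>0)"
    using DERIV_isCont[OF d(1)] by (simp add: isCont_def)
  then have isC': "(Y \<longlongrightarrow> Y s\<^sub>0) (at_left s\<^sub>0)" "(Y \<longlongrightarrow> Y s\<^sub>0) (at_right s\<^sub>0)"
    by (simp_all add: filterlim_at_split)
  have "Y s\<^sub>0 \<le> 0"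
    by (rule tendsto_upperbound[OF isC'(1)]) (auto simp: eventually_at_filter left)
  moreover have "Y s\<^sub>0 \<ge> 0"
    by (rule tendsto_lowerbound[OF isC'(2)]) (auto simp: eventually_at_filter right)
  ultimately have Y0: "Y s\<^sub>0 = 0" by simp
  have pos: "deriv Y s\<^sub>0 > 0"
  proof (rule ccontr)
    assume "\<not> deriv Y s\<^sub>0 > 0"
    then have "\<exists>\<delta>>0. \<forall>h>0. h < \<delta> \<longrightarrow> Y (s\<^sub>0 + h) < 0"
    proof (cases "deriv Y s\<^sub>0 = 0")
      case True
      from PII_solution_no_min_at_zero[OF Y \<open>\<alpha> < 0\<close> Y0 True]
      obtain \<delta> where "\<delta> > 0" "\<forall>t. t \<noteq> s\<^sub>0 \<longrightarrow> \<bar>t - s\<^sub>0\<bar> < \<delta> \<longrightarrow> Y t < 0" by blast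
      then show ?thesis by (intro exI[of _ \<delta>]) simp
    next
      case False
      with \<open>\<not> deriv Y s\<^sub>0 > 0\<close> show ?thesis
        using DERIV_neg_dec_right[OF d(1), of s\<^sub>0] Y0 by simp
    qed
    then obtain \<delta> where \<delta>: "\<delta> > 0" "\<forall>h>0. h < \<delta> \<longrightarrow> Y (s\<^sub>0 + h) < 0" by blast
    then have "Y (s\<^sub>0 + \<delta> / 2) < 0" by simp
    with right[of "s\<^sub>0 + \<delta> / 2"] \<delta>(1) show False by simp
  qed
  obtain d1 where d1: "d1 > 0" "\<And>h. h > 0 \<Longrightarrow> h < d1 \<Longrightarrow> Y (s\<^sub>0 - h) < 0"
    using DERIV_pos_inc_left[OF d(1) pos] Y0 by auto
  obtain d2 where d2: "d2 > 0" "\<And>h. h > 0 \<Longrightarrow> h < d2 \<Longrightarrow> Y (s\<^sub>0 + h) > 0"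
    using DERIV_pos_inc_right[OF d(1) pos] Y0 by auto
  show ?thesis
  proof (rule ex1I[of _ s\<^sub>0])
    show "changes_sign_at Y s\<^sub>0"
      unfolding changes_sign_at_def
    proof (intro exI[of _ "min d1 d2"] conjI ballI)
      fix s t assume "s \<in> {s\<^sub>0 - min d1 d2<..<s\<^sub>0}" "t \<in> {s\<^sub>0<..<s\<^sub>0 + min d1 d2}"
      then have "Y s < 0" "Y t > 0"
        using d1(2)[of "s\<^sub>0 - s"] d2(2)[of "t - s\<^sub>0"] by auto
      then show "Y s * Y t < 0" by (rule mult_neg_pos)
    qed (use d1 d2 in auto)
  next
    fix s\<^sub>1 assume "changes_sign_at Y s\<^sub>1"
    then obtain \<delta> where \<delta>: "\<delta> > 0" "\<And>s t. s\<^sub>1 - \<delta> < s \<Longrightarrow> s < s\<^sub>1 \<Longrightarrow> s\<^sub>1 < t \<Longrightarrow> t < s\<^sub>1 + \<delta> \<Longrightarrow> Y s * Y t < 0"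
      by (auto simp: changes_sign_at_def)
    show "s\<^sub>1 = s\<^sub>0"
    proof (rule ccontr)
      assume "s\<^sub>1 \<noteq> s\<^sub>0"
      \<comment> \<open>Smaller than the distance to \<open>s\<^sub>0\<close>, so that
        \<open>s\<^sub>1 - h\<close> and \<open>s\<^sub>1 + h\<close> lie on the same side of it,
        where Y has one weak sign.\<close>
      define h where "h = min \<delta> \<bar>s\<^sub>1 - s\<^sub>0\<bar> / 2"
      have h: "h > 0" "h < \<delta>" "h < \<bar>s\<^sub>1 - s\<^sub>0\<bar>"
        using \<delta>(1) \<open>s\<^sub>1 \<noteq> s\<^sub>0\<close> by (auto simp: h_def min_def)
      have "Y (s\<^sub>1 - h) * Y (s\<^sub>1 + h) < 0"
        using h by (intro \<delta>(2)) auto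
      moreover have "Y (s\<^sub>1 - h) * Y (s\<^sub>1 + h) \<ge> 0"
      proof (cases "s\<^sub>1 < s\<^sub>0")
        case True
        then show ?thesis using h by (intro mult_nonpos_nonpos left) auto
      next
        case False
        then show ?thesis using h by (intro mult_nonneg_nonneg right) auto
      qed
      ultimately show False by simp
    qed
  qed
qed

section \<open>First hitting points, choice of parameters, and the slope condition at -\<xi>\<close>

lemma first_hitting_point:
  fixes h :: "real \<Rightarrow> real"
  assumes "l \<le> u" and h: "continuous_on {l..u} h" and "h l < 0" "h u \<ge> 0"
  obtains x where "l < x" "x \<le> u" "h x = 0" "\<And>y. l \<le> y \<Longrightarrow> y \<le> x \<Longrightarrow> h y \<le> 0"
proof -
  define T where "T = {y \<in> {l..u}. 0 \<le> h y}"
  have "closed T"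
  proof -
    have "T = {l..u} \<inter> h -` {0..}" by (auto simp: T_def)
    then show ?thesis using continuous_closed_preimage[OF h closed_atLeastAtMost closed_atLeast[of 0]] by simp
  qed
  moreover have "T \<subseteq> {l..u}" by (auto simp: T_def)
  ultimately have "compact T"
    by (meson bounded_closed_interval bounded_subset compact_eq_bounded_closed)
  moreover have "T \<noteq> {}"
    using assms by (auto simp: T_def)
  ultimately
  obtain x where x: "x \<in> T" "\<And>y. y \<in> T \<Longrightarrow> x \<le> y"
    using compact_attains_inf by metis
  have below: "h y < 0" if "l \<le> y" "y < x" for y
    using x that by (force simp: T_def)
  have lx: "l \<le> x" "x \<le> u" "0 \<le> h x" using x(1) by (auto simp: T_def)
  have "h x = 0"
  proof (rule ccontr)
    assume "h x \<noteq> 0"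
    with IVT'[of h l 0 x] assms lx continuous_on_subset[OF h, of "{l..x}"]
    obtain y where "l \<le> y" "y \<le> x" "h y = 0" by auto
    with below[of y] \<open>h x \<noteq> 0\<close> show False by (cases "y = x") auto
  qed
  moreover have "l < x" using lx assms by (cases "l = x") auto
  ultimately show thesis
    using below lx by (intro that[of x]) (auto simp: le_less)
qed

text \<open>First \<eta> <= C/6 keeps the quadratic term within half of \<eta> C; then \<kappa> is
  chosen, depending on \<eta>, to keep \<kappa> E within a quarter of it.\<close>

lemma transition_parameters_exist:
  fixes B C D E :: real
  assumes "C > 0" "D \<ge> 0"
  obtains \<eta> \<kappa> where "0 < \<eta>" "\<eta> < 1" "0 < \<kappa>" "\<kappa> \<le> 1" "D * \<kappa>\<^sup>2 \<le> 1" "3 * \<eta>\<^sup>2 + \<kappa> * E < \<eta> * C"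
proof -
  define \<eta> where "\<eta> = min (1 / 2) (C / 6)"
  have \<eta>: "0 < \<eta>" "\<eta> < 1" "\<eta> \<le> C / 6" using assms by (auto simp: \<eta>_def)
  define M where "M = \<bar>E\<bar> + 1"
  have M: "M > 0" "E \<le> M" by (auto simp: M_def)
  define \<kappa> where "\<kappa> = min 1 (min (1 / (D + 1)) (\<eta> * C / (4 * M)))"
  have \<kappa>: "0 < \<kappa>" "\<kappa> \<le> 1" "\<kappa> \<le> 1 / (D + 1)" "\<kappa> \<le> \<eta> * C / (4 * M)"
    using assms \<eta> M by (auto simp: \<kappa>_def)
  have "D * \<kappa>\<^sup>2 \<le> D * (\<kappa> * 1)"
    unfolding power2_eq_square using \<kappa> assms by (intro mult_left_mono) auto
  also have "\<dots> \<le> D * (1 / (D + 1))"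
    using \<kappa> assms by (intro mult_left_mono) auto
  also have "\<dots> \<le> 1" using assms by simp
  finally have 1: "D * \<kappa>\<^sup>2 \<le> 1" .
  have "\<eta> * \<eta> \<le> \<eta> * (C / 6)"
    using \<eta> by (intro mult_left_mono) auto
  then have 2: "3 * \<eta>\<^sup>2 \<le> \<eta> * C / 2"
    by (simp add: power2_eq_square)
  have "\<kappa> * E \<le> \<kappa> * M"
    using \<kappa> M by (intro mult_left_mono) auto
  also have "\<dots> \<le> \<eta> * C / (4 * M) * M"
    using \<kappa> M by (intro mult_right_mono) auto
  also have "\<dots> = \<eta> * C / 4"
    using M by simp
  finally have "3 * \<eta>\<^sup>2 + \<kappa> * E < \<eta> * C"
    using 2 \<eta>(1) assms(1) mult_pos_pos[of \<eta> C] by linarith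
  with 1 \<eta> \<kappa> show thesis by (intro that)
qed

text \<open>Otherwise A |f| exceeds \<mu>' / sqrt 2 near -\<xi> for some A below the infimum.
  Multiplied by 3 sqrt \<mu> and integrated from -\<xi>, this bounds sqrt 2 \<mu>^(3/2) by 3 A times
  the integral of |f| sqrt \<mu>, against the definition of the infimum.\<close>

lemma a_star_le:
  assumes "\<xi> > 0" and \<mu>: "\<And>x. (\<mu> has_real_derivative \<mu>' x) (at x)" and \<mu>': "continuous_on UNIV \<mu>'"
    and \<mu>_0: "\<mu> (- \<xi>) = 0" and \<mu>_pos: "\<And>x. - \<xi> < x \<Longrightarrow> x \<le> 0 \<Longrightarrow> \<mu> x > 0"
    and f: "continuous_on UNIV f"
    and "0 < a" "a < a_star \<mu> f \<xi>" "f (- \<xi>) < 0"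
  shows "a * - f (- \<xi>) < \<mu>' (- \<xi>) / sqrt 2"
proof (rule ccontr)
  assume neg: "\<not> a * - f (- \<xi>) < \<mu>' (- \<xi>) / sqrt 2"
  \<comment> \<open>Strictly above \<open>a\<close>, so that the negated inequality becomes strict
    with \<open>A\<close> even if it is an equality with \<open>a\<close>.\<close>
  define A where "A = (a + a_star \<mu> f \<xi>) / 2"
  have A: "a < A" "A < a_star \<mu> f \<xi>" using assms by (auto simp: A_def)
  have \<mu>c: "continuous_on UNIV \<mu>"
    using \<mu> by (auto intro!: continuous_at_imp_continuous_on DERIV_isCont)
  have "a * - f (- \<xi>) < A * - f (- \<xi>)"
    using A assms by (intro mult_strict_right_mono) auto
  with neg have "\<mu>' (- \<xi>) / sqrt 2 < A * - f (- \<xi>)"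
    by linarith
  then have "\<mu>' (- \<xi>) / sqrt 2 < A * \<bar>f (- \<xi>)\<bar>"
    using \<open>f (- \<xi>) < 0\<close> by simp
  moreover have "isCont (\<lambda>x. A * \<bar>f x\<bar> - \<mu>' x / sqrt 2) (- \<xi>)"
    using f \<mu>' by (auto intro!: continuous_intros simp: continuous_on_eq_continuous_at)
  then have "((\<lambda>x. A * \<bar>f x\<bar> - \<mu>' x / sqrt 2) \<longlongrightarrow> A * \<bar>f (- \<xi>)\<bar> - \<mu>' (- \<xi>) / sqrt 2) (at (- \<xi>))"
    by (simp add: isCont_def)
  ultimately have "\<forall>\<^sub>F x in at (- \<xi>). A * \<bar>f x\<bar> - \<mu>' x / sqrt 2 > 0"
    by (intro order_tendstoD(1)) auto
  then obtain d where d: "d > 0" "\<And>x. x \<noteq> - \<xi> \<Longrightarrow> \<bar>x + \<xi>\<bar> < d \<Longrightarrow> \<mu>' x / sqrt 2 < A * \<bar>f x\<bar>"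
    by (auto simp: eventually_at dist_real_def)
  define e where "e = - \<xi> + min (d / 2) \<xi>"
  have e: "- \<xi> < e" "e \<le> 0" "e + \<xi> < d"
    using d(1) \<open>\<xi> > 0\<close> by (auto simp: e_def min_def)
  define I where "I = (LINT t:{-\<xi>..e}|lborel. \<bar>f t\<bar> * sqrt (\<mu> t))"
  have \<mu>_nn: "\<mu> x \<ge> 0" if "- \<xi> \<le> x" "x \<le> 0" for x
    using \<mu>_pos[of x] \<mu>_0 that by (cases "x = - \<xi>") auto
  have int_nn: "(LINT t:{-\<xi>..x}|lborel. \<bar>f t\<bar> * sqrt (\<mu> t)) \<ge> 0" if "x \<le> 0" for x
    unfolding set_lebesgue_integral_def
    using \<mu>_nn that by (intro integral_nonneg_AE AE_I2) (auto simp: indicator_def)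
  have "a_star \<mu> f \<xi> \<le> sqrt 2 * \<mu> e powr (3/2) / (3 * I)"
    unfolding a_star_def I_def
  proof (rule cINF_lower)
    show "bdd_below ((\<lambda>x. sqrt 2 * \<mu> x powr (3 / 2) / (3 * (LINT t:{- \<xi>..x}|lborel. \<bar>f t\<bar> * sqrt (\<mu> t)))) ` {- \<xi><..0})"
      using int_nn by (intro bdd_belowI[of _ 0]) auto
  qed (use e in auto)
  moreover have "I \<ge> 0" unfolding I_def using int_nn e by simp
  \<comment> \<open>Division by zero yields 0, so I = 0 would make the infimum nonpositive.\<close>
  moreover have "I \<noteq> 0"
    using calculation(1) A \<open>0 < a\<close> by auto
  ultimately have I: "I > 0" "a_star \<mu> f \<xi> * (3 * I) \<le> sqrt 2 * \<mu> e powr (3/2)"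
    by (auto simp: field_simps)
  define G where "G = (\<lambda>x. sqrt 2 * (\<mu> x * sqrt (\<mu> x)))"
  have "G e - G (- \<xi>) \<le> (LINT t:{-\<xi>..e}|lborel. 3 * A * (\<bar>f t\<bar> * sqrt (\<mu> t)))"
  proof (rule FTC_le_set_integral[where S = "{}" and \<psi> = "\<lambda>x. 3 / sqrt 2 * (sqrt (\<mu> x) * \<mu>' x)"])
    show "continuous_on {- \<xi>..e} G"
      unfolding G_def by (intro continuous_intros continuous_on_subset[OF \<mu>c]) auto
    show "set_integrable lborel {- \<xi>..e} (\<lambda>t. 3 * A * (\<bar>f t\<bar> * sqrt (\<mu> t)))"
      by (intro set_integrable_continuous continuous_intros continuous_on_subset[OF \<mu>c] continuous_on_subset[OF f]) auto
    fix x assume "x \<in> {- \<xi><..<e} - {}"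
    then have x: "- \<xi> < x" "x < e" by auto
    have pos: "\<mu> x > 0" using \<mu>_pos[of x] x e by simp
    show "3 / sqrt 2 * (sqrt (\<mu> x) * \<mu>' x) \<le> 3 * A * (\<bar>f x\<bar> * sqrt (\<mu> x))"
    proof -
      have "\<mu>' x / sqrt 2 * (3 * sqrt (\<mu> x)) \<le> A * \<bar>f x\<bar> * (3 * sqrt (\<mu> x))"
        using d(2)[of x] x e pos by (intro mult_right_mono) auto
      then show ?thesis by (simp add: mult_ac)
    qed
    have "sqrt 2 * (3 / 2 * (sqrt (\<mu> x) * \<mu>' x)) = 3 / sqrt 2 * (sqrt (\<mu> x) * \<mu>' x)"
      by (simp add: field_simps)
    from DERIV_cong[OF DERIV_cmult[OF DERIV_mult_sqrt[OF \<mu> pos]] this]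
    show "(G has_real_derivative 3 / sqrt 2 * (sqrt (\<mu> x) * \<mu>' x)) (at x)"
      unfolding G_def .
  qed (use e in auto)
  also have "\<dots> = 3 * A * I"
    by (simp add: I_def)
  finally have "G e \<le> 3 * A * I"
    by (simp add: G_def \<mu>_0)
  moreover have "sqrt 2 * \<mu> e powr (3/2) = G e"
  proof -
    have "\<mu> e powr (3/2) = \<mu> e powr (1 + 1/2)" by simp
    also have "\<dots> = \<mu> e * sqrt (\<mu> e)"
      using \<mu>_pos[of e] e by (simp only: powr_add) (simp add: powr_half_sqrt)
    finally show ?thesis by (simp add: G_def)
  qed
  ultimately have "a_star \<mu> f \<xi> * (3 * I) \<le> A * (3 * I)"
    using I(2) by simp
  with I(1) A(2) show False by simp
qed

section \<open>The zero stays in the Painleve scale\<close>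

text \<open>By \<open>far\<close> the zero leaves every window of size \<epsilon>^(2/3). A single
  small \<epsilon> then meets all assumptions of \<open>transition\<close>, and the energy gap
  contradicts minimality on [\<open>x\<^sub>1\<close>, \<open>x\<^sub>2\<close>].\<close>

lemma transition_not_far:
  fixes v :: "real \<Rightarrow> real \<Rightarrow> real"
  assumes "\<xi> > 0" and \<mu>: "\<And>x. (\<mu> has_real_derivative \<mu>' x) (at x)" and \<mu>': "continuous_on UNIV \<mu>'"
    and \<mu>_bd: "\<And>x. \<bar>\<mu> x\<bar> \<le> m" and \<mu>_0: "\<mu> (- \<xi>) = 0" and \<mu>'_pos: "\<mu>' (- \<xi>) > 0"
    and f: "continuous_on UNIV f" and f_int: "integrable lborel f" and f_np: "\<And>x. x \<le> 0 \<Longrightarrow> f x \<le> 0"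
    and "0 < a" and slope: "a * - f (- \<xi>) < \<mu>' (- \<xi>) / sqrt 2"
    and sol: "\<forall>\<^sub>F \<epsilon> in at_right 0. energy_minimizing_solution \<mu> f a \<epsilon> (v \<epsilon>)"
    and lim: "uniform_limit UNIV v (\<lambda>x. sqrt (max (\<mu> x) 0)) (at_right 0)"
    and \<rho>_lim: "(\<rho> \<longlongrightarrow> - \<xi>) (at_right 0)"
    and neg: "\<forall>\<^sub>F \<epsilon> in at_right 0. v \<epsilon> (\<rho> \<epsilon>) = 0 \<and> (\<forall>x<\<rho> \<epsilon>. v \<epsilon> x < 0)"
    and "c\<^sub>1 > 0" "A\<^sub>0 \<ge> 0"
    and v_near: "\<forall>\<^sub>F \<epsilon> in at_right 0. - A\<^sub>0 * \<epsilon> powr (1/3) \<le> v \<epsilon> (- \<xi> + c\<^sub>1 * \<epsilon> powr (2/3))"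
    and far: "\<And>K. \<forall>\<^sub>F \<epsilon> in at_right 0. - \<xi> + K * \<epsilon> powr (2/3) < \<rho> \<epsilon>"
  shows False
proof -
  define m\<^sub>1 where "m\<^sub>1 = \<mu>' (- \<xi>)"
  \<comment> \<open>Half of the gap in \<open>slope\<close>. Like the bounds
    \<open>m\<^sub>1 / 2\<close> and \<open>2 * m\<^sub>1\<close> on \<mu>' below, it leaves slack
    that persists in a neighbourhood by continuity.\<close>
  define c\<^sub>0 where "c\<^sub>0 = (m\<^sub>1 / sqrt 2 - a * - f (- \<xi>)) / 2"
  have "m\<^sub>1 > 0" "c\<^sub>0 > 0" using \<mu>'_pos slope by (auto simp: m\<^sub>1_def c\<^sub>0_def)
  have \<mu>c: "continuous_on UNIV \<mu>"
    using \<mu> by (auto intro!: continuous_at_imp_continuous_on DERIV_isCont)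
  have t1: "(\<mu>' \<longlongrightarrow> m\<^sub>1) (nhds (- \<xi>))"
    using \<mu>' by (simp add: continuous_on_eq_continuous_at m\<^sub>1_def isCont_def tendsto_at_iff_tendsto_nhds)
  have "isCont (\<lambda>x. \<mu>' x / sqrt 2 - (- a * f x)) (- \<xi>)"
    using f \<mu>' by (auto intro!: continuous_intros simp: continuous_on_eq_continuous_at)
  then have t2: "((\<lambda>x. \<mu>' x / sqrt 2 - (- a * f x)) \<longlongrightarrow> 2 * c\<^sub>0) (nhds (- \<xi>))"
  proof -
    have "2 * c\<^sub>0 = \<mu>' (- \<xi>) / sqrt 2 - (- a * f (- \<xi>))"
      unfolding c\<^sub>0_def m\<^sub>1_def by simp
    then show ?thesis
      using \<open>isCont _ _\<close> tendsto_at_iff_tendsto_nhds[of "\<lambda>x. \<mu>' x / sqrt 2 - (- a * f x)" "- \<xi>"]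
      by (simp only: isCont_def)
  qed
  have "\<forall>\<^sub>F x in nhds (- \<xi>). m\<^sub>1 / 2 < \<mu>' x \<and> \<mu>' x < 2 * m\<^sub>1 \<and> c\<^sub>0 < \<mu>' x / sqrt 2 - (- a * f x)"
    using \<open>m\<^sub>1 > 0\<close> \<open>c\<^sub>0 > 0\<close>
    by (intro eventually_conj order_tendstoD(1)[OF t1] order_tendstoD(2)[OF t1] order_tendstoD(1)[OF t2]) auto
  then obtain \<delta> where \<delta>: "\<delta> > 0" "\<And>x. \<bar>x + \<xi>\<bar> < \<delta> \<Longrightarrow>
      m\<^sub>1 / 2 < \<mu>' x \<and> \<mu>' x < 2 * m\<^sub>1 \<and> c\<^sub>0 < \<mu>' x / sqrt 2 - (- a * f x)"
    by (auto simp: eventually_nhds_metric dist_real_def)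
  define d where "d = min (\<delta> / 2) (\<xi> / 2)"
  have d: "d > 0" "d < \<delta>" "d < \<xi>" using \<delta>(1) \<open>\<xi> > 0\<close> by (auto simp: d_def)
  have near: "m\<^sub>1 / 2 \<le> \<mu>' x \<and> \<mu>' x \<le> 2 * m\<^sub>1" "0 \<le> - a * f x \<and> c\<^sub>0 \<le> \<mu>' x / sqrt 2 - (- a * f x)"
    if "- \<xi> \<le> x" "x \<le> - \<xi> + d" for x
    using \<delta>(2)[of x] that d f_np[of x] \<open>0 < a\<close> by (auto simp: mult_nonneg_nonpos)
  have \<mu>_ge: "m\<^sub>1 / 2 * (x + \<xi>) \<le> \<mu> x" if x: "- \<xi> \<le> x" "x \<le> - \<xi> + d" for x
  proof (cases "x = - \<xi>")
    case False
    with x have "- \<xi> < x" by simp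
    from MVT2[OF this, of \<mu> \<mu>'] \<mu>
    obtain z where z: "- \<xi> < z" "z < x" "\<mu> x - \<mu> (- \<xi>) = (x - - \<xi>) * \<mu>' z" by blast
    have "m\<^sub>1 / 2 \<le> \<mu>' z" using near(1)[of z] z x by simp
    then have "m\<^sub>1 / 2 * (x + \<xi>) \<le> \<mu>' z * (x + \<xi>)"
      using x by (intro mult_right_mono) auto
    with z \<mu>_0 show ?thesis by (simp add: mult.commute)
  qed (simp add: \<mu>_0)
  define b B where "b = m\<^sub>1 / 2" and "B = 2 * m\<^sub>1"
  have bB: "b > 0" "B > 0" using \<open>m\<^sub>1 > 0\<close> by (auto simp: b_def B_def)
  obtain \<eta> \<kappa> where \<eta>\<kappa>: "0 < \<eta>" "\<eta> < 1" "0 < \<kappa>" "\<kappa> \<le> 1" "((c\<^sub>1 + 2) * B) * \<kappa>\<^sup>2 \<le> 1"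
    "3 * \<eta>\<^sup>2 + \<kappa> * error_const b B c\<^sub>0 A\<^sub>0 c\<^sub>1 < \<eta> * (2 * c\<^sub>0 / (3 * B))"
    using transition_parameters_exist[of "2 * c\<^sub>0 / (3 * B)" "(c\<^sub>1 + 2) * B"] bB \<open>c\<^sub>0 > 0\<close> \<open>c\<^sub>1 > 0\<close> by auto
  \<comment> \<open>K >= \<open>c\<^sub>1\<close> puts \<open>x\<^sub>1\<close> to the left of the
    zero, where v < 0. K >= 1 / (\<kappa>^2 b) gives r <= \<kappa> sqrt
    (\<open>\<mu> x\<^sub>2\<close>), because \<open>\<mu> x\<^sub>2\<close> is at least b
    (\<open>x\<^sub>2\<close> + \<xi>).\<close>
  define K where "K = max c\<^sub>1 (1 / (\<kappa>\<^sup>2 * b))"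
  define e where "e = - \<xi> + d"
  have \<mu>e: "\<mu> e > 0"
  proof -
    have "0 < m\<^sub>1 / 2 * d" using d(1) \<open>m\<^sub>1 > 0\<close> by simp
    also have "\<dots> \<le> \<mu> e" using \<mu>_ge[of e] d by (simp add: e_def)
    finally show ?thesis .
  qed
  have "(1 - \<eta>) * sqrt (\<mu> e) < sqrt (\<mu> e)"
    using \<eta>\<kappa>(1) \<mu>e by simp
  moreover have "((\<lambda>\<epsilon>. v \<epsilon> e) \<longlongrightarrow> sqrt (max (\<mu> e) 0)) (at_right 0)"
    by (rule tendsto_uniform_limitI[OF lim]) simp
  ultimately have ev_e: "\<forall>\<^sub>F \<epsilon> in at_right 0. (1 - \<eta>) * sqrt (\<mu> e) < v \<epsilon> e"
    using \<mu>e by (intro order_tendstoD(1)) auto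
  have ev_\<rho>: "\<forall>\<^sub>F \<epsilon> in at_right 0. \<rho> \<epsilon> < e"
    using \<rho>_lim d by (intro order_tendstoD(2)) (auto simp: e_def)
  have ev_bd: "\<forall>\<^sub>F \<epsilon> in at_right 0. \<forall>x\<in>UNIV. dist (v \<epsilon> x) (sqrt (max (\<mu> x) 0)) < 1"
    using lim by (rule uniform_limitD) simp
  have ev_pos: "\<forall>\<^sub>F \<epsilon> in at_right (0::real). \<epsilon> > 0"
    by (simp add: eventually_at_right_less)
  have "\<forall>\<^sub>F \<epsilon> in at_right 0. \<epsilon> > 0 \<and> energy_minimizing_solution \<mu> f a \<epsilon> (v \<epsilon>)
      \<and> (v \<epsilon> (\<rho> \<epsilon>) = 0 \<and> (\<forall>x<\<rho> \<epsilon>. v \<epsilon> x < 0))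
      \<and> - A\<^sub>0 * \<epsilon> powr (1/3) \<le> v \<epsilon> (- \<xi> + c\<^sub>1 * \<epsilon> powr (2/3)) \<and> - \<xi> + K * \<epsilon> powr (2/3) < \<rho> \<epsilon>
      \<and> (1 - \<eta>) * sqrt (\<mu> e) < v \<epsilon> e \<and> \<rho> \<epsilon> < e \<and> (\<forall>x\<in>UNIV. dist (v \<epsilon> x) (sqrt (max (\<mu> x) 0)) < 1)"
    by (intro eventually_conj ev_pos sol neg v_near far ev_e ev_\<rho> ev_bd)
  then obtain \<epsilon> where \<epsilon>: "\<epsilon> > 0" "energy_minimizing_solution \<mu> f a \<epsilon> (v \<epsilon>)"
      "v \<epsilon> (\<rho> \<epsilon>) = 0" "\<And>x. x < \<rho> \<epsilon> \<Longrightarrow> v \<epsilon> x < 0"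
      "- A\<^sub>0 * \<epsilon> powr (1/3) \<le> v \<epsilon> (- \<xi> + c\<^sub>1 * \<epsilon> powr (2/3))" "- \<xi> + K * \<epsilon> powr (2/3) < \<rho> \<epsilon>"
      "(1 - \<eta>) * sqrt (\<mu> e) < v \<epsilon> e" "\<rho> \<epsilon> < e" "\<And>x. dist (v \<epsilon> x) (sqrt (max (\<mu> x) 0)) < 1"
    using eventually_happens'[OF trivial_limit_at_right_real] by blast
  define r where "r = \<epsilon> powr (1/3)"
  have r: "r > 0" "r ^ 3 = \<epsilon>" "r\<^sup>2 = \<epsilon> powr (2/3)"
    using \<epsilon>(1) by (auto simp: r_def powr_power)
  have C2: "C2_on UNIV (v \<epsilon>)" using \<epsilon>(2) by (simp add: energy_minimizing_solution_def)
  note v = C2_on_UNIV_derivatives[OF C2]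
  define x\<^sub>1 where "x\<^sub>1 = - \<xi> + c\<^sub>1 * r\<^sup>2"
  have "c\<^sub>1 * r\<^sup>2 \<le> K * r\<^sup>2" by (intro mult_right_mono) (auto simp: K_def)
  then have x\<^sub>1: "- \<xi> < x\<^sub>1" "x\<^sub>1 < \<rho> \<epsilon>"
    using \<epsilon>(6) \<open>c\<^sub>1 > 0\<close> r by (auto simp: x\<^sub>1_def)
  \<comment> \<open>Negative at the zero of \<open>v\<close> and, by uniform convergence,
    nonnegative at the fixed point \<open>e\<close>; its first zero serves as
    \<open>x\<^sub>2\<close>.\<close>
  define h where "h = (\<lambda>x. v \<epsilon> x - (1 - \<eta>) * sqrt (\<mu> x))"
  have "continuous_on {\<rho> \<epsilon>..e} h"
    unfolding h_def by (intro continuous_intros continuous_on_subset[OF v(4)] continuous_on_subset[OF \<mu>c]) auto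
  moreover have "h (\<rho> \<epsilon>) < 0"
  proof -
    have "0 < m\<^sub>1 / 2 * (\<rho> \<epsilon> + \<xi>)" using x\<^sub>1 \<open>m\<^sub>1 > 0\<close> by simp
    also have "\<dots> \<le> \<mu> (\<rho> \<epsilon>)" using x\<^sub>1 \<epsilon>(8) by (intro \<mu>_ge) (auto simp: e_def)
    finally show ?thesis using \<eta>\<kappa>(1,2) \<epsilon>(3) by (simp add: h_def)
  qed
  moreover have "h e \<ge> 0" using \<epsilon>(7) by (simp add: h_def)
  ultimately obtain x\<^sub>2 where x\<^sub>2: "\<rho> \<epsilon> < x\<^sub>2" "x\<^sub>2 \<le> e" "h x\<^sub>2 = 0"
    "\<And>y. \<rho> \<epsilon> \<le> y \<Longrightarrow> y \<le> x\<^sub>2 \<Longrightarrow> h y \<le> 0"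
    using first_hitting_point[of "\<rho> \<epsilon>" e h] \<epsilon>(8) by auto
  have N: "r \<le> \<kappa> * sqrt (\<mu> x\<^sub>2)"
  proof -
    have "1 / (\<kappa>\<^sup>2 * b) * r\<^sup>2 \<le> K * r\<^sup>2" by (intro mult_right_mono) (auto simp: K_def)
    also have "\<dots> \<le> x\<^sub>2 + \<xi>" using \<epsilon>(6) x\<^sub>2(1) r by simp
    finally have "(\<kappa>\<^sup>2 * b) * (1 / (\<kappa>\<^sup>2 * b) * r\<^sup>2) \<le> (\<kappa>\<^sup>2 * b) * (x\<^sub>2 + \<xi>)"
      using bB by (intro mult_left_mono) auto
    then have "r\<^sup>2 \<le> \<kappa>\<^sup>2 * (b * (x\<^sub>2 + \<xi>))"
      using bB \<eta>\<kappa>(3) by (simp add: mult.assoc)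
    also have "\<dots> \<le> \<kappa>\<^sup>2 * \<mu> x\<^sub>2"
      using \<mu>_ge[of x\<^sub>2] x\<^sub>1 x\<^sub>2 by (intro mult_left_mono) (auto simp: b_def e_def)
    finally have "sqrt (r\<^sup>2) \<le> sqrt (\<kappa>\<^sup>2 * \<mu> x\<^sub>2)"
      by (rule real_sqrt_le_mono)
    then show ?thesis using r(1) \<eta>\<kappa>(3) by (simp add: real_sqrt_mult)
  qed
  interpret transition \<mu> \<mu>' f "v \<epsilon>" "deriv (v \<epsilon>)" "- \<xi>" x\<^sub>2 a b B c\<^sub>0 A\<^sub>0 c\<^sub>1 r \<eta> \<kappa> x\<^sub>1 "sqrt (\<mu> x\<^sub>2)" "r ^ 3"
  proof unfold_locales
    show "x\<^sub>1 \<equiv> - \<xi> + c\<^sub>1 * r\<^sup>2" by (simp add: x\<^sub>1_def)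
    show "b \<le> \<mu>' x \<and> \<mu>' x \<le> B" "0 \<le> - a * f x \<and> c\<^sub>0 \<le> \<mu>' x / sqrt 2 - - a * f x" if "- \<xi> \<le> x" "x \<le> x\<^sub>2" for x
      using near[of x] that x\<^sub>2 by (auto simp: b_def B_def e_def)
    show "- A\<^sub>0 * r \<le> v \<epsilon> (- \<xi> + c\<^sub>1 * r\<^sup>2)" using \<epsilon>(5) r by (simp add: r_def)
    show "v \<epsilon> (- \<xi> + c\<^sub>1 * r\<^sup>2) \<le> 0" using \<epsilon>(4)[OF x\<^sub>1(2)] by (simp add: x\<^sub>1_def)
    show "v \<epsilon> x \<le> (1 - \<eta>) * sqrt (\<mu> x)" if le: "- \<xi> + c\<^sub>1 * r\<^sup>2 \<le> x" and "x \<le> x\<^sub>2" for x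
    proof (cases "x < \<rho> \<epsilon>")
      note that = le[folded x\<^sub>1_def] \<open>x \<le> x\<^sub>2\<close>
      case True
      have "0 \<le> m\<^sub>1 / 2 * (x + \<xi>)" using x\<^sub>1 that \<open>m\<^sub>1 > 0\<close> by simp
      also have "\<dots> \<le> \<mu> x" using x\<^sub>1 x\<^sub>2 that by (intro \<mu>_ge) (auto simp: e_def)
      finally have "0 \<le> (1 - \<eta>) * sqrt (\<mu> x)" using \<eta>\<kappa>(2) by simp
      with \<epsilon>(4)[OF True] show ?thesis by simp
    next
      case False
      with x\<^sub>2(4)[of x] that show ?thesis by (simp add: h_def)
    qed
    show "v \<epsilon> x\<^sub>2 = (1 - \<eta>) * sqrt (\<mu> x\<^sub>2)" using x\<^sub>2(3) by (simp add: h_def)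
    show "- \<xi> < x\<^sub>2" using x\<^sub>1 x\<^sub>2 by simp
  qed (use bB \<open>c\<^sub>0 > 0\<close> \<open>A\<^sub>0 \<ge> 0\<close> \<open>c\<^sub>1 > 0\<close> r \<eta>\<kappa> \<mu> \<mu>' \<mu>_0 f v N in auto)
  have v_bd: "\<bar>v \<epsilon> x\<bar> \<le> 1 + sqrt m" for x
  proof -
    have "max (\<mu> x) 0 \<le> m" using \<mu>_bd[of x] by auto
    then have "sqrt (max (\<mu> x) 0) \<le> sqrt m" by (rule real_sqrt_le_mono)
    moreover have "sqrt (max (\<mu> x) 0) \<ge> 0" by simp
    ultimately show ?thesis using \<epsilon>(9)[of x] unfolding dist_real_def by linarith
  qed
  obtain C where C: "\<And>x. x \<in> {x\<^sub>1..x\<^sub>2} \<Longrightarrow> \<bar>w' x\<bar> \<le> C" using w'_bounded by blast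
  have "(LINT x:{x\<^sub>1..x\<^sub>2}|lborel. lagrangian \<mu> f a \<epsilon> x (v \<epsilon> x) (deriv (v \<epsilon>) x))
      \<le> (LINT x:{x\<^sub>1..x\<^sub>2}|lborel. lagrangian \<mu> f a \<epsilon> x (w x) (w' x))"
    by (rule minimizer_local_lagrangian_le[where S = "{y\<^sub>1, y\<^sub>2}", OF \<epsilon>(2) v_bd \<mu>c \<mu>_bd f_int f _ w_cont w_ends _ w_deriv w'_meas C])
      (use order in auto)
  with energy_gap show False by (simp add: r)
qed

lemma same_sign_if_no_zero:
  fixes v :: "real \<Rightarrow> real"
  assumes v: "continuous_on UNIV v" and nz: "\<And>z. z \<in> {min x y..max x y} \<Longrightarrow> v z \<noteq> 0"
  shows "v x > 0 \<longleftrightarrow> v y > 0"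
proof -
  have *: "v s > 0 \<longleftrightarrow> v t > 0" if st: "s \<le> t" and nz: "\<And>z. z \<in> {s..t} \<Longrightarrow> v z \<noteq> 0" for s t
  proof (rule ccontr)
    assume "\<not> ?thesis"
    then have "v s \<le> 0 \<and> 0 \<le> v t \<or> v t \<le> 0 \<and> 0 \<le> v s" by auto
    then have "\<exists>z\<ge>s. z \<le> t \<and> v z = 0"
      using IVT'[of v s 0 t] IVT2'[of v t 0 s] st continuous_on_subset[OF v] by auto
    with nz show False by (metis atLeastAtMost_iff)
  qed
  show ?thesis
  proof (cases "x \<le> y")
    case True
    show ?thesis by (rule *[OF True]) (use nz True in simp)
  next
    case False
    then have "y \<le> x" by simp
    show ?thesis by (rule *[OF \<open>y \<le> x\<close>, symmetric]) (use nz \<open>y \<le> x\<close> in simp)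
  qed
qed

section \<open>Transfer of signs from the minimizers to their blow-up limit\<close>

theorem theorem1p1:
  fixes \<xi> a \<alpha> :: real
    and \<mu> f Y :: "real \<Rightarrow> real"
    and v :: "real \<Rightarrow> real \<Rightarrow> real"
    and \<rho> :: "real \<Rightarrow> real"
  assumes "\<xi> > 0"
    and "\<mu> C1_differentiable_on UNIV" and "bounded (range \<mu>)"
    and "\<And>x. \<mu> (- x) = \<mu> x"
    and "\<And>x. x > 0 \<Longrightarrow> deriv \<mu> x < 0"
    and "\<mu> \<xi> = 0"
    and "integrable lborel f" and "bounded (range f)" and "continuous_on UNIV f"
    and "\<And>x. f (- x) = - f x"
    and "\<And>x. x > 0 \<Longrightarrow> f x > 0"
    and "\<exists>\<delta>>0. C2_on (ball (- \<xi>) \<delta>) \<mu> \<and> C2_on (ball (- \<xi>) \<delta>) f"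
    and "0 < a" and "a < a_star \<mu> f \<xi>"
    and "\<forall>\<^sub>F \<epsilon> in at_right 0. energy_minimizing_solution \<mu> f a \<epsilon> (v \<epsilon>)"
    and "uniform_limit UNIV v (\<lambda>x. sqrt (max (\<mu> x) 0)) (at_right 0)"
    and "\<forall>\<^sub>F \<epsilon> in at_right 0. \<forall>x. v \<epsilon> x = 0 \<longleftrightarrow> x = \<rho> \<epsilon>"
    and "(\<rho> \<longlongrightarrow> - \<xi>) (at_right 0)"
    and "\<alpha> = a * f (- \<xi>) / (sqrt 2 * deriv \<mu> (- \<xi>))"
    and "PII_solution \<alpha> Y" and "PII_minimal \<alpha> Y"
    and "C1_loc_limit
          (\<lambda>\<epsilon> s. 2 powr (- 1/2) * (deriv \<mu> (- \<xi>) * \<epsilon>) powr (- 1/3)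
                    * v \<epsilon> (- \<xi> - \<epsilon> powr (2/3) * s / (deriv \<mu> (- \<xi>)) powr (1/3)))
          (\<lambda>s. - Y s) (at_right 0)"
  shows "\<exists>!s\<^sub>0. changes_sign_at Y s\<^sub>0"
proof -
  note \<xi> = assms(1) and even = assms(4) and odd = assms(10) and sol = assms(15) and lim = assms(16)
    and zeros = assms(17) and \<rho>_lim = assms(18) and Y = assms(20)
  have \<mu>: "(\<mu> has_real_derivative deriv \<mu> x) (at x)" for x
    using assms(2) by (auto simp: C1_differentiable_on_eq DERIV_deriv_iff_real_differentiable)
  have \<mu>': "continuous_on UNIV (deriv \<mu>)"
  proof -
    have "vector_derivative \<mu> (at x) = deriv \<mu> x" for x
      using \<mu>[of x] by (simp add: has_real_derivative_iff_has_vector_derivative vector_derivative_at)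
    then show ?thesis using assms(2) by (simp add: C1_differentiable_on_eq)
  qed
  have deriv_odd: "deriv \<mu> (- x) = - deriv \<mu> x" for x
  proof -
    have "((\<lambda>x. \<mu> (- x)) has_real_derivative deriv \<mu> (- x) * - 1) (at x)"
      by (rule DERIV_chain2[OF \<mu>]) (auto intro!: derivative_eq_intros)
    then have "(\<mu> has_real_derivative - deriv \<mu> (- x)) (at x)" by (simp add: even)
    from DERIV_unique[OF \<mu> this] show ?thesis by simp
  qed
  have \<mu>_0: "\<mu> (- \<xi>) = 0" by (simp add: even assms(6))
  have \<mu>_pos: "\<mu> x > 0" if x: "- \<xi> < x" "x \<le> 0" for x
  proof -
    obtain z where z: "- \<xi> < z" "z < x" "\<mu> x - \<mu> (- \<xi>) = (x - - \<xi>) * deriv \<mu> z"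
      using MVT2[OF x(1), of \<mu> "deriv \<mu>"] \<mu> by blast
    have "deriv \<mu> z > 0" using assms(5)[of "- z"] deriv_odd[of z] z x by simp
    with z x \<mu>_0 show ?thesis by simp
  qed
  have f_neg: "f x < 0" if "x < 0" for x
    using assms(11)[of "- x"] odd[of x] that by simp
  have f_np: "f x \<le> 0" if "x \<le> 0" for x
    using f_neg[of x] odd[of 0] that by (cases "x = 0") auto
  define m\<^sub>1 where "m\<^sub>1 = deriv \<mu> (- \<xi>)"
  have m\<^sub>1: "m\<^sub>1 > 0" using assms(5)[OF \<xi>] deriv_odd[of \<xi>] by (simp add: m\<^sub>1_def)
  have "\<alpha> < 0"
    using f_neg[of "- \<xi>"] \<xi> assms(13,19) m\<^sub>1 by (simp add: m\<^sub>1_def divide_neg_pos mult_pos_neg)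
  have ev_pos: "\<forall>\<^sub>F \<epsilon> in at_right (0::real). \<epsilon> > 0"
    by (simp add: eventually_at_right_less)
  \<comment> \<open>\<open>X\<close> decreases in s, and \<open>R\<close> has the sign of
    \<open>v\<close> at \<open>X\<close> but tends to -Y. Thus Y > 0 at s forces v < 0 at the
    corresponding point for small \<epsilon>.\<close>
  define X where "X = (\<lambda>\<epsilon> s. - \<xi> - \<epsilon> powr (2/3) * s / m\<^sub>1 powr (1/3))"
  define R where "R = (\<lambda>\<epsilon> s. 2 powr (- 1/2) * (m\<^sub>1 * \<epsilon>) powr (- 1/3) * v \<epsilon> (X \<epsilon> s))"
  have R_lim: "((\<lambda>\<epsilon>. R \<epsilon> s) \<longlongrightarrow> - Y s) (at_right 0)" for s
  proof -
    have "C1_loc_limit R (\<lambda>s. - Y s) (at_right 0)"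
      unfolding R_def X_def m\<^sub>1_def by (rule assms(22))
    then have "uniform_limit {s} R (\<lambda>s. - Y s) (at_right 0)"
      unfolding C1_loc_limit_def by (simp del: uniform_limit_singleton)
    then show ?thesis by (rule tendsto_uniform_limitI) simp
  qed
  have R_sgn: "R \<epsilon> s < 0 \<longleftrightarrow> v \<epsilon> (X \<epsilon> s) < 0" "R \<epsilon> s > 0 \<longleftrightarrow> v \<epsilon> (X \<epsilon> s) > 0" if "\<epsilon> > 0" for \<epsilon> s
    using that m\<^sub>1 by (auto simp: R_def mult_less_0_iff zero_less_mult_iff)
  have ev_neg: "\<forall>\<^sub>F \<epsilon> in at_right 0. v \<epsilon> (X \<epsilon> s) < 0" if "Y s > 0" for s
    using order_tendstoD(2)[OF R_lim, of s 0] that ev_pos by (auto elim: eventually_elim2 simp: R_sgn)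
  have ev_posv: "\<forall>\<^sub>F \<epsilon> in at_right 0. v \<epsilon> (X \<epsilon> s) > 0" if "Y s < 0" for s
    using order_tendstoD(1)[OF R_lim, of 0 s] that ev_pos by (auto elim: eventually_elim2 simp: R_sgn)
  obtain p where p: "Y p > 0"
    using PII_solution_not_nonpos[OF Y \<open>\<alpha> < 0\<close>] by blast
  \<comment> \<open>A single zero leaves one sign on each side. On the right it is that of
    \<open>v \<epsilon> 0\<close>, which tends to sqrt (\<mu> 0) > 0; on the left it is negative,
    because v < 0 at \<open>X \<epsilon> p\<close>.\<close>
  have signs: "\<forall>\<^sub>F \<epsilon> in at_right 0. (\<forall>x<\<rho> \<epsilon>. v \<epsilon> x < 0) \<and> (\<forall>x>\<rho> \<epsilon>. v \<epsilon> x > 0)"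
  proof -
    have v0: "((\<lambda>\<epsilon>. v \<epsilon> 0) \<longlongrightarrow> sqrt (max (\<mu> 0) 0)) (at_right 0)"
      by (rule tendsto_uniform_limitI[OF lim]) simp
    have ev0: "\<forall>\<^sub>F \<epsilon> in at_right 0. v \<epsilon> 0 > 0"
      by (rule order_tendstoD(1)[OF v0]) (use \<mu>_pos[of 0] \<xi> in simp)
    have ev\<rho>: "\<forall>\<^sub>F \<epsilon> in at_right 0. \<rho> \<epsilon> < 0"
      by (rule order_tendstoD(2)[OF \<rho>_lim]) (use \<xi> in simp)
    show ?thesis
      using sol zeros ev0 ev\<rho> ev_neg[OF p]
    proof eventually_elim
      case (elim \<epsilon>)
      have c: "continuous_on UNIV (v \<epsilon>)"
        using elim(1) C2_on_UNIV_derivatives(4) by (simp add: energy_minimizing_solution_def)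
      have same: "v \<epsilon> x > 0 \<longleftrightarrow> v \<epsilon> y > 0" if "\<rho> \<epsilon> < x \<and> \<rho> \<epsilon> < y \<or> x < \<rho> \<epsilon> \<and> y < \<rho> \<epsilon>" for x y
      proof (rule same_sign_if_no_zero[OF c])
        fix z assume "z \<in> {min x y..max x y}"
        with that have "z \<noteq> \<rho> \<epsilon>" by (auto simp: min_def max_def split: if_splits)
        with elim(2) show "v \<epsilon> z \<noteq> 0" by simp
      qed
      have right: "v \<epsilon> x > 0" if "x > \<rho> \<epsilon>" for x
        using same[of x 0] elim(3,4) that by simp
      have "X \<epsilon> p \<noteq> \<rho> \<epsilon>"
        using elim(2,5) by (metis less_irrefl)
      then have Xp: "X \<epsilon> p < \<rho> \<epsilon>"
        using right[of "X \<epsilon> p"] elim(5) by linarith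
      have "v \<epsilon> x < 0" if "x < \<rho> \<epsilon>" for x
      proof -
        have "v \<epsilon> x \<noteq> 0" using elim(2) that by (metis less_irrefl)
        moreover have "\<not> v \<epsilon> x > 0"
          using same[of x "X \<epsilon> p"] Xp elim(5) that by simp
        ultimately show ?thesis by linarith
      qed
      with right show ?case by blast
    qed
  qed
  have \<rho>_gt: "\<forall>\<^sub>F \<epsilon> in at_right 0. X \<epsilon> s < \<rho> \<epsilon>" if "Y s > 0" for s
    using signs zeros ev_neg[OF that] by eventually_elim (metis less_asym' linorder_neqE_linordered_idom less_irrefl)
  have \<rho>_lt: "\<forall>\<^sub>F \<epsilon> in at_right 0. X \<epsilon> s > \<rho> \<epsilon>" if "Y s < 0" for s
    using signs zeros ev_posv[OF that] by eventually_elim (metis less_asym' linorder_neqE_linordered_idom less_irrefl)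
  \<comment> \<open>One \<epsilon> locates both points relative to the zero, and \<open>X\<close>
    reverses the order.\<close>
  have ord: "s < t" if "Y s < 0" "Y t > 0" for s t
  proof -
    have "\<forall>\<^sub>F \<epsilon> in at_right 0. X \<epsilon> t < \<rho> \<epsilon> \<and> \<rho> \<epsilon> < X \<epsilon> s \<and> \<epsilon> > 0"
      by (intro eventually_conj \<rho>_lt \<rho>_gt that ev_pos)
    then obtain \<epsilon> where "X \<epsilon> t < \<rho> \<epsilon>" "\<rho> \<epsilon> < X \<epsilon> s" and \<epsilon>: "\<epsilon> > 0"
      using eventually_happens'[OF trivial_limit_at_right_real] by blast
    then have "\<epsilon> powr (2/3) * s / m\<^sub>1 powr (1/3) < \<epsilon> powr (2/3) * t / m\<^sub>1 powr (1/3)"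
      by (simp add: X_def)
    then show ?thesis using \<epsilon> m\<^sub>1 by (simp add: divide_less_cancel)
  qed
  have "\<exists>n. Y n < 0"
  proof (rule ccontr)
    assume "\<not> (\<exists>n. Y n < 0)"
    then have Y_pos: "Y s > 0" for s
      using PII_nonneg_imp_pos[OF Y \<open>\<alpha> < 0\<close>] by (simp add: not_less)
    obtain M where M: "\<And>x. \<bar>\<mu> x\<bar> \<le> M"
      using assms(3) by (auto simp: bounded_iff)
    \<comment> \<open>With this value \<open>- \<xi> + c\<^sub>1 * \<epsilon> powr (2/3)\<close> is
      \<open>X \<epsilon> (- 1)\<close>. The constant \<open>A\<^sub>0\<close> is the limit Y (-1)
      of -R there plus a slack of 1, with the scaling of \<open>R\<close> undone.\<close>
    define c\<^sub>1 where "c\<^sub>1 = 1 / m\<^sub>1 powr (1/3)"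
    define A\<^sub>0 where "A\<^sub>0 = (Y (- 1) + 1) * 2 powr (1/2) * m\<^sub>1 powr (1/3)"
    show False
    proof (rule transition_not_far[of \<xi> \<mu> "deriv \<mu>" M f a v \<rho> c\<^sub>1 A\<^sub>0])
      show "a * - f (- \<xi>) < deriv \<mu> (- \<xi>) / sqrt 2"
        by (rule a_star_le[OF \<xi> \<mu> \<mu>' \<mu>_0 \<mu>_pos assms(9,13,14) f_neg]) (use \<xi> in auto)
      show "\<forall>\<^sub>F \<epsilon> in at_right 0. v \<epsilon> (\<rho> \<epsilon>) = 0 \<and> (\<forall>x<\<rho> \<epsilon>. v \<epsilon> x < 0)"
        using signs zeros by eventually_elim auto
      show "\<forall>\<^sub>F \<epsilon> in at_right 0. - A\<^sub>0 * \<epsilon> powr (1/3) \<le> v \<epsilon> (- \<xi> + c\<^sub>1 * \<epsilon> powr (2/3))"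
        using order_tendstoD(1)[OF R_lim, of "- (Y (- 1) + 1)" "- 1"] ev_pos
      proof (rule eventually_elim2)
        fix \<epsilon> :: real assume R: "- (Y (- 1) + 1) < R \<epsilon> (- 1)" and "\<epsilon> > 0"
        define S where "S = 2 powr (1/2) * (m\<^sub>1 * \<epsilon>) powr (1/3)"
        have S: "S > 0" using m\<^sub>1 \<open>\<epsilon> > 0\<close> by (simp add: S_def)
        have "R \<epsilon> (- 1) = v \<epsilon> (X \<epsilon> (- 1)) / S"
          using powr_minus_divide[of "2 :: real" "1/2"] powr_minus_divide[of "m\<^sub>1 * \<epsilon>" "1/3"]
          by (simp add: R_def S_def)
        with R S have "- (Y (- 1) + 1) * S < v \<epsilon> (X \<epsilon> (- 1))"
          by (simp add: pos_less_divide_eq)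
        moreover have "- (Y (- 1) + 1) * S = - A\<^sub>0 * \<epsilon> powr (1/3)"
          using m\<^sub>1 \<open>\<epsilon> > 0\<close> by (simp add: A\<^sub>0_def S_def powr_mult algebra_simps)
        moreover have "X \<epsilon> (- 1) = - \<xi> + c\<^sub>1 * \<epsilon> powr (2/3)"
          by (simp add: X_def c\<^sub>1_def)
        ultimately show "- A\<^sub>0 * \<epsilon> powr (1/3) \<le> v \<epsilon> (- \<xi> + c\<^sub>1 * \<epsilon> powr (2/3))"
          by simp
      qed simp
      \<comment> \<open>The parameter \<open>- (K * m\<^sub>1 powr (1/3))\<close> is the one that
        \<open>X\<close> sends to \<open>- \<xi> + K * \<epsilon> powr (2/3)\<close>; positivity of
        Y there places the zero further to the right.\<close>
      show "\<forall>\<^sub>F \<epsilon> in at_right 0. - \<xi> + K * \<epsilon> powr (2/3) < \<rho> \<epsilon>" for K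
        using \<rho>_gt[OF Y_pos[of "- (K * m\<^sub>1 powr (1/3))"]] m\<^sub>1 by (simp add: X_def mult.commute)
    qed (use \<xi> \<mu> \<mu>' M \<mu>_0 m\<^sub>1 assms(7,9,13) f_np sol lim \<rho>_lim Y_pos[of "- 1"] in \<open>auto simp: m\<^sub>1_def c\<^sub>1_def A\<^sub>0_def\<close>)
  qed
  then obtain n where "Y n < 0" by blast
  from PII_unique_sign_change[OF Y \<open>\<alpha> < 0\<close> p this ord] show ?thesis .
qed

end
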